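(* Let $X$ be a complex Banach space, let $p>0$, let $(\mathcal{I},\|\cdot\|_{\mathcal{I}})$ be an $l_p$-ideal in $\mathcal{B}(X)$ with eigenvalue constant $\gamma_p$, and let $A\in\mathcal{B}(X)$ and $K\in\mathcal{I}$. Suppose that for some $R\ge r(A)$ and $C_A>0$ we have $$\|(\lambda-A)^{-1}\|\le\frac{C_A}{|\lambda|-R},\qquad|\lambda|>R.$$ Then for $s>R$ the following holds: $$n_{A+K}(s)\le C_A^p\,\gamma_p^p\,\Gamma_p\,\frac{1}{s^p}\,\Phi_p\left(\frac{R}{s}\right)\|K\|_{\mathcal{I}}^p.$$ Here the right-hand side is bounded from above by $$C_A^p\,\gamma_p^p\,\Gamma_p\,\frac{(p+1)^{p+1}}{p^p}\,\frac{s}{(s-R)^{p+1}}\,\|K\|_{\mathcal{I}}^p.$$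
   Context: $\mathcal{B}(X)$ denotes the bounded linear operators on $X$ with operator norm $\|\cdot\|$, $\mathcal{F}(X)$ the finite rank operators, $I$ the identity; $r(A)=\sup\{|\lambda|:\lambda\in\sigma(A)\}$ is the spectral radius. Discrete eigenvalues: isolated points of the spectrum that are eigenvalues of finite algebraic multiplicity, the algebraic multiplicity being the rank of the associated Riesz projection. $n_{A+K}(s)$ is the number of discrete eigenvalues of $A+K$ in $\{\lambda\in\mathbb{C}:|\lambda|>s\}$, counted with algebraic multiplicity. Quasi-norm: a map $\|\cdot\|_V:V\to[0,\infty)$ on a complex vector space with $\|x\|_V=0\iff x=0$, $\|\lambda x\|_V=|\lambda|\|x\|_V$, and $\|x+y\|_V\le q(\|x\|_V+\|y\|_V)$ for some $q\ge1$. $V$ carries the metrizable vector topology for which the sets $\{x:\|x\|_V\le 1/n\}$, $n\in\mathbb{N}$, form a fundamental system of neighbourhoods of $0$. $l_p$-ideal: a linear subspace $\mathcal{I}\subset\mathcal{B}(X)$ with a quasi-norm $\|\cdot\|_{\mathcal{I}}$ such that: (A1) $\mathcal{F}(X)\subset\mathcal{I}$ is dense in $(\mathcal{I},\|\cdot\|_{\mathcal{I}})$; (A2) $\|L\|\le\|L\|_{\mathcal{I}}$ for $L\in\mathcal{I}$; (A3) if $L\in\mathcal{I}$ and $A,B\in\mathcal{B}(X)$, then $ALB\in\mathcal{I}$ and $\|ALB\|_{\mathcal{I}}\le\|A\|\|L\|_{\mathcal{I}}\|B\|$; (A4) there is a constant $\gamma_p$ (the eigenvalue constant) with $\left(\sum_j|\lambda_j(L)|^p\right)^{1/p}\le\gamma_p\|L\|_{\mathcal{I}}$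 for all $L\in\mathcal{I}$, where $(\lambda_j(L))$ are the discrete eigenvalues of $L$ counted with algebraic multiplicity. $\Gamma_p>0$ is a constant such that $|\det_p(I-F)|\le\exp\left(\Gamma_p\sum_k|\lambda_k(F)|^p\right)$ for every $F\in\mathcal{F}(X)$ (discrete eigenvalues counted with algebraic multiplicity); it is a known fact that such a constant exists. Here, for $F\in\mathcal{F}(X)$ with range $R_F$ and restriction $F|_{R_F}:R_F\to R_F$, $\det(I-F):=\det(I_{R_F}-F|_{R_F})$, $\operatorname{tr}(F):=\operatorname{tr}(F|_{R_F})$, and $\det_p(I-F):=\det(I-F)\exp\left(\sum_{k=1}^{\lceil p\rceil-1}\frac1k\operatorname{tr}(F^k)\right)$, with $\lceil p\rceil=\min\{n\in\mathbb{N}:n\ge p\}$ and an empty sum equal to $0$. $\Phi_p:(0,1)\to\mathbb{R}$ is given by $$\Phi_p(x)=\frac{\left(W(\frac1p e^{1/p}x)\right)^p}{\left(\frac1p-W(\frac1p e^{1/p}x)\right)^{p+1}x^p},$$ where $W:[0,\infty)\to[0,\infty)$ is the Lambert function defined by $W(x)e^{W(x)}=x$; in the case $R=0$, $\Phi_p(0)$ is understood as $\lim_{x\to0^+}\Phi_p(x)$. *)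

theory Defs
  imports
    "HOL-Complex_Analysis.Complex_Analysis"
    "Jordan_Normal_Form.Determinant"
begin

section \<open>Complex Banach spaces\<close>

class complex_vector = real_vector +
  fixes scaleC :: "complex \<Rightarrow> 'a \<Rightarrow> 'a" (infixr "*\<^sub>C" 75)
  assumes scaleC_add_right: "c *\<^sub>C (x + y) = c *\<^sub>C x + c *\<^sub>C y"
    and scaleC_add_left: "(c + d) *\<^sub>C x = c *\<^sub>C x + d *\<^sub>C x"
    and scaleC_scaleC: "c *\<^sub>C d *\<^sub>C x = (c * d) *\<^sub>C x"
    and scaleC_of_real: "complex_of_real r *\<^sub>C x = r *\<^sub>R x"

lemma scaleC_one: "1 *\<^sub>C x = (x :: 'a::complex_vector)"
  using scaleC_of_real[of 1 x] by simp

global_interpretation complex_vector: vector_space "scaleC :: complex \<Rightarrow> 'a \<Rightarrow> 'a::complex_vector"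
  by unfold_locales (simp_all add: scaleC_add_right scaleC_add_left scaleC_scaleC scaleC_one)

class complex_normed_vector = complex_vector + real_normed_vector +
  assumes norm_scaleC: "norm (c *\<^sub>C x) = cmod c * norm x"

class complex_banach = complex_normed_vector + banach

lemma bounded_linear_scaleC: "bounded_linear ((*\<^sub>C) c :: 'a \<Rightarrow> 'a::complex_normed_vector)"
proof (rule bounded_linear_intro[where K = "cmod c"])
  show "c *\<^sub>C r *\<^sub>R x = r *\<^sub>R c *\<^sub>C x" for r and x :: 'a
    by (simp add: scaleC_of_real[symmetric] scaleC_scaleC mult.commute)
qed (simp_all add: scaleC_add_right norm_scaleC)

instantiation complex :: complex_banach
begin

definition scaleC_complex :: "complex \<Rightarrow> complex \<Rightarrow> complex"
  where "scaleC_complex c x = c * x"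

instance
  by standard (simp_all add: scaleC_complex_def algebra_simps scaleR_conv_of_real norm_mult)

end

instantiation blinfun :: (real_normed_vector, complex_normed_vector) complex_normed_vector
begin

lift_definition scaleC_blinfun :: "complex \<Rightarrow> 'a \<Rightarrow>\<^sub>L 'b \<Rightarrow> 'a \<Rightarrow>\<^sub>L 'b"
  is "\<lambda>c f x. c *\<^sub>C f x"
  by (rule bounded_linear_compose[OF bounded_linear_scaleC])

instance
proof
  fix c d :: complex and r :: real and f g :: "'a \<Rightarrow>\<^sub>L 'b"
  show "c *\<^sub>C (f + g) = c *\<^sub>C f + c *\<^sub>C g"
    by transfer (simp add: scaleC_add_right)
  show "(c + d) *\<^sub>C f = c *\<^sub>C f + d *\<^sub>C f"
    by transfer (simp add: scaleC_add_left)
  show "c *\<^sub>C d *\<^sub>C f = (c * d) *\<^sub>C f"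
    by transfer (simp add: scaleC_scaleC)
  show "complex_of_real r *\<^sub>C f = r *\<^sub>R f"
    by transfer (simp add: scaleC_of_real)
  have le: "norm (c *\<^sub>C f) \<le> cmod c * norm f" for c and f :: "'a \<Rightarrow>\<^sub>L 'b"
  proof (rule norm_blinfun_bound)
    fix x
    show "norm (blinfun_apply (c *\<^sub>C f) x) \<le> cmod c * norm f * norm x"
      using mult_left_mono[OF norm_blinfun[of f x], of "cmod c"]
      by (simp add: scaleC_blinfun.rep_eq norm_scaleC mult.assoc)
  qed simp
  show "norm (c *\<^sub>C f) = cmod c * norm f"
  proof (cases "c = 0")
    case True
    then show ?thesis using le[of c f] by simp
  next
    case False
    have "inverse c *\<^sub>C c *\<^sub>C f = f"
      using False by transfer (simp add: scaleC_scaleC scaleC_one)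
    then have "norm f \<le> cmod (inverse c) * norm (c *\<^sub>C f)"
      using le[of "inverse c" "c *\<^sub>C f"] by simp
    then have "cmod c * norm f \<le> norm (c *\<^sub>C f)"
      using False by (simp add: norm_divide field_simps)
    then show ?thesis using le[of c f] by simp
  qed
qed

end

instance blinfun :: (real_normed_vector, complex_banach) complex_banach ..


section \<open>Bounded and finite rank operators\<close>

text \<open>The type of bounded real-linear maps carries the operator norm; the algebra of bounded
  operators on a complex space is its subset of complex-linear maps.\<close>

definition bounded_ops :: "('a::complex_normed_vector \<Rightarrow>\<^sub>L 'a) set"
  where "bounded_ops = {A. \<forall>c x. blinfun_apply A (c *\<^sub>C x) = c *\<^sub>C blinfun_apply A x}"

definition finite_rank_ops :: "('a::complex_normed_vector \<Rightarrow>\<^sub>L 'a) set"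
  where "finite_rank_ops = {F \<in> bounded_ops.
    \<exists>B. finite B \<and> range (blinfun_apply F) \<subseteq> complex_vector.span B}"

definition op_rank :: "('a::complex_normed_vector \<Rightarrow>\<^sub>L 'a) \<Rightarrow> nat"
  where "op_rank F = complex_vector.dim (range (blinfun_apply F))"

definition op_power :: "('a::real_normed_vector \<Rightarrow>\<^sub>L 'a) \<Rightarrow> nat \<Rightarrow> 'a \<Rightarrow>\<^sub>L 'a"
  where "op_power F k = ((\<lambda>G. F o\<^sub>L G) ^^ k) id_blinfun"


section \<open>Spectrum and discrete eigenvalues\<close>

definition inverse_op :: "('a::complex_normed_vector \<Rightarrow>\<^sub>L 'a) \<Rightarrow> ('a \<Rightarrow>\<^sub>L 'a) \<Rightarrow> bool"
  where "inverse_op T S \<longleftrightarrow> S \<in> bounded_ops \<and> T o\<^sub>L S = id_blinfun \<and> S o\<^sub>L T = id_blinfun"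

definition op_spectrum :: "('a::complex_normed_vector \<Rightarrow>\<^sub>L 'a) \<Rightarrow> complex set"
  where "op_spectrum A = {\<mu>. \<not> (\<exists>S. inverse_op (\<mu> *\<^sub>C id_blinfun - A) S)}"

definition resolvent_op :: "('a::complex_normed_vector \<Rightarrow>\<^sub>L 'a) \<Rightarrow> complex \<Rightarrow> 'a \<Rightarrow>\<^sub>L 'a"
  where "resolvent_op A \<mu> = (THE S. inverse_op (\<mu> *\<^sub>C id_blinfun - A) S)"

text \<open>The supremum is taken in the nonnegative reals: inserting 0 only matters for the zero space,
  whose operators have empty spectrum.\<close>

definition op_spectral_radius :: "('a::complex_normed_vector \<Rightarrow>\<^sub>L 'a) \<Rightarrow> real"
  where "op_spectral_radius A = Sup (insert 0 (cmod ` op_spectrum A))"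

text \<open>The vector-valued analogue of \<^const>\<open>contour_integral\<close>.\<close>

definition vector_contour_integral :: "(real \<Rightarrow> complex) \<Rightarrow> (complex \<Rightarrow> 'v::complex_normed_vector) \<Rightarrow> 'v"
  where "vector_contour_integral g f =
    integral {0..1} (\<lambda>t. vector_derivative g (at t within {0..1}) *\<^sub>C f (g t))"

text \<open>For an isolated point of the spectrum, the Riesz projection does not depend on the radius
  of the positively oriented circle, as long as the closed disc contains no other spectral point.\<close>

definition riesz_projection :: "('a::complex_banach \<Rightarrow>\<^sub>L 'a) \<Rightarrow> complex \<Rightarrow> 'a \<Rightarrow>\<^sub>L 'a"
  where "riesz_projection A \<mu> =
    (let r = (SOME r. 0 < r \<and> cball \<mu> r \<inter> op_spectrum A \<subseteq> {\<mu>})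
     in (1 / (2 * complex_of_real pi * \<i>)) *\<^sub>C
          vector_contour_integral (circlepath \<mu> r) (resolvent_op A))"

definition alg_mult :: "('a::complex_banach \<Rightarrow>\<^sub>L 'a) \<Rightarrow> complex \<Rightarrow> nat"
  where "alg_mult A \<mu> = op_rank (riesz_projection A \<mu>)"

text \<open>Membership in \<^const>\<open>finite_rank_ops\<close> is required explicitly because
  \<^const>\<open>op_rank\<close> is 0 for operators of infinite rank.\<close>

definition discrete_eigenvalues :: "('a::complex_banach \<Rightarrow>\<^sub>L 'a) \<Rightarrow> complex set"
  where "discrete_eigenvalues A = {\<mu>. \<mu> isolated_in op_spectrum A \<and>
    (\<exists>x. x \<noteq> 0 \<and> blinfun_apply A x = \<mu> *\<^sub>C x) \<and> riesz_projection A \<mu> \<in> finite_rank_ops}"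

text \<open>The count is extended-valued, so that a finite upper bound for it includes the assertion
  that there are only finitely many such eigenvalues.\<close>

definition eigenvalue_count :: "('a::complex_banach \<Rightarrow>\<^sub>L 'a) \<Rightarrow> real \<Rightarrow> ennreal"
  where "eigenvalue_count A s =
    (\<Sum>\<^sub>\<infinity>\<mu> \<in> {\<mu> \<in> discrete_eigenvalues A. s < cmod \<mu>}. of_nat (alg_mult A \<mu>))"


section \<open>Quasi-norms and ideals\<close>

definition quasi_norm_on :: "'v::complex_vector set \<Rightarrow> ('v \<Rightarrow> real) \<Rightarrow> bool"
  where "quasi_norm_on V N \<longleftrightarrow> complex_vector.subspace V \<and>
    (\<forall>x\<in>V. 0 \<le> N x) \<and>
    (\<forall>x\<in>V. N x = 0 \<longleftrightarrow> x = 0) \<and>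
    (\<forall>c. \<forall>x\<in>V. N (c *\<^sub>C x) = cmod c * N x) \<and>
    (\<exists>q\<ge>1. \<forall>x\<in>V. \<forall>y\<in>V. N (x + y) \<le> q * (N x + N y))"

text \<open>The translates of the sets \<open>{x \<in> V. N x \<le> 1 / n}\<close> serve as neighbourhood bases.\<close>

definition quasi_norm_topology :: "'v::complex_vector set \<Rightarrow> ('v \<Rightarrow> real) \<Rightarrow> 'v topology"
  where "quasi_norm_topology V N = topology (\<lambda>U. U \<subseteq> V \<and>
    (\<forall>x\<in>U. \<exists>n\<ge>1. {y \<in> V. N (y - x) \<le> 1 / real n} \<subseteq> U))"

lemma openin_quasi_norm_topology:
  "openin (quasi_norm_topology V N) U \<longleftrightarrow> U \<subseteq> V \<and>
    (\<forall>x\<in>U. \<exists>n\<ge>1. {y \<in> V. N (y - x) \<le> 1 / real n} \<subseteq> U)"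
proof -
  let ?B = "\<lambda>x n. {y \<in> V. N (y - x) \<le> 1 / real n}"
  have mono: "?B x n \<subseteq> ?B x m" if "1 \<le> m" "m \<le> n" for x m n
  proof -
    have "1 / real n \<le> 1 / real m" using that by (simp add: frac_le)
    then show ?thesis by auto
  qed
  have "istopology (\<lambda>U. U \<subseteq> V \<and> (\<forall>x\<in>U. \<exists>n\<ge>1. ?B x n \<subseteq> U))"
    unfolding istopology_def
  proof (intro conjI allI impI ballI)
    fix S T x
    assume S: "S \<subseteq> V \<and> (\<forall>x\<in>S. \<exists>n\<ge>1. ?B x n \<subseteq> S)"
      and T: "T \<subseteq> V \<and> (\<forall>x\<in>T. \<exists>n\<ge>1. ?B x n \<subseteq> T)"
    show "S \<inter> T \<subseteq> V" using S by blast
    assume "x \<in> S \<inter> T"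
    then obtain m n where "m \<ge> 1" "?B x m \<subseteq> S" "n \<ge> 1" "?B x n \<subseteq> T"
      using S T by blast
    then have "max m n \<ge> 1 \<and> ?B x (max m n) \<subseteq> S \<inter> T"
      using mono[of m "max m n" x] mono[of n "max m n" x] by auto
    then show "\<exists>n\<ge>1. ?B x n \<subseteq> S \<inter> T" by blast
  next
    fix \<K> assume K: "\<forall>S\<in>\<K>. S \<subseteq> V \<and> (\<forall>x\<in>S. \<exists>n\<ge>1. ?B x n \<subseteq> S)"
    show "\<Union>\<K> \<subseteq> V" using K by blast
    fix x assume "x \<in> \<Union>\<K>"
    then obtain S where "S \<in> \<K>" "x \<in> S" by blast
    then obtain n where "n \<ge> 1" "?B x n \<subseteq> S" using K by blast
    then show "\<exists>n\<ge>1. ?B x n \<subseteq> \<Union>\<K>" using \<open>S \<in> \<K>\<close> by blast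
  qed
  then show ?thesis by (simp add: quasi_norm_topology_def)
qed

locale lp_ideal =
  fixes p :: real
    and \<I> :: "('a::complex_banach \<Rightarrow>\<^sub>L 'a) set"
    and N :: "('a \<Rightarrow>\<^sub>L 'a) \<Rightarrow> real"
    and \<gamma> :: real
  assumes subset_bounded_ops: "\<I> \<subseteq> bounded_ops"
    and quasi_norm: "quasi_norm_on \<I> N"
    and finite_rank_subset: "finite_rank_ops \<subseteq> \<I>"
    and finite_rank_dense: "quasi_norm_topology \<I> N closure_of finite_rank_ops = \<I>"
    and norm_le: "L \<in> \<I> \<Longrightarrow> norm L \<le> N L"
    and ideal: "\<lbrakk>L \<in> \<I>; A \<in> bounded_ops; B \<in> bounded_ops\<rbrakk> \<Longrightarrow> A o\<^sub>L L o\<^sub>L B \<in> \<I>"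
    and ideal_norm: "\<lbrakk>L \<in> \<I>; A \<in> bounded_ops; B \<in> bounded_ops\<rbrakk> \<Longrightarrow>
      N (A o\<^sub>L L o\<^sub>L B) \<le> norm A * N L * norm B"
    and eigenvalues_summable: "L \<in> \<I> \<Longrightarrow>
      (\<lambda>\<mu>. real (alg_mult L \<mu>) * cmod \<mu> powr p) summable_on discrete_eigenvalues L"
    and eigenvalue_constant: "L \<in> \<I> \<Longrightarrow>
      (\<Sum>\<^sub>\<infinity>\<mu> \<in> discrete_eigenvalues L. real (alg_mult L \<mu>) * cmod \<mu> powr p) powr (1 / p) \<le> \<gamma> * N L"


section \<open>Regularized determinants of finite rank perturbations\<close>

text \<open>Determinant and trace on the range are computed from the matrix with respect to some basis
  of the range; their values do not depend on this choice.\<close>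

definition range_basis :: "('a::complex_normed_vector \<Rightarrow>\<^sub>L 'a) \<Rightarrow> 'a list"
  where "range_basis F = (SOME bs. distinct bs \<and> \<not> complex_vector.dependent (set bs) \<and>
    complex_vector.span (set bs) = range (blinfun_apply F))"

definition range_matrix :: "('a::complex_normed_vector \<Rightarrow>\<^sub>L 'a) \<Rightarrow> complex mat"
  where "range_matrix F = (let bs = range_basis F in
    mat (length bs) (length bs)
      (\<lambda>(i, j). complex_vector.representation (set bs) (blinfun_apply F (bs ! j)) (bs ! i)))"

definition fr_det :: "('a::complex_normed_vector \<Rightarrow>\<^sub>L 'a) \<Rightarrow> complex"
  where "fr_det F = Determinant.det (1\<^sub>m (length (range_basis F)) - range_matrix F)"

definition fr_trace :: "('a::complex_normed_vector \<Rightarrow>\<^sub>L 'a) \<Rightarrow> complex"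
  where "fr_trace F = (\<Sum>i < length (range_basis F). range_matrix F $$ (i, i))"

text \<open>\<open>fr_det F\<close> and \<open>fr_det_reg p F\<close> stand for \<open>det (I - F)\<close> and \<open>det\<^sub>p (I - F)\<close>.\<close>

definition fr_det_reg :: "real \<Rightarrow> ('a::complex_normed_vector \<Rightarrow>\<^sub>L 'a) \<Rightarrow> complex"
  where "fr_det_reg p F =
    fr_det F * exp (\<Sum>k = 1..<nat \<lceil>p\<rceil>. 1 / of_nat k * fr_trace (op_power F k))"


section \<open>The function in the bound\<close>

definition Lambert_W :: "real \<Rightarrow> real"
  where "Lambert_W x = (THE w. 0 \<le> w \<and> w * exp w = x)"

definition Phi_formula :: "real \<Rightarrow> real \<Rightarrow> real"
  where "Phi_formula p x =
    Lambert_W (1 / p * exp (1 / p) * x) powr p /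
    ((1 / p - Lambert_W (1 / p * exp (1 / p) * x)) powr (p + 1) * x powr p)"

definition Phi :: "real \<Rightarrow> real \<Rightarrow> real"
  where "Phi p x = (if x = 0 then Lim (at_right 0) (Phi_formula p) else Phi_formula p x)"

end

theory Submission
  imports Defs "Jordan_Normal_Form.Char_Poly" "HOL-Real_Asymp.Real_Asymp"
begin

text \<open>
  The discrete eigenvalues of \<open>A + K\<close> are counted as zeros of a perturbation determinant. For an
  operator \<open>F\<close> of finite rank, \<open>\<lambda> \<mapsto> det (I - F R\<^sub>A(\<lambda>))\<close> is holomorphic for \<open>\<bar>\<lambda>\<bar> > R\<close>, equals 1 at
  infinity, and vanishes at the eigenvalues of \<open>A + F\<close>, with their multiplicities. If it is
  bounded by \<open>B\<close> on the circle \<open>\<bar>\<lambda>\<bar> = t\<close>, Jensen's inequality bounds the number \<open>n\<close> of zeros of modulus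
  at least \<open>s > t\<close> by \<open>(s / t)\<^sup>n \<le> B\<close> (lemma \<open>zero_count_jensen\<close>). The regularized determinant is at most
  \<open>exp (\<Gamma> \<gamma>\<^sup>p (C N(K) / (t - R))\<^sup>p)\<close> there, because the ideal controls the \<open>p\<close>-th powers of
  eigenvalues. The radius \<open>t\<close> that gives the best bound on \<open>n\<close> is expressed by the Lambert function,
  whence \<open>Phi\<close>; the radius that would be best with \<open>1 - v\<close> in place of \<open>- ln v\<close> gives the explicit bound.

  The eigenvalues in question span, with their generalized eigenspaces, a finite-dimensional
  subspace \<open>M\<close> invariant under \<open>A + K\<close>; let \<open>E\<close> be a bounded projection onto \<open>M\<close>. If \<open>F\<^sub>0\<close> has finite
  rank and is close to \<open>K\<close>, then \<open>F = F\<^sub>0 (I - E) + K E\<close> is also close to \<open>K\<close> and coincides with \<open>K\<close> on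
  \<open>M\<close>. Hence \<open>A + F\<close> has exactly the same restriction to \<open>M\<close>, and the determinant of \<open>F\<close> splits off the
  factor \<open>\<Prod> (1 - \<nu> / \<lambda>)\<close> over the eigenvalues on \<open>M\<close> (lemma \<open>fr_det_invariant_factor\<close>). This makes
  the zeros visible while \<open>F\<close> approaches \<open>K\<close> (lemma \<open>eigenvalue_count_bound\<close>).

  A quasi-norm may be discontinuous, so \<open>N F\<close> can stay away from \<open>N K\<close> although \<open>N (F - K)\<close> tends to 0.
  To obtain the sharp constant, the eigenvalue inequality is applied to \<open>L = K R\<^sub>A(\<lambda>)\<close> itself.
  Lemma \<open>approximation_with_determinant_bound\<close> approximates \<open>L\<close> by \<open>F' = L\<^sub>1 + H\<close>, where \<open>L\<^sub>1\<close> is the part of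
  \<open>L\<close> that belongs to the eigenvalues of modulus greater than \<open>\<delta>\<close> and all eigenvalues of \<open>H\<close> are small. The
  determinant of \<open>L\<^sub>1\<close> is bounded through the eigenvalues of \<open>L\<close>. That of \<open>H\<close> is almost 1: density of the
  finite rank operators makes \<open>z \<mapsto> det\<^sub>p (I - z F')\<close> grow at most like \<open>exp (\<kappa> \<bar>z\<bar>\<^sup>p)\<close> with arbitrarily
  small \<open>\<kappa>\<close> (lemma \<open>det_growth\<close>). A logarithm whose real part is at most a small multiple of \<open>1 / \<delta>\<^sup>p\<close> on
  the disc of radius \<open>1 / (2 \<delta>)\<close> has a small Taylor remainder of order \<open>m = \<lceil>p\<rceil>\<close> at 1 (lemma
  \<open>regularized_product_bound\<close>).
  Determinants of operators that are close in \<open>N\<close> are close (lemma \<open>det_lipschitz\<close>), which transfers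
  the bound from \<open>F'\<close> to \<open>F R\<^sub>A(\<lambda>)\<close>.

  The spectral theory behind this rests on two facts: the range of a Riesz projection of finite rank is
  the generalized eigenspace (lemma \<open>riesz_int_range_gen_eigenspace\<close>), and every nonzero spectral point of
  a norm limit of finite rank operators is a discrete eigenvalue (lemma \<open>approximable_discrete\<close>).
\<close>

section \<open>Complex-linear operators\<close>

lemmas op_apply = blinfun.add_left blinfun.diff_left blinfun.minus_left blinfun.zero_left
  blinfun.add_right blinfun.diff_right blinfun.minus_right blinfun.zero_right
  scaleC_blinfun.rep_eq

lemma bounded_bilinear_scaleC:
  "bounded_bilinear ((*\<^sub>C) :: complex \<Rightarrow> 'a \<Rightarrow> 'a::complex_normed_vector)"
proof (rule bounded_bilinear.intro)
  show "\<exists>K. \<forall>a b. norm (a *\<^sub>C (b::'a)) \<le> norm a * norm b * K"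
    by (rule exI[of _ 1]) (simp add: norm_scaleC)
  show "(r *\<^sub>R a) *\<^sub>C b = r *\<^sub>R a *\<^sub>C b" for r a and b :: 'a
    by (metis scaleC_of_real scaleC_scaleC scaleR_conv_of_real)
  show "a *\<^sub>C r *\<^sub>R b = r *\<^sub>R a *\<^sub>C b" for r a and b :: 'a
    by (metis scaleC_of_real scaleC_scaleC mult.commute)
qed (simp_all add: scaleC_add_left scaleC_add_right)

lemmas continuous_on_scaleC [continuous_intros] = bounded_bilinear.continuous_on[OF bounded_bilinear_scaleC]
lemmas tendsto_scaleC [tendsto_intros] = bounded_bilinear.tendsto[OF bounded_bilinear_scaleC]

lemmas scaleC_diff_right = complex_vector.scale_right_diff_distrib
lemmas scaleC_diff_left = complex_vector.scale_left_diff_distrib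
lemmas scaleC_sum_right = complex_vector.scale_sum_right

lemmas scaleC_simps = scaleC_add_right scaleC_add_left scaleC_diff_right scaleC_diff_left
  scaleC_scaleC scaleC_one

lemma bopsI: "(\<And>c x. blinfun_apply A (c *\<^sub>C x) = c *\<^sub>C blinfun_apply A x) \<Longrightarrow> A \<in> bounded_ops"
  by (simp add: bounded_ops_def)

lemma bopsD: "A \<in> bounded_ops \<Longrightarrow> blinfun_apply A (c *\<^sub>C x) = c *\<^sub>C blinfun_apply A x"
  by (simp add: bounded_ops_def)

lemma bops_id [simp, intro]: "id_blinfun \<in> bounded_ops"
  by (rule bopsI) simp

lemma bops_zero [simp, intro]: "0 \<in> bounded_ops"
  by (rule bopsI) simp

lemma bops_add [simp, intro]: "A \<in> bounded_ops \<Longrightarrow> B \<in> bounded_ops \<Longrightarrow> A + B \<in> bounded_ops"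
  by (rule bopsI) (simp add: bopsD op_apply scaleC_simps)

lemma bops_diff [simp, intro]: "A \<in> bounded_ops \<Longrightarrow> B \<in> bounded_ops \<Longrightarrow> A - B \<in> bounded_ops"
  by (rule bopsI) (simp add: bopsD op_apply scaleC_simps)

lemma bops_uminus [simp, intro]: "A \<in> bounded_ops \<Longrightarrow> - A \<in> bounded_ops"
  by (rule bopsI) (simp add: bopsD op_apply scaleC_simps)

lemma bops_scaleC [simp, intro]: "A \<in> bounded_ops \<Longrightarrow> c *\<^sub>C A \<in> bounded_ops"
  by (rule bopsI) (simp add: bopsD op_apply scaleC_simps mult.commute)

lemma bops_compose [simp, intro]: "A \<in> bounded_ops \<Longrightarrow> B \<in> bounded_ops \<Longrightarrow> A o\<^sub>L B \<in> bounded_ops"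
  by (rule bopsI) (simp add: bopsD)

lemma op_power_0 [simp]: "op_power A 0 = id_blinfun"
  by (simp add: op_power_def)

lemma op_power_Suc [simp]: "op_power A (Suc k) = A o\<^sub>L op_power A k"
  by (simp add: op_power_def)

lemma bops_power [simp, intro]: "A \<in> bounded_ops \<Longrightarrow> op_power A k \<in> bounded_ops"
  by (induction k) auto

lemma op_power_apply: "blinfun_apply (op_power A k) x = (blinfun_apply A ^^ k) x"
  by (induction k) auto

lemma op_linear:
  assumes "A \<in> bounded_ops"
  shows "Vector_Spaces.linear (*\<^sub>C) (*\<^sub>C) (blinfun_apply A)"
  by unfold_locales (simp_all add: blinfun.add_right bopsD[OF assms])

lemma norm_op_power: "norm (op_power A k) \<le> norm A ^ k"
proof (induction k)
  case 0
  then show ?case using norm_blinfun_id_le by simp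
next
  case (Suc k)
  have "norm (A o\<^sub>L op_power A k) \<le> norm A * norm (op_power A k)"
    by (rule norm_blinfun_compose)
  also have "\<dots> \<le> norm A * norm A ^ k" using Suc by (intro mult_left_mono) auto
  finally show ?case by simp
qed

lemma range_op_subspace: "A \<in> bounded_ops \<Longrightarrow> complex_vector.subspace (range (blinfun_apply A))"
  by (rule complex_vector.subspaceI)
    (auto simp: blinfun.add_right[symmetric] bopsD[symmetric] intro: range_eqI[of 0 _ 0])

section \<open>Inverses\<close>

lemma inverse_op_apply:
  assumes "inverse_op T S"
  shows "blinfun_apply T (blinfun_apply S x) = x" "blinfun_apply S (blinfun_apply T x) = x"
  using assms unfolding inverse_op_def
  by (metis blinfun_apply_blinfun_compose blinfun_apply_id_blinfun id_apply)+

lemma inverse_op_unique: "inverse_op T S \<Longrightarrow> inverse_op T S' \<Longrightarrow> S = S'"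
proof (rule blinfun_eqI)
  fix x
  assume 1: "inverse_op T S" and 2: "inverse_op T S'"
  have "blinfun_apply S (blinfun_apply T (blinfun_apply S' x)) = blinfun_apply S' x"
    by (rule inverse_op_apply[OF 1])
  then show "blinfun_apply S x = blinfun_apply S' x" by (simp add: inverse_op_apply[OF 2])
qed

definition inv_op :: "('a::complex_normed_vector \<Rightarrow>\<^sub>L 'a) \<Rightarrow> ('a \<Rightarrow>\<^sub>L 'a)"
  where "inv_op T = (THE S. inverse_op T S)"

lemma inv_op_eq: "inverse_op T S \<Longrightarrow> inv_op T = S"
  unfolding inv_op_def using inverse_op_unique by blast

lemma resolvent_op_eq_inv_op: "resolvent_op A \<mu> = inv_op (\<mu> *\<^sub>C id_blinfun - A)"
  by (simp add: resolvent_op_def inv_op_def)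

lemma inverse_opI:
  assumes "S \<in> bounded_ops" "\<And>x. blinfun_apply T (blinfun_apply S x) = x"
    "\<And>x. blinfun_apply S (blinfun_apply T x) = x"
  shows "inverse_op T S"
  using assms unfolding inverse_op_def by (auto intro!: blinfun_eqI)

lemma inverse_op_compose:
  assumes "inverse_op T S" "inverse_op T' S'"
  shows "inverse_op (T o\<^sub>L T') (S' o\<^sub>L S)"
  using assms inverse_op_apply[OF assms(1)] inverse_op_apply[OF assms(2)]
  by (intro inverse_opI) (auto simp: inverse_op_def)

lemma neumann_series:
  fixes B :: "'a::complex_banach \<Rightarrow>\<^sub>L 'a"
  assumes B: "B \<in> bounded_ops" and nB: "norm B < 1"
  shows "\<exists>S. inverse_op (id_blinfun - B) S \<and> norm S \<le> 1 / (1 - norm B)"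
proof -
  have s: "summable (op_power B)"
    by (rule summable_comparison_test'[where g = "\<lambda>k. norm B ^ k" and N = 0])
       (use nB norm_op_power[of B] in \<open>auto intro: summable_geometric\<close>)
  define S where "S = suminf (op_power B)"
  have sums: "op_power B sums S" using s by (simp add: S_def summable_sums)
  have app: "(\<lambda>k. blinfun_apply (op_power B k) x) sums blinfun_apply S x" for x
    using bounded_linear.sums[OF bounded_linear_apply_blinfun sums] .
  have Sb: "S \<in> bounded_ops"
  proof (rule bopsI)
    fix c x
    have "(\<lambda>k. c *\<^sub>C blinfun_apply (op_power B k) x) sums (c *\<^sub>C blinfun_apply S x)"
      using bounded_linear.sums[OF bounded_linear_scaleC app] .
    moreover have "(\<lambda>k. c *\<^sub>C blinfun_apply (op_power B k) x) sums (blinfun_apply S (c *\<^sub>C x))"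
      using app[of "c *\<^sub>C x"] by (simp add: bopsD[OF bops_power[OF B]])
    ultimately show "blinfun_apply S (c *\<^sub>C x) = c *\<^sub>C blinfun_apply S x"
      using sums_unique2 by blast
  qed
  have 1: "blinfun_apply B (blinfun_apply S x) = blinfun_apply S x - x" for x
  proof -
    have "(\<lambda>k. blinfun_apply B (blinfun_apply (op_power B k) x)) sums blinfun_apply B (blinfun_apply S x)"
      by (rule bounded_linear.sums[OF blinfun.bounded_linear_right app])
    moreover have "(\<lambda>k. blinfun_apply (op_power B (Suc k)) x) sums (blinfun_apply S x - x)"
      using app[of x] by (subst sums_Suc_iff) simp
    ultimately show ?thesis by (simp add: sums_unique2)
  qed
  have 2: "blinfun_apply S (blinfun_apply B x) = blinfun_apply S x - x" for x
  proof -
    have "(\<lambda>k. blinfun_apply (op_power B k) (blinfun_apply B x)) sums blinfun_apply S (blinfun_apply B x)"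
      by (rule app)
    moreover have "(\<lambda>k. blinfun_apply (op_power B (Suc k)) x) sums (blinfun_apply S x - x)"
      using app[of x] by (subst sums_Suc_iff) simp
    moreover have "blinfun_apply (op_power B (Suc k)) x = blinfun_apply (op_power B k) (blinfun_apply B x)" for k
      by (simp only: op_power_apply funpow_Suc_right comp_def)
    ultimately show ?thesis by (simp add: sums_unique2)
  qed
  have "inverse_op (id_blinfun - B) S"
    by (rule inverse_opI) (use Sb 1 2 in \<open>simp_all add: op_apply\<close>)
  moreover have "norm S \<le> (\<Sum>k. norm B ^ k)"
    unfolding S_def using norm_op_power[of B] nB
    by (intro norm_suminf_le) (auto intro: summable_geometric)
  ultimately show ?thesis using nB by (auto simp: suminf_geometric)
qed

text \<open>Write \<open>T' = T (I - S (T - T'))\<close> and invert the second factor by a Neumann series of norm at most 2. The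
  explicit bounds give both that the invertible operators form an open set and that inversion is continuous.\<close>

lemma inverse_stable:
  fixes T :: "'a::complex_banach \<Rightarrow>\<^sub>L 'a"
  assumes TS: "inverse_op T S" and T: "T \<in> bounded_ops" "T' \<in> bounded_ops"
    and small: "norm (T' - T) * norm S \<le> 1/2"
  shows "\<exists>S'. inverse_op T' S' \<and> norm S' \<le> 2 * norm S \<and> norm (S' - S) \<le> 2 * (norm S)\<^sup>2 * norm (T' - T)"
proof -
  have S: "S \<in> bounded_ops" using TS by (simp add: inverse_op_def)
  define B where "B = S o\<^sub>L (T - T')"
  have nB: "norm B \<le> 1/2"
    using norm_blinfun_compose[of S "T - T'"] small unfolding B_def
    by (metis (no_types, lifting) mult.commute norm_minus_commute order_trans)
  have Bb: "B \<in> bounded_ops" using S T by (simp add: B_def)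
  obtain Q where Q: "inverse_op (id_blinfun - B) Q" "norm Q \<le> 1 / (1 - norm B)"
    using neumann_series[OF Bb] nB by auto
  have "1 / (1 - norm B) \<le> 2" using nB by (simp add: field_simps)
  then have nQ: "norm Q \<le> 2" using Q(2) by linarith
  have "T o\<^sub>L (id_blinfun - B) = T'"
    by (rule blinfun_eqI) (simp add: B_def op_apply inverse_op_apply[OF TS])
  then have inv: "inverse_op T' (Q o\<^sub>L S)" using inverse_op_compose[OF TS Q(1)] by simp
  have n1: "norm (Q o\<^sub>L S) \<le> 2 * norm S"
    using norm_blinfun_compose[of Q S] mult_right_mono[OF nQ, of "norm S"] by simp
  have "(Q o\<^sub>L S) - S = (Q o\<^sub>L S) o\<^sub>L ((T - T') o\<^sub>L S)"
  proof (rule blinfun_eqI)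
    fix x
    have "blinfun_apply (Q o\<^sub>L S) (blinfun_apply T' (blinfun_apply S x)) = blinfun_apply S x"
      using inverse_op_apply[OF inv] by blast
    then show "blinfun_apply ((Q o\<^sub>L S) - S) x = blinfun_apply ((Q o\<^sub>L S) o\<^sub>L ((T - T') o\<^sub>L S)) x"
      unfolding blinfun_apply_blinfun_compose blinfun.diff_left blinfun.diff_right inverse_op_apply[OF TS]
      by simp
  qed
  then have "norm ((Q o\<^sub>L S) - S) \<le> norm (Q o\<^sub>L S) * norm ((T - T') o\<^sub>L S)"
    by (simp only: norm_blinfun_compose)
  also have "\<dots> \<le> norm (Q o\<^sub>L S) * (norm (T - T') * norm S)"
    by (intro mult_left_mono norm_blinfun_compose) auto
  also have "\<dots> \<le> (2 * norm S) * (norm (T - T') * norm S)"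
    using n1 by (intro mult_right_mono) auto
  finally have "norm ((Q o\<^sub>L S) - S) \<le> 2 * (norm S)\<^sup>2 * norm (T' - T)"
    by (simp add: power2_eq_square norm_minus_commute mult_ac)
  with inv n1 show ?thesis by blast
qed

definition invertibles :: "('a::complex_normed_vector \<Rightarrow>\<^sub>L 'a) set"
  where "invertibles = {T \<in> bounded_ops. \<exists>S. inverse_op T S}"

lemma inv_op_inverse: "T \<in> invertibles \<Longrightarrow> inverse_op T (inv_op T)"
  unfolding invertibles_def using inv_op_eq by fastforce

lemma inv_op_bops: "T \<in> invertibles \<Longrightarrow> inv_op T \<in> bounded_ops"
  using inv_op_inverse by (auto simp: inverse_op_def)

lemma inv_op_apply:
  assumes "T \<in> invertibles"
  shows "blinfun_apply T (blinfun_apply (inv_op T) x) = x"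
    "blinfun_apply (inv_op T) (blinfun_apply T x) = x"
  using inverse_op_apply[OF inv_op_inverse[OF assms]] by auto

lemma invertibles_open:
  fixes T :: "'a::complex_banach \<Rightarrow>\<^sub>L 'a"
  assumes "T \<in> invertibles"
  shows "\<exists>e>0. \<forall>T'\<in>bounded_ops. norm (T' - T) < e \<longrightarrow> T' \<in> invertibles"
proof -
  define S where "S = inv_op T"
  have TS: "inverse_op T S" using inv_op_inverse[OF assms] by (simp add: S_def)
  have T: "T \<in> bounded_ops" using assms by (simp add: invertibles_def)
  have "T' \<in> invertibles" if "T' \<in> bounded_ops" "norm (T' - T) < 1 / (2 * (norm S + 1))" for T'
  proof -
    have "norm (T' - T) * norm S \<le> 1 / (2 * (norm S + 1)) * norm S"
      using that by (intro mult_right_mono) auto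
    also have "\<dots> \<le> 1/2" by (simp add: divide_simps add_nonneg_pos)
    finally show ?thesis using inverse_stable[OF TS T that(1)] that(1) by (auto simp: invertibles_def)
  qed
  then show ?thesis by (intro exI[of _ "1 / (2 * (norm S + 1))"]) (simp add: add_nonneg_pos)
qed

lemma continuous_on_inv_op:
  "continuous_on invertibles (inv_op :: ('a::complex_banach \<Rightarrow>\<^sub>L 'a) \<Rightarrow> _)"
  unfolding continuous_on_iff
proof (intro ballI allI impI)
  fix T :: "'a \<Rightarrow>\<^sub>L 'a" and e :: real assume T: "T \<in> invertibles" and e: "e > 0"
  define S where "S = inv_op T"
  have TS: "inverse_op T S" using inv_op_inverse[OF T] by (simp add: S_def)
  define d where "d = min (1 / (2 * (norm S + 1))) (e / (2 * (norm S)\<^sup>2 + 1))"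
  have pos: "2 * (norm S)\<^sup>2 + 1 > 0" by (simp add: add_nonneg_pos)
  have "d > 0" using e pos by (simp add: d_def add_nonneg_pos)
  moreover have "dist (inv_op T') (inv_op T) < e" if T': "T' \<in> invertibles" "dist T' T < d" for T'
  proof -
    have n: "norm (T' - T) < 1 / (2 * (norm S + 1))" "norm (T' - T) < e / (2 * (norm S)\<^sup>2 + 1)"
      using that by (auto simp: d_def dist_norm)
    have "norm (T' - T) * norm S \<le> 1 / (2 * (norm S + 1)) * norm S"
      using n by (intro mult_right_mono) auto
    also have "\<dots> \<le> 1/2" by (simp add: divide_simps add_nonneg_pos)
    finally obtain S' where S': "inverse_op T' S'" "norm (S' - S) \<le> 2 * (norm S)\<^sup>2 * norm (T' - T)"
      using inverse_stable[OF TS] T T' by (auto simp: invertibles_def)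
    have "2 * (norm S)\<^sup>2 * norm (T' - T) \<le> (2 * (norm S)\<^sup>2 + 1) * norm (T' - T)"
      by (simp add: mult_right_mono)
    also have "\<dots> < (2 * (norm S)\<^sup>2 + 1) * (e / (2 * (norm S)\<^sup>2 + 1))"
      using n(2) pos by (intro mult_strict_left_mono) auto
    also have "\<dots> = e" using pos by simp
    finally show ?thesis using S' inv_op_eq[OF S'(1)] by (simp add: dist_norm S_def)
  qed
  ultimately show "\<exists>d>0. \<forall>x'\<in>invertibles. dist x' T < d \<longrightarrow> dist (inv_op x') (inv_op T) < e"
    by blast
qed

section \<open>Resolvents\<close>

lemma spectrum_iff_invertibles:
  "A \<in> bounded_ops \<Longrightarrow> \<mu> \<notin> op_spectrum A \<longleftrightarrow> \<mu> *\<^sub>C id_blinfun - A \<in> invertibles"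
  by (simp add: op_spectrum_def invertibles_def)

lemma resolvent_bops: "A \<in> bounded_ops \<Longrightarrow> \<mu> \<notin> op_spectrum A \<Longrightarrow> resolvent_op A \<mu> \<in> bounded_ops"
  by (simp add: resolvent_op_eq_inv_op inv_op_bops spectrum_iff_invertibles)

lemma resolvent_apply:
  assumes "A \<in> bounded_ops" "\<mu> \<notin> op_spectrum A"
  shows "blinfun_apply A (blinfun_apply (resolvent_op A \<mu>) x) = \<mu> *\<^sub>C blinfun_apply (resolvent_op A \<mu>) x - x"
    "blinfun_apply (resolvent_op A \<mu>) (blinfun_apply A x) = \<mu> *\<^sub>C blinfun_apply (resolvent_op A \<mu>) x - x"
proof -
  have i: "\<mu> *\<^sub>C id_blinfun - A \<in> invertibles" using assms by (simp add: spectrum_iff_invertibles)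
  show "blinfun_apply A (blinfun_apply (resolvent_op A \<mu>) x) = \<mu> *\<^sub>C blinfun_apply (resolvent_op A \<mu>) x - x"
    using inv_op_apply(1)[OF i, of x] by (simp add: resolvent_op_eq_inv_op op_apply algebra_simps)
  show "blinfun_apply (resolvent_op A \<mu>) (blinfun_apply A x) = \<mu> *\<^sub>C blinfun_apply (resolvent_op A \<mu>) x - x"
    using inv_op_apply(2)[OF i, of x] inv_op_bops[OF i]
    by (simp add: resolvent_op_eq_inv_op op_apply bopsD algebra_simps)
qed

lemma continuous_on_resolvent:
  fixes A :: "'a::complex_banach \<Rightarrow>\<^sub>L 'a"
  assumes "A \<in> bounded_ops"
  shows "continuous_on (- op_spectrum A) (resolvent_op A)"
  unfolding resolvent_op_eq_inv_op[abs_def]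
  by (rule continuous_on_compose2[OF continuous_on_inv_op])
     (use assms in \<open>auto intro!: continuous_intros simp: spectrum_iff_invertibles\<close>)

lemma spectrum_closed:
  fixes A :: "'a::complex_banach \<Rightarrow>\<^sub>L 'a"
  assumes A: "A \<in> bounded_ops"
  shows "closed (op_spectrum A)"
proof -
  have "open (- op_spectrum A)"
    unfolding open_dist
  proof (intro ballI)
    fix \<mu> assume "\<mu> \<in> - op_spectrum A"
    then obtain e where e: "e > 0" "\<And>T'. T' \<in> bounded_ops \<Longrightarrow> norm (T' - (\<mu> *\<^sub>C id_blinfun - A)) < e \<Longrightarrow> T' \<in> invertibles"
      using invertibles_open[of "\<mu> *\<^sub>C id_blinfun - A"] A by (auto simp: spectrum_iff_invertibles)
    have "\<nu> \<in> - op_spectrum A" if "dist \<nu> \<mu> < e" for \<nu>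
    proof -
      have "norm ((\<nu> *\<^sub>C id_blinfun - A) - (\<mu> *\<^sub>C id_blinfun - A)) = cmod (\<nu> - \<mu>) * norm (id_blinfun :: 'a \<Rightarrow>\<^sub>L 'a)"
        by (simp add: scaleC_diff_left[symmetric] norm_scaleC)
      also have "\<dots> \<le> cmod (\<nu> - \<mu>) * 1"
        by (intro mult_left_mono norm_blinfun_id_le) auto
      finally show ?thesis using that A e(2)[of "\<nu> *\<^sub>C id_blinfun - A"]
        by (auto simp: dist_norm spectrum_iff_invertibles)
    qed
    then show "\<exists>e>0. \<forall>y. dist y \<mu> < e \<longrightarrow> y \<in> - op_spectrum A" using e(1) by blast
  qed
  then show ?thesis by (simp add: open_closed)
qed

lemma invertible_id_minus:
  fixes A :: "'a::complex_banach \<Rightarrow>\<^sub>L 'a"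
  assumes "A \<in> bounded_ops" "norm A < 1"
  shows "id_blinfun - A \<in> invertibles"
  using neumann_series[OF assms] assms by (auto simp: invertibles_def)

lemma scaleC_invertible:
  assumes "T \<in> invertibles" "c \<noteq> 0"
  shows "c *\<^sub>C T \<in> invertibles" "inv_op (c *\<^sub>C T) = inverse c *\<^sub>C inv_op T"
proof -
  have "inverse_op (c *\<^sub>C T) (inverse c *\<^sub>C inv_op T)"
    using assms inv_op_bops[OF assms(1)] inv_op_apply[OF assms(1)]
    by (intro inverse_opI) (auto simp: op_apply bopsD scaleC_simps invertibles_def)
  then show "c *\<^sub>C T \<in> invertibles" "inv_op (c *\<^sub>C T) = inverse c *\<^sub>C inv_op T"
    using assms inv_op_eq by (auto simp: invertibles_def)
qed

text \<open>The passage from \<open>\<mu>\<close> to \<open>z = 1 / \<mu>\<close>: the resolvent becomes \<open>z (I - z A)\<^sup>-\<^sup>1\<close>, which is holomorphic near \<open>z = 0\<close>,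
  so that determinants can be treated on discs instead of neighbourhoods of infinity.\<close>

lemma spectrum_reciprocal:
  fixes A :: "'a::complex_banach \<Rightarrow>\<^sub>L 'a"
  assumes "A \<in> bounded_ops" "\<mu> \<noteq> 0"
  shows "\<mu> \<notin> op_spectrum A \<longleftrightarrow> id_blinfun - inverse \<mu> *\<^sub>C A \<in> invertibles"
proof -
  have e: "\<mu> *\<^sub>C (id_blinfun - inverse \<mu> *\<^sub>C A) = \<mu> *\<^sub>C id_blinfun - A"
    using assms by (simp add: scaleC_simps)
  have e2: "inverse \<mu> *\<^sub>C (\<mu> *\<^sub>C id_blinfun - A) = id_blinfun - inverse \<mu> *\<^sub>C A"
    using assms by (simp add: scaleC_simps)
  show ?thesis using scaleC_invertible(1)[of _ \<mu>] scaleC_invertible(1)[of _ "inverse \<mu>"] e e2 assms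
    by (metis inverse_nonzero_iff_nonzero spectrum_iff_invertibles)
qed

lemma spectrum_norm_le:
  fixes A :: "'a::complex_banach \<Rightarrow>\<^sub>L 'a"
  assumes "A \<in> bounded_ops" "\<mu> \<in> op_spectrum A"
  shows "cmod \<mu> \<le> norm A"
proof (rule ccontr)
  assume "\<not> ?thesis"
  then have less: "norm A < cmod \<mu>" by simp
  then have "\<mu> \<noteq> 0" using norm_ge_zero[of A] by (metis norm_zero not_less)
  moreover have "norm (inverse \<mu> *\<^sub>C A) < 1"
    using less \<open>\<mu> \<noteq> 0\<close> by (simp add: norm_scaleC norm_inverse inverse_eq_divide pos_divide_less_eq norm_divide)
  ultimately show False
    using invertible_id_minus[of "inverse \<mu> *\<^sub>C A"] spectrum_reciprocal assms by blast
qed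

lemma spectral_radius_bound:
  fixes A :: "'a::complex_banach \<Rightarrow>\<^sub>L 'a"
  assumes "A \<in> bounded_ops" "op_spectral_radius A \<le> R"
  shows "0 \<le> R" "R < cmod \<mu> \<Longrightarrow> \<mu> \<notin> op_spectrum A"
proof -
  have b: "bdd_above (insert 0 (cmod ` op_spectrum A))"
    using spectrum_norm_le[OF assms(1)] by (intro bdd_aboveI[of _ "norm A"]) auto
  show "0 \<le> R"
    using cSup_upper[OF _ b, of 0] assms(2) unfolding op_spectral_radius_def by auto
  show "\<mu> \<notin> op_spectrum A" if "R < cmod \<mu>"
  proof
    assume "\<mu> \<in> op_spectrum A"
    then have "cmod \<mu> \<le> op_spectral_radius A"
      unfolding op_spectral_radius_def by (intro cSup_upper[OF _ b]) auto
    then show False using assms(2) that by simp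
  qed
qed

section \<open>Finite-dimensional subspaces\<close>

definition fin_dim :: "'a::complex_normed_vector set \<Rightarrow> bool"
  where "fin_dim V \<longleftrightarrow> (\<exists>B. finite B \<and> V \<subseteq> complex_vector.span B)"

definition is_basis :: "'a::complex_normed_vector list \<Rightarrow> 'a set \<Rightarrow> bool"
  where "is_basis b V \<longleftrightarrow> distinct b \<and> \<not> complex_vector.dependent (set b) \<and>
    complex_vector.span (set b) = V"

definition coord :: "'a::complex_normed_vector list \<Rightarrow> nat \<Rightarrow> 'a \<Rightarrow> complex"
  where "coord b i x = complex_vector.representation (set b) x (b ! i)"

lemma is_basis_subspace: "is_basis b V \<Longrightarrow> complex_vector.subspace V"
  unfolding is_basis_def by auto

lemma is_basis_fin_dim: "is_basis b V \<Longrightarrow> fin_dim V"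
  unfolding is_basis_def fin_dim_def by (metis List.finite_set order_refl)

lemma is_basis_mem: "is_basis b V \<Longrightarrow> i < length b \<Longrightarrow> b ! i \<in> V"
  unfolding is_basis_def using complex_vector.span_base by (metis nth_mem)

lemma is_basis_length: "is_basis b V \<Longrightarrow> length b = complex_vector.dim V"
  unfolding is_basis_def
  by (metis complex_vector.dim_span_eq_card_independent distinct_card)

lemma sum_list_nth: "distinct b \<Longrightarrow> (\<Sum>v\<in>set b. f v) = (\<Sum>i<length b. f (b ! i))"
  by (simp add: sum.distinct_set_conv_list sum_list_sum_nth atLeast0LessThan)

lemma coord_sum:
  assumes "is_basis b V" "x \<in> V"
  shows "(\<Sum>i<length b. coord b i x *\<^sub>C b ! i) = x"
proof -
  have "(\<Sum>v\<in>set b. complex_vector.representation (set b) x v *\<^sub>C v) = x"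
    using assms by (intro complex_vector.sum_representation_eq) (auto simp: is_basis_def)
  then show ?thesis using assms by (subst (asm) sum_list_nth) (auto simp: is_basis_def coord_def)
qed

lemma coord_add: "is_basis b V \<Longrightarrow> x \<in> V \<Longrightarrow> y \<in> V \<Longrightarrow> coord b i (x + y) = coord b i x + coord b i y"
  unfolding is_basis_def coord_def by (auto simp: complex_vector.representation_add)

lemma coord_diff: "is_basis b V \<Longrightarrow> x \<in> V \<Longrightarrow> y \<in> V \<Longrightarrow> coord b i (x - y) = coord b i x - coord b i y"
  unfolding is_basis_def coord_def by (auto simp: complex_vector.representation_diff)

lemma coord_scale: "is_basis b V \<Longrightarrow> x \<in> V \<Longrightarrow> coord b i (c *\<^sub>C x) = c * coord b i x"
  unfolding is_basis_def coord_def by (auto simp: complex_vector.representation_scale)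

lemma coord_zero [simp]: "coord b i 0 = 0"
  unfolding coord_def by (simp add: complex_vector.representation_zero)

lemma coord_Sum: "is_basis b V \<Longrightarrow> (\<And>k. k \<in> S \<Longrightarrow> f k \<in> V) \<Longrightarrow>
  coord b i (\<Sum>k\<in>S. f k) = (\<Sum>k\<in>S. coord b i (f k))"
  unfolding is_basis_def coord_def by (auto simp: complex_vector.representation_sum)

lemma coord_basis:
  assumes "is_basis b V" "i < length b" "j < length b"
  shows "coord b i (b ! j) = (if i = j then 1 else 0)"
  using assms unfolding is_basis_def coord_def
  by (subst complex_vector.representation_basis) (auto simp: nth_eq_iff_index_eq)

lemma coord_unique:
  assumes b: "is_basis b V" and j: "j < length b"
  shows "coord b j (\<Sum>i<length b. a i *\<^sub>C b ! i) = a j"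
proof -
  have "coord b j (\<Sum>i<length b. a i *\<^sub>C b ! i) = (\<Sum>i<length b. coord b j (a i *\<^sub>C b ! i))"
    using is_basis_subspace[OF b] is_basis_mem[OF b]
    by (intro coord_Sum[OF b]) (auto intro: complex_vector.subspace_scale)
  also have "\<dots> = (\<Sum>i<length b. if i = j then a i else 0)"
    using j by (intro sum.cong) (auto simp: coord_scale[OF b is_basis_mem[OF b]] coord_basis[OF b])
  finally show ?thesis using j by simp
qed

lemma basis_sum_mem: "is_basis b V \<Longrightarrow> (\<Sum>i<length b. a i *\<^sub>C b ! i) \<in> V"
  using is_basis_subspace is_basis_mem
  by (intro complex_vector.subspace_sum) (auto intro!: complex_vector.subspace_scale)

lemma fin_dim_subset: "fin_dim W \<Longrightarrow> V \<subseteq> W \<Longrightarrow> fin_dim V"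
  unfolding fin_dim_def by blast

lemma basis_extend:
  assumes b: "is_basis b V" and V: "V \<subseteq> W" and W: "complex_vector.subspace W" "fin_dim W"
  shows "\<exists>c. is_basis (b @ c) W"
proof -
  obtain T where T: "finite T" "W \<subseteq> complex_vector.span T" using W by (auto simp: fin_dim_def)
  have "set b \<subseteq> W" using b V complex_vector.span_superset by (fastforce simp: is_basis_def)
  then obtain B where B: "set b \<subseteq> B" "B \<subseteq> W" "\<not> complex_vector.dependent B" "W \<subseteq> complex_vector.span B"
    using complex_vector.maximal_independent_subset_extend[of "set b" W] b by (auto simp: is_basis_def)
  have "finite B" using complex_vector.independent_span_bound[OF T(1) B(3)] B T by blast
  then obtain c where c: "set c = B - set b" "distinct c"
    using finite_distinct_list[of "B - set b"] by auto
  have "complex_vector.span B = W"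
    using B W by (metis complex_vector.span_minimal subset_antisym)
  then have "is_basis (b @ c) W"
    using b c B unfolding is_basis_def by (auto simp: Un_absorb1)
  then show ?thesis ..
qed

lemma is_basis_Nil: "is_basis [] {0}"
  by (simp add: is_basis_def complex_vector.independent_empty)

lemma basis_ex:
  assumes "complex_vector.subspace V" "fin_dim V"
  shows "\<exists>b. is_basis b V"
  using basis_extend[OF is_basis_Nil _ assms] complex_vector.subspace_0[OF assms(1)] by auto

lemma fin_dim_span_Un:
  assumes "fin_dim V" "fin_dim W"
  shows "fin_dim (complex_vector.span (V \<union> W))"
proof -
  obtain A B where "finite A" "V \<subseteq> complex_vector.span A" "finite B" "W \<subseteq> complex_vector.span B"
    using assms unfolding fin_dim_def by blast
  then have "finite (A \<union> B)" "V \<union> W \<subseteq> complex_vector.span (A \<union> B)"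
    using complex_vector.span_mono[of A "A \<union> B"] complex_vector.span_mono[of B "A \<union> B"] by blast+
  then show ?thesis
    unfolding fin_dim_def by (metis complex_vector.span_minimal complex_vector.subspace_span)
qed

lemma fin_dim_image:
  assumes "A \<in> bounded_ops" "fin_dim V"
  shows "fin_dim (blinfun_apply A ` V)"
proof -
  interpret Vector_Spaces.linear "(*\<^sub>C)" "(*\<^sub>C)" "blinfun_apply A" by (rule op_linear[OF assms(1)])
  obtain B where "finite B" "V \<subseteq> complex_vector.span B" using assms unfolding fin_dim_def by blast
  then show ?thesis unfolding fin_dim_def
    by (metis finite_imageI image_mono span_image)
qed

lemma basis_append_direct:
  assumes b: "is_basis b V" and c: "is_basis c W" and disj: "V \<inter> W = {0}"
  shows "is_basis (b @ c) (complex_vector.span (V \<union> W))"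
proof -
  have ind: "\<not> complex_vector.dependent (set b)" "\<not> complex_vector.dependent (set c)"
    and sp: "complex_vector.span (set b) = V" "complex_vector.span (set c) = W"
    using b c by (auto simp: is_basis_def)
  have sub: "set b \<subseteq> V" "set c \<subseteq> W"
    using complex_vector.span_superset[of "set b"] complex_vector.span_superset[of "set c"] sp by simp_all
  have ne: "0 \<notin> set b" using ind(1) complex_vector.dependent_zero[of "set b"] by auto
  have dj: "set b \<inter> set c = {}"
  proof (rule equals0I)
    fix x assume x: "x \<in> set b \<inter> set c"
    then have "x \<in> V \<inter> W" using sub by (meson IntE IntI subsetD)
    then show False using disj ne x by simp
  qed
  have "\<not> complex_vector.dependent (set b \<union> set c)"
  proof (rule complex_vector.independent_if_scalars_zero)
    fix f x assume 0: "(\<Sum>x\<in>set b \<union> set c. f x *\<^sub>C x) = 0" and x: "x \<in> set b \<union> set c"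
    have eq: "(\<Sum>x\<in>set b. f x *\<^sub>C x) = - (\<Sum>x\<in>set c. f x *\<^sub>C x)"
      using 0 dj by (simp add: sum.union_disjoint eq_neg_iff_add_eq_0)
    have "(\<Sum>x\<in>set b. f x *\<^sub>C x) \<in> V"
      unfolding sp(1)[symmetric]
      by (intro complex_vector.span_sum complex_vector.span_scale complex_vector.span_base)
    moreover have "- (\<Sum>x\<in>set c. f x *\<^sub>C x) \<in> W"
      unfolding sp(2)[symmetric]
      by (intro complex_vector.span_neg complex_vector.span_sum complex_vector.span_scale complex_vector.span_base)
    ultimately have "(\<Sum>x\<in>set b. f x *\<^sub>C x) \<in> V \<inter> W" unfolding eq by (rule IntI)
    then have "(\<Sum>x\<in>set b. f x *\<^sub>C x) = 0" unfolding disj by (rule singletonD)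
    moreover from this eq have "(\<Sum>x\<in>set c. f x *\<^sub>C x) = 0" by simp
    ultimately show "f x = 0"
      using x complex_vector.independentD[OF ind(1) finite_set order_refl, of f x]
        complex_vector.independentD[OF ind(2) finite_set order_refl, of f x]
      by (elim UnE) simp_all
  qed auto
  moreover have "complex_vector.span (set b \<union> set c) = complex_vector.span (V \<union> W)"
    unfolding complex_vector.span_Un sp complex_vector.span_span[symmetric, of "set b"]
    using sp by (metis complex_vector.span_Un complex_vector.span_span)
  ultimately show ?thesis using b c dj by (auto simp: is_basis_def)
qed

text \<open>Induction over the basis. By the induction hypothesis, convergent linear combinations have convergent
  coefficients, so the span of \<open>B\<close> is closed and a further vector has positive distance from it.\<close>

lemma coefficients_bounded:
  assumes "finite B" "\<not> complex_vector.dependent (B :: 'a::complex_normed_vector set)"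
  shows "\<exists>K\<ge>0. \<forall>a. \<forall>b\<in>B. cmod (a b) \<le> K * norm (\<Sum>b\<in>B. a b *\<^sub>C b)"
  using assms
proof (induction B rule: finite_induct)
  case empty
  then show ?case by (auto intro: exI[of _ 0])
next
  case (insert v B)
  then have iB: "\<not> complex_vector.dependent B" and v: "v \<notin> complex_vector.span B"
    by (auto simp: complex_vector.independent_insert)
  obtain K where K: "K \<ge> 0" "\<And>a b. b \<in> B \<Longrightarrow> cmod (a b) \<le> K * norm (\<Sum>b\<in>B. a b *\<^sub>C b)"
    using insert.IH[OF iB] by blast
  have "\<exists>d>0. \<forall>a. d \<le> norm (v - (\<Sum>b\<in>B. a b *\<^sub>C b))"
  proof (rule ccontr)
    assume "\<not> ?thesis"
    then have "\<exists>a. norm (v - (\<Sum>b\<in>B. a b *\<^sub>C b)) < inverse (real (Suc n))" for n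
      by (metis inverse_positive_iff_positive not_le of_nat_0_less_iff zero_less_Suc)
    then obtain a where a: "\<And>n. norm (v - (\<Sum>b\<in>B. a n b *\<^sub>C b)) < inverse (real (Suc n))" by metis
    have lim: "(\<lambda>n. \<Sum>b\<in>B. a n b *\<^sub>C b) \<longlonglongrightarrow> v"
    proof (rule LIM_zero_cancel, rule LIMSEQ_norm_0)
      show "norm ((\<Sum>b\<in>B. a n b *\<^sub>C b) - v) < 1 / real (Suc n)" for n
        using a[of n] by (simp add: norm_minus_commute inverse_eq_divide)
    qed
    then have "Cauchy (\<lambda>n. \<Sum>b\<in>B. a n b *\<^sub>C b)" by (rule LIMSEQ_imp_Cauchy)
    have "convergent (\<lambda>n. a n b)" if "b \<in> B" for b
    proof (rule Cauchy_convergent, rule metric_CauchyI)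
      fix e :: real assume "e > 0"
      then obtain M where M: "\<And>m n. m \<ge> M \<Longrightarrow> n \<ge> M \<Longrightarrow>
        dist (\<Sum>b\<in>B. a m b *\<^sub>C b) (\<Sum>b\<in>B. a n b *\<^sub>C b) < e / (K + 1)"
        using metric_CauchyD[OF \<open>Cauchy _\<close>, of "e / (K + 1)"] K(1) by (auto simp: add_nonneg_pos)
      have "dist (a m b) (a n b) < e" if "m \<ge> M" "n \<ge> M" for m n
      proof -
        have "cmod (a m b - a n b) \<le> K * norm (\<Sum>b\<in>B. (a m b - a n b) *\<^sub>C b)"
          using K(2)[OF \<open>b \<in> B\<close>, of "\<lambda>b. a m b - a n b"] .
        also have "(\<Sum>b\<in>B. (a m b - a n b) *\<^sub>C b) = (\<Sum>b\<in>B. a m b *\<^sub>C b) - (\<Sum>b\<in>B. a n b *\<^sub>C b)"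
          by (simp add: scaleC_diff_left sum_subtractf)
        also have "K * norm \<dots> \<le> (K + 1) * norm ((\<Sum>b\<in>B. a m b *\<^sub>C b) - (\<Sum>b\<in>B. a n b *\<^sub>C b))"
          by (intro mult_right_mono) auto
        also have "\<dots> < (K + 1) * (e / (K + 1))"
          using M[OF that] K(1) by (intro mult_strict_left_mono) (auto simp: dist_norm)
        finally show ?thesis using K(1) by (simp add: dist_norm)
      qed
      then show "\<exists>M. \<forall>m\<ge>M. \<forall>n\<ge>M. dist (a m b) (a n b) < e" by blast
    qed
    then obtain l where l: "\<And>b. b \<in> B \<Longrightarrow> (\<lambda>n. a n b) \<longlonglongrightarrow> l b"
      unfolding convergent_def by metis
    have "(\<lambda>n. \<Sum>b\<in>B. a n b *\<^sub>C b) \<longlonglongrightarrow> (\<Sum>b\<in>B. l b *\<^sub>C b)"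
      by (intro tendsto_intros l)
    then have "v = (\<Sum>b\<in>B. l b *\<^sub>C b)" using lim LIMSEQ_unique by blast
    moreover have "(\<Sum>b\<in>B. l b *\<^sub>C b) \<in> complex_vector.span B"
      by (intro complex_vector.span_sum complex_vector.span_scale complex_vector.span_base)
    ultimately show False using v by simp
  qed
  then obtain d where d: "d > 0" "\<And>a. d \<le> norm (v - (\<Sum>b\<in>B. a b *\<^sub>C b))" by blast
  have bv: "cmod (a v) \<le> 1 / d * norm (\<Sum>b\<in>insert v B. a b *\<^sub>C b)" for a
  proof (cases "a v = 0")
    case False
    have "a v *\<^sub>C (v - (\<Sum>b\<in>B. (- a b / a v) *\<^sub>C b)) = (\<Sum>b\<in>insert v B. a b *\<^sub>C b)"
      unfolding scaleC_diff_right scaleC_sum_right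
      using insert.hyps False by (simp add: scaleC_scaleC sum_negf)
    then have "norm (\<Sum>b\<in>insert v B. a b *\<^sub>C b) = cmod (a v) * norm (v - (\<Sum>b\<in>B. (- a b / a v) *\<^sub>C b))"
      by (simp only: norm_scaleC[symmetric])
    then have "cmod (a v) * d \<le> norm (\<Sum>b\<in>insert v B. a b *\<^sub>C b)"
      using mult_left_mono[OF d(2)[of "\<lambda>b. - a b / a v"], of "cmod (a v)"] by simp
    then show ?thesis using d by (simp add: field_simps)
  qed (use d in simp)
  have bB: "cmod (a b) \<le> K * (1 + norm v / d) * norm (\<Sum>b\<in>insert v B. a b *\<^sub>C b)" if "b \<in> B" for a b
  proof -
    have "(\<Sum>b\<in>B. a b *\<^sub>C b) = (\<Sum>b\<in>insert v B. a b *\<^sub>C b) - a v *\<^sub>C v" using insert by simp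
    then have "norm (\<Sum>b\<in>B. a b *\<^sub>C b) \<le> norm (\<Sum>b\<in>insert v B. a b *\<^sub>C b) + cmod (a v) * norm v"
      by (metis norm_scaleC norm_triangle_ineq4)
    also have "\<dots> \<le> norm (\<Sum>b\<in>insert v B. a b *\<^sub>C b) + (1 / d * norm (\<Sum>b\<in>insert v B. a b *\<^sub>C b)) * norm v"
      using bv by (intro add_left_mono mult_right_mono) auto
    also have "\<dots> = (1 + norm v / d) * norm (\<Sum>b\<in>insert v B. a b *\<^sub>C b)" by (simp add: algebra_simps)
    finally have "norm (\<Sum>b\<in>B. a b *\<^sub>C b) \<le> (1 + norm v / d) * norm (\<Sum>b\<in>insert v B. a b *\<^sub>C b)" .
    then show ?thesis using K(2)[OF that, of a] mult_left_mono[OF _ K(1)] by (smt (verit) mult.assoc)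
  qed
  define C where "C = max (1 / d) (K * (1 + norm v / d))"
  have "cmod (a b) \<le> C * norm (\<Sum>b\<in>insert v B. a b *\<^sub>C b)" if "b \<in> insert v B" for a b
  proof -
    have "1 / d * norm (\<Sum>b\<in>insert v B. a b *\<^sub>C b) \<le> C * norm (\<Sum>b\<in>insert v B. a b *\<^sub>C b)"
      "K * (1 + norm v / d) * norm (\<Sum>b\<in>insert v B. a b *\<^sub>C b) \<le> C * norm (\<Sum>b\<in>insert v B. a b *\<^sub>C b)"
      unfolding C_def by (intro mult_right_mono max.cobounded1 max.cobounded2 norm_ge_zero)+
    note le = this
    show ?thesis
    proof (cases "b = v")
      case True
      then show ?thesis using order_trans[OF bv[of a] le(1)] by simp
    next
      case False
      then have "b \<in> B" using that by simp
      then show ?thesis using order_trans[OF bB[of b a] le(2)] by simp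
    qed
  qed
  moreover have "C \<ge> 0" using d(1) by (simp add: C_def le_max_iff_disj)
  ultimately show ?case by blast
qed

lemma coord_bounded:
  assumes b: "is_basis b V"
  shows "\<exists>K\<ge>0. \<forall>x\<in>V. \<forall>i<length b. cmod (coord b i x) \<le> K * norm x"
proof -
  obtain K where K: "K \<ge> 0" "\<And>a v. v \<in> set b \<Longrightarrow> cmod (a v) \<le> K * norm (\<Sum>v\<in>set b. a v *\<^sub>C v)"
    using coefficients_bounded[of "set b"] b by (auto simp: is_basis_def)
  have "cmod (coord b i x) \<le> K * norm x" if "x \<in> V" "i < length b" for x i
  proof -
    have "(\<Sum>v\<in>set b. complex_vector.representation (set b) x v *\<^sub>C v) = x"
      using b that by (intro complex_vector.sum_representation_eq) (auto simp: is_basis_def)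
    then show ?thesis using K(2)[of "b ! i" "complex_vector.representation (set b) x"] that
      by (simp add: coord_def)
  qed
  then show ?thesis using K(1) by blast
qed

section \<open>Eigenvalues and triangular bases of invariant subspaces\<close>

lemma eigenvector_ex:
  assumes T: "T \<in> bounded_ops" and b: "is_basis b V" and inv: "blinfun_apply T ` V \<subseteq> V" and ne: "b \<noteq> []"
  shows "\<exists>\<nu>. \<exists>x\<in>V. x \<noteq> 0 \<and> blinfun_apply T x = \<nu> *\<^sub>C x"
proof -
  define n where "n = length b"
  define M where "M = mat n n (\<lambda>(i,j). coord b i (blinfun_apply T (b ! j)))"
  have M: "M \<in> carrier_mat n n" by (simp add: M_def)
  obtain as where as: "char_poly M = (\<Prod>a\<leftarrow>as. [:- a, 1:])" "length as = n"
    using char_poly_factorized[OF M] by blast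
  have "as \<noteq> []" using as ne by (auto simp: n_def)
  then have "poly (char_poly M) (hd as) = 0"
    unfolding as by (cases as) auto
  then obtain v where v: "eigenvector M v (hd as)"
    using eigenvalue_root_char_poly[OF M] by (auto simp: eigenvalue_def)
  then have vc: "v \<in> carrier_vec n" and v0: "v \<noteq> 0\<^sub>v n" and Mv: "M *\<^sub>v v = hd as \<cdot>\<^sub>v v"
    using M by (auto simp: eigenvector_def)
  define x where "x = (\<Sum>i<length b. vec_index v i *\<^sub>C b ! i)"
  have xV: "x \<in> V" unfolding x_def by (rule basis_sum_mem[OF b])
  have cx: "coord b i x = vec_index v i" if "i < n" for i
    unfolding x_def using coord_unique[OF b] that by (simp add: n_def)
  have "x \<noteq> 0"
  proof
    assume "x = 0"
    then have "vec_index v i = 0" if "i < n" for i using cx[OF that] by simp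
    then show False using v0 vc by (auto intro!: eq_vecI)
  qed
  moreover have "blinfun_apply T x = hd as *\<^sub>C x"
  proof -
    have TV: "blinfun_apply T (b ! j) \<in> V" if "j < n" for j
      using inv is_basis_mem[OF b] that by (auto simp: n_def)
    have TxV: "blinfun_apply T x \<in> V" using inv xV by auto
    have Tx: "blinfun_apply T x = (\<Sum>j<n. vec_index v j *\<^sub>C blinfun_apply T (b ! j))"
      unfolding x_def n_def by (simp add: blinfun.sum_right bopsD[OF T])
    have "coord b i (blinfun_apply T x) = hd as * vec_index v i" if i: "i < n" for i
    proof -
      have "coord b i (blinfun_apply T x) = (\<Sum>j<n. coord b i (vec_index v j *\<^sub>C blinfun_apply T (b ! j)))"
        unfolding Tx using TV is_basis_subspace[OF b]
        by (intro coord_Sum[OF b]) (auto intro: complex_vector.subspace_scale)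
      also have "\<dots> = (\<Sum>j<n. M $$ (i,j) * vec_index v j)"
        using i TV by (intro sum.cong) (auto simp: M_def coord_scale[OF b] mult.commute)
      also have "\<dots> = vec_index (M *\<^sub>v v) i"
        using i vc M by (simp add: mult_mat_vec_def scalar_prod_def atLeast0LessThan)
      also have "\<dots> = hd as * vec_index v i" using i vc Mv by simp
      finally show ?thesis .
    qed
    then have "(\<Sum>i<length b. coord b i (blinfun_apply T x) *\<^sub>C b ! i) = (\<Sum>i<length b. hd as *\<^sub>C vec_index v i *\<^sub>C b ! i)"
      by (intro sum.cong) (auto simp: n_def scaleC_scaleC)
    then show ?thesis
      unfolding coord_sum[OF b TxV] by (simp add: x_def scaleC_sum_right)
  qed
  ultimately show ?thesis using xV by blast
qed

text \<open>If \<open>\<nu>\<close> is an eigenvalue on \<open>V\<close>, then \<open>T - \<nu>\<close> maps \<open>V\<close> onto an invariant subspace \<open>W\<close> of smaller dimension.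
  Any extension of a triangular basis of \<open>W\<close> to a basis of \<open>V\<close> is triangular, since \<open>T v - \<nu> v\<close> lies in \<open>W\<close>.\<close>

lemma triangular_basis_ex:
  assumes T: "T \<in> bounded_ops" and V: "complex_vector.subspace V" "fin_dim V"
    and inv: "blinfun_apply T ` V \<subseteq> V"
  shows "\<exists>b \<nu>. is_basis b V \<and> length \<nu> = length b \<and> (\<forall>j<length b.
    blinfun_apply T (b ! j) - \<nu> ! j *\<^sub>C b ! j \<in> complex_vector.span (set (take j b)) \<and>
    (\<exists>x\<in>V. x \<noteq> 0 \<and> blinfun_apply T x = \<nu> ! j *\<^sub>C x))"
  using V inv
proof (induction "complex_vector.dim V" arbitrary: V rule: less_induct)
  case less
  obtain b0 where b0: "is_basis b0 V" using basis_ex less.prems by blast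
  show ?case
  proof (cases "b0 = []")
    case True
    then show ?thesis using b0 by (intro exI[of _ "[]"]) auto
  next
    case False
    obtain \<nu> x where x: "x \<in> V" "x \<noteq> 0" "blinfun_apply T x = \<nu> *\<^sub>C x"
      using eigenvector_ex[OF T b0 less.prems(3) False] by blast
    define G where "G = T - \<nu> *\<^sub>C id_blinfun"
    have Gb: "G \<in> bounded_ops" using T by (simp add: G_def)
    have Gapp: "blinfun_apply G y = blinfun_apply T y - \<nu> *\<^sub>C y" for y by (simp add: G_def op_apply)
    define W where "W = blinfun_apply G ` V"
    have W: "complex_vector.subspace W"
    proof -
      interpret Gl: Vector_Spaces.linear "(*\<^sub>C)" "(*\<^sub>C)" "blinfun_apply G" by (rule op_linear[OF Gb])
      show ?thesis unfolding W_def by (rule Gl.subspace_image[OF less.prems(1)])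
    qed
    have WV: "W \<subseteq> V"
      unfolding W_def Gapp using less.prems by (auto intro!: complex_vector.subspace_diff complex_vector.subspace_scale)
    have fW: "fin_dim W" using fin_dim_subset[OF less.prems(2) WV] .
    have TG: "blinfun_apply T (blinfun_apply G y) = blinfun_apply G (blinfun_apply T y)" for y
      by (simp add: Gapp blinfun.diff_right bopsD[OF T])
    have invW: "blinfun_apply T ` W \<subseteq> W"
      using less.prems(3) by (auto simp: W_def TG)
    have "is_basis [x] (complex_vector.span {x})"
      using x(2) by (simp add: is_basis_def complex_vector.dependent_single)
    moreover have "complex_vector.span {x} \<subseteq> V"
      using x(1) less.prems(1) by (intro complex_vector.span_minimal) auto
    ultimately obtain c where c: "is_basis ([x] @ c) V" using basis_extend less.prems by blast
    have "W \<subseteq> complex_vector.span (blinfun_apply G ` set c)"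
    proof -
      interpret Gl: Vector_Spaces.linear "(*\<^sub>C)" "(*\<^sub>C)" "blinfun_apply G" by (rule op_linear[OF Gb])
      have "W = complex_vector.span (blinfun_apply G ` set ([x] @ c))"
        using c unfolding W_def is_basis_def by (metis Gl.span_image)
      also have "blinfun_apply G ` set ([x] @ c) = insert 0 (blinfun_apply G ` set c)"
        using x(3) by (simp add: Gapp)
      finally show ?thesis by (simp add: complex_vector.span_insert_0)
    qed
    then have "complex_vector.dim W \<le> card (blinfun_apply G ` set c)"
      by (intro complex_vector.dim_le_card) auto
    also have "\<dots> \<le> length c" by (meson card_image_le card_length finite_set le_trans)
    also have "\<dots> < complex_vector.dim V" using is_basis_length[OF c] by simp
    finally have "complex_vector.dim W < complex_vector.dim V" .
    from less.hyps[OF this W fW invW] obtain w \<mu> where w: "is_basis w W" "length \<mu> = length w"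
      and wall: "\<forall>j<length w. blinfun_apply T (w ! j) - \<mu> ! j *\<^sub>C w ! j \<in> complex_vector.span (set (take j w)) \<and>
        (\<exists>x\<in>W. x \<noteq> 0 \<and> blinfun_apply T x = \<mu> ! j *\<^sub>C x)"
      by (elim exE conjE) (rule that)
    have wj: "blinfun_apply T (w ! j) - \<mu> ! j *\<^sub>C w ! j \<in> complex_vector.span (set (take j w))"
      and we: "\<exists>x\<in>W. x \<noteq> 0 \<and> blinfun_apply T x = \<mu> ! j *\<^sub>C x" if "j < length w" for j
      using wall that by blast+
    obtain d where d: "is_basis (w @ d) V" using basis_extend[OF w(1) WV less.prems(1,2)] by blast
    define \<xi> where "\<xi> = \<mu> @ replicate (length d) \<nu>"
    have "blinfun_apply T ((w @ d) ! j) - \<xi> ! j *\<^sub>C (w @ d) ! j \<in> complex_vector.span (set (take j (w @ d))) \<and>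
        (\<exists>x\<in>V. x \<noteq> 0 \<and> blinfun_apply T x = \<xi> ! j *\<^sub>C x)" if j: "j < length (w @ d)" for j
    proof (cases "j < length w")
      case True
      then show ?thesis using wj[OF True] we[OF True] w(2) WV by (auto simp: \<xi>_def nth_append)
    next
      case False
      then have \<xi>j: "\<xi> ! j = \<nu>" using j w(2) by (simp add: \<xi>_def nth_append)
      have "blinfun_apply G ((w @ d) ! j) \<in> W"
        using is_basis_mem[OF d j] by (auto simp: W_def)
      also have "W = complex_vector.span (set w)" using w(1) by (simp add: is_basis_def)
      also have "\<dots> \<subseteq> complex_vector.span (set (take j (w @ d)))"
        using False by (intro complex_vector.span_mono) auto
      finally show ?thesis using x \<xi>j by (auto simp: Gapp)
    qed
    then show ?thesis using d w(2)
      by (intro exI[of _ "w @ d"] exI[of _ \<xi>]) (simp add: \<xi>_def)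
  qed
qed

section \<open>Generalized eigenspaces\<close>

definition gen_eigenspace :: "('a::complex_normed_vector \<Rightarrow>\<^sub>L 'a) \<Rightarrow> complex \<Rightarrow> 'a set"
  where "gen_eigenspace T \<mu> = {x. \<exists>k. blinfun_apply (op_power (T - \<mu> *\<^sub>C id_blinfun) k) x = 0}"

lemma op_power_zero_mono:
  assumes "blinfun_apply (op_power N k) x = 0" "k \<le> l"
  shows "blinfun_apply (op_power N l) x = 0"
proof -
  obtain d where "l = d + k" using assms by (metis le_add_diff_inverse2)
  then show ?thesis using assms by (simp add: op_power_apply funpow_add)
    (metis blinfun.zero_right op_power_apply)
qed

lemma op_power_commute:
  assumes "\<And>x. blinfun_apply B (blinfun_apply A x) = blinfun_apply A (blinfun_apply B x)"
  shows "blinfun_apply B (blinfun_apply (op_power A k) x) = blinfun_apply (op_power A k) (blinfun_apply B x)"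
  by (induction k arbitrary: x) (simp_all add: assms)

lemma gen_eigenspace_subspace:
  assumes T: "T \<in> bounded_ops"
  shows "complex_vector.subspace (gen_eigenspace T \<mu>)"
proof (rule complex_vector.subspaceI)
  let ?N = "T - \<mu> *\<^sub>C id_blinfun"
  have N: "?N \<in> bounded_ops" using T by simp
  show "0 \<in> gen_eigenspace T \<mu>" by (auto simp: gen_eigenspace_def)
  show "x + y \<in> gen_eigenspace T \<mu>" if "x \<in> gen_eigenspace T \<mu>" "y \<in> gen_eigenspace T \<mu>" for x y
  proof -
    obtain k l where "blinfun_apply (op_power ?N k) x = 0" "blinfun_apply (op_power ?N l) y = 0"
      using \<open>x \<in> _\<close> \<open>y \<in> _\<close> by (auto simp: gen_eigenspace_def)
    then have "blinfun_apply (op_power ?N (max k l)) (x + y) = 0"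
      using op_power_zero_mono[of ?N k x "max k l"] op_power_zero_mono[of ?N l y "max k l"]
      by (simp add: blinfun.add_right)
    then show ?thesis by (auto simp: gen_eigenspace_def)
  qed
  show "c *\<^sub>C x \<in> gen_eigenspace T \<mu>" if "x \<in> gen_eigenspace T \<mu>" for c x
    using that bopsD[OF bops_power[OF N]] by (fastforce simp: gen_eigenspace_def)
qed

lemma gen_eigenspace_commute:
  assumes "\<And>x. blinfun_apply B (blinfun_apply T x) = blinfun_apply T (blinfun_apply B x)"
    "B \<in> bounded_ops" "x \<in> gen_eigenspace T \<mu>"
  shows "blinfun_apply B x \<in> gen_eigenspace T \<mu>"
proof -
  obtain k where k: "blinfun_apply (op_power (T - \<mu> *\<^sub>C id_blinfun) k) x = 0"
    using assms(3) by (auto simp: gen_eigenspace_def)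
  have "blinfun_apply B (blinfun_apply (op_power (T - \<mu> *\<^sub>C id_blinfun) k) x)
      = blinfun_apply (op_power (T - \<mu> *\<^sub>C id_blinfun) k) (blinfun_apply B x)"
    using assms by (intro op_power_commute) (simp add: op_apply bopsD)
  then show ?thesis using k by (auto simp: gen_eigenspace_def)
qed

text \<open>\<open>T - \<mu>\<close> maps each vector of a triangular basis into the span of its predecessors, so each application
  shortens the basis by one.\<close>

lemma nilpotent_if_single_eigenvalue:
  assumes T: "T \<in> bounded_ops" and V: "complex_vector.subspace V" "fin_dim V"
    and inv: "blinfun_apply T ` V \<subseteq> V"
    and single: "\<And>\<nu> x. x \<in> V \<Longrightarrow> x \<noteq> 0 \<Longrightarrow> blinfun_apply T x = \<nu> *\<^sub>C x \<Longrightarrow> \<nu> = \<mu>"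
  shows "\<exists>k. \<forall>x\<in>V. blinfun_apply (op_power (T - \<mu> *\<^sub>C id_blinfun) k) x = 0"
proof -
  define N where "N = T - \<mu> *\<^sub>C id_blinfun"
  have N: "N \<in> bounded_ops" using T by (simp add: N_def)
  obtain b \<nu> where b: "is_basis b V"
    and all: "\<forall>j<length b. blinfun_apply T (b ! j) - \<nu> ! j *\<^sub>C b ! j \<in> complex_vector.span (set (take j b)) \<and>
      (\<exists>x\<in>V. x \<noteq> 0 \<and> blinfun_apply T x = \<nu> ! j *\<^sub>C x)"
    using triangular_basis_ex[OF T V inv] by (elim exE conjE) (rule that)
  have tri: "blinfun_apply T (b ! j) - \<nu> ! j *\<^sub>C b ! j \<in> complex_vector.span (set (take j b))"
    and ev: "\<exists>x\<in>V. x \<noteq> 0 \<and> blinfun_apply T x = \<nu> ! j *\<^sub>C x" if "j < length b" for j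
    using all that by blast+
  have "\<forall>x\<in>complex_vector.span (set (take j b)). blinfun_apply (op_power N j) x = 0" if "j \<le> length b" for j
    using that
  proof (induction j)
    case 0
    then show ?case by simp
  next
    case (Suc j)
    show ?case
    proof
      fix x assume "x \<in> complex_vector.span (set (take (Suc j) b))"
      then have "x \<in> complex_vector.span (insert (b ! j) (set (take j b)))"
        using Suc.prems by (simp add: take_Suc_conv_app_nth)
      then obtain c y where y: "y \<in> complex_vector.span (set (take j b))" "x = y + c *\<^sub>C b ! j"
        by (auto simp: complex_vector.span_insert) (metis add.commute diff_add_cancel)
      have 1: "blinfun_apply (op_power N (Suc j)) y = 0"
        using Suc y(1) op_power_zero_mono[of N j y "Suc j"] by (metis Suc_leD le_SucI order_refl)
      have "\<nu> ! j = \<mu>" using ev[of j] single Suc.prems by auto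
      then have "blinfun_apply N (b ! j) \<in> complex_vector.span (set (take j b))"
        using tri[of j] Suc.prems by (simp add: N_def op_apply)
      then have "blinfun_apply (op_power N j) (blinfun_apply N (b ! j)) = 0" using Suc by auto
      then have "blinfun_apply (op_power N (Suc j)) (b ! j) = 0"
        by (simp add: op_power_apply funpow_swap1)
      then show "blinfun_apply (op_power N (Suc j)) x = 0"
        using 1 by (simp only: y(2) blinfun.add_right bopsD[OF bops_power[OF N]]) simp
    qed
  qed
  from this[of "length b"] show ?thesis using b by (auto simp: is_basis_def N_def)
qed

lemma eigenvector_power:
  assumes "T \<in> bounded_ops" "blinfun_apply T x = \<nu> *\<^sub>C x"
  shows "blinfun_apply (op_power T k) x = \<nu> ^ k *\<^sub>C x"
  by (induction k) (simp_all add: assms bopsD scaleC_simps mult.commute)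

lemma eigenvector_shift_power:
  assumes "T \<in> bounded_ops" "blinfun_apply T x = \<nu> *\<^sub>C x"
  shows "blinfun_apply (op_power (T - \<mu> *\<^sub>C id_blinfun) k) x = (\<nu> - \<mu>) ^ k *\<^sub>C x"
  by (rule eigenvector_power) (use assms in \<open>simp_all add: op_apply scaleC_simps\<close>)

lemma gen_eigenspace_single_eigenvalue:
  assumes "T \<in> bounded_ops" "x \<in> gen_eigenspace T \<mu>" "x \<noteq> 0" "blinfun_apply T x = \<nu> *\<^sub>C x"
  shows "\<nu> = \<mu>"
  using assms eigenvector_shift_power[OF assms(1,4)] by (auto simp: gen_eigenspace_def)

lemma gen_eigenspace_invariant:
  "T \<in> bounded_ops \<Longrightarrow> blinfun_apply T ` gen_eigenspace T \<mu> \<subseteq> gen_eigenspace T \<mu>"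
  using gen_eigenspace_commute[of T T] by blast

lemma gen_eigenspace_exponent:
  assumes "T \<in> bounded_ops" "fin_dim (gen_eigenspace T \<mu>)"
  shows "\<exists>k. \<forall>x\<in>gen_eigenspace T \<mu>. blinfun_apply (op_power (T - \<mu> *\<^sub>C id_blinfun) k) x = 0"
  using assms by (intro nilpotent_if_single_eigenvalue gen_eigenspace_subspace gen_eigenspace_invariant)
    (auto intro: gen_eigenspace_single_eigenvalue)

text \<open>\<open>Q\<close> is the product of the powers \<open>(T - \<nu>)\<^sup>k\<close> that kill the generalized eigenspaces. It tells the
  eigenvalues in \<open>S\<close> from all others.\<close>

lemma gen_eigenspaces_annihilator:
  assumes T: "T \<in> bounded_ops" and S: "finite S" "\<And>\<mu>. \<mu> \<in> S \<Longrightarrow> fin_dim (gen_eigenspace T \<mu>)"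
  shows "\<exists>Q\<in>bounded_ops. (\<forall>x. blinfun_apply Q (blinfun_apply T x) = blinfun_apply T (blinfun_apply Q x)) \<and>
    (\<forall>x\<in>complex_vector.span (\<Union>(gen_eigenspace T ` S)). blinfun_apply Q x = 0) \<and>
    (\<forall>\<mu>. \<mu> \<notin> S \<longrightarrow> (\<forall>x. blinfun_apply T x = \<mu> *\<^sub>C x \<longrightarrow> (\<exists>c. c \<noteq> 0 \<and> blinfun_apply Q x = c *\<^sub>C x)))"
  using S
proof (induction S rule: finite_induct)
  case empty
  show ?case by (rule bexI[of _ id_blinfun]) (auto intro: exI[of _ 1] simp: scaleC_one)
next
  case (insert \<nu> S)
  then obtain Q where Q: "Q \<in> bounded_ops"
    and comm: "\<And>x. blinfun_apply Q (blinfun_apply T x) = blinfun_apply T (blinfun_apply Q x)"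
    and kill: "\<And>x. x \<in> complex_vector.span (\<Union>(gen_eigenspace T ` S)) \<Longrightarrow> blinfun_apply Q x = 0"
    and keep: "\<And>\<mu> x. \<mu> \<notin> S \<Longrightarrow> blinfun_apply T x = \<mu> *\<^sub>C x \<Longrightarrow> (\<exists>c. c \<noteq> 0 \<and> blinfun_apply Q x = c *\<^sub>C x)"
    by (metis insertCI)
  obtain k where k: "\<And>x. x \<in> gen_eigenspace T \<nu> \<Longrightarrow> blinfun_apply (op_power (T - \<nu> *\<^sub>C id_blinfun) k) x = 0"
    using gen_eigenspace_exponent[OF T] insert.prems by (metis insertI1)
  define N where "N = op_power (T - \<nu> *\<^sub>C id_blinfun) k"
  have N: "N \<in> bounded_ops" using T by (simp add: N_def)
  have NT: "blinfun_apply N (blinfun_apply T x) = blinfun_apply T (blinfun_apply N x)" for x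
    unfolding N_def by (rule op_power_commute[symmetric]) (simp add: op_apply bopsD[OF T])
  have "complex_vector.subspace {x. blinfun_apply (N o\<^sub>L Q) x = 0}"
    by (rule complex_vector.subspaceI) (use N Q in \<open>auto simp: op_apply bopsD\<close>)
  moreover have "blinfun_apply (N o\<^sub>L Q) x = 0" if x: "x \<in> gen_eigenspace T \<mu>" "\<mu> \<in> insert \<nu> S" for x \<mu>
  proof (cases "\<mu> = \<nu>")
    case True
    then show ?thesis using k[OF gen_eigenspace_commute[OF comm Q]] x(1) by (simp add: N_def)
  next
    case False
    then have "x \<in> \<Union>(gen_eigenspace T ` S)" using x by auto
    then show ?thesis using kill[OF complex_vector.span_base] by (simp add: blinfun.zero_right)
  qed
  then have "\<Union>(gen_eigenspace T ` insert \<nu> S) \<subseteq> {x. blinfun_apply (N o\<^sub>L Q) x = 0}" by auto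
  ultimately have k2: "complex_vector.span (\<Union>(gen_eigenspace T ` insert \<nu> S)) \<subseteq> {x. blinfun_apply (N o\<^sub>L Q) x = 0}"
    by (intro complex_vector.span_minimal)
  have "\<exists>c. c \<noteq> 0 \<and> blinfun_apply (N o\<^sub>L Q) x = c *\<^sub>C x" if "\<mu> \<notin> insert \<nu> S" "blinfun_apply T x = \<mu> *\<^sub>C x" for \<mu> x
  proof -
    have "\<exists>c. c \<noteq> 0 \<and> blinfun_apply Q x = c *\<^sub>C x"
      using that by (intro keep[of \<mu> x]) auto
    then obtain c where c: "c \<noteq> 0" "blinfun_apply Q x = c *\<^sub>C x" by (elim exE conjE)
    have "blinfun_apply (N o\<^sub>L Q) x = (c * (\<mu> - \<nu>) ^ k) *\<^sub>C x"
      by (simp only: blinfun_apply_blinfun_compose c(2) bopsD[OF N])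
        (simp only: N_def eigenvector_shift_power[OF T that(2)] scaleC_scaleC)
    then show ?thesis using c that by (intro exI[of _ "c * (\<mu> - \<nu>) ^ k"]) auto
  qed
  then show ?case using N Q NT comm k2
    by (intro bexI[of _ "N o\<^sub>L Q"]) auto
qed

text \<open>A common vector of a generalized eigenspace and the span of the others would yield an eigenvector
  with two different eigenvalues; hence the sum is direct and dimensions add up.\<close>

lemma span_Union_gen_eigenspaces:
  assumes T: "T \<in> bounded_ops" and S: "finite S" "\<And>\<mu>. \<mu> \<in> S \<Longrightarrow> fin_dim (gen_eigenspace T \<mu>)"
  defines "M \<equiv> complex_vector.span (\<Union>(gen_eigenspace T ` S))"
  shows "fin_dim M" "blinfun_apply T ` M \<subseteq> M"
    "\<And>x \<nu>. x \<in> M \<Longrightarrow> x \<noteq> 0 \<Longrightarrow> blinfun_apply T x = \<nu> *\<^sub>C x \<Longrightarrow> \<nu> \<in> S"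
    "complex_vector.dim M = (\<Sum>\<mu>\<in>S. complex_vector.dim (gen_eigenspace T \<mu>))"
proof -
  interpret Tl: Vector_Spaces.linear "(*\<^sub>C)" "(*\<^sub>C)" "blinfun_apply T" by (rule op_linear[OF T])
  have inv: "blinfun_apply T ` complex_vector.span (\<Union>(gen_eigenspace T ` S')) \<subseteq> complex_vector.span (\<Union>(gen_eigenspace T ` S'))" for S'
    unfolding Tl.span_image[symmetric]
    using gen_eigenspace_invariant[OF T] by (intro complex_vector.span_mono) blast
  then show "blinfun_apply T ` M \<subseteq> M" by (simp add: M_def)
  have ev: "\<nu> \<in> S'" if "S' \<subseteq> S" "x \<in> complex_vector.span (\<Union>(gen_eigenspace T ` S'))" "x \<noteq> 0" "blinfun_apply T x = \<nu> *\<^sub>C x" for S' x \<nu>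
    using gen_eigenspaces_annihilator[OF T, of S'] that S finite_subset
    by (metis complex_vector.scale_eq_0_iff subset_iff)
  then show "\<And>x \<nu>. x \<in> M \<Longrightarrow> x \<noteq> 0 \<Longrightarrow> blinfun_apply T x = \<nu> *\<^sub>C x \<Longrightarrow> \<nu> \<in> S"
    by (auto simp: M_def)
  have "\<exists>b. is_basis b (complex_vector.span (\<Union>(gen_eigenspace T ` S'))) \<and>
      length b = (\<Sum>\<mu>\<in>S'. complex_vector.dim (gen_eigenspace T \<mu>))" if "S' \<subseteq> S" for S'
    using finite_subset[OF that S(1)] that
  proof (induction S' rule: finite_induct)
    case empty
    show ?case using is_basis_Nil by (intro exI[of _ "[]"]) simp
  next
    case (insert \<mu> S')
    let ?M = "complex_vector.span (\<Union>(gen_eigenspace T ` S'))"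
    obtain b where b: "is_basis b ?M" "length b = (\<Sum>\<mu>\<in>S'. complex_vector.dim (gen_eigenspace T \<mu>))"
      using insert by auto
    obtain c where c: "is_basis c (gen_eigenspace T \<mu>)"
      using basis_ex[OF gen_eigenspace_subspace[OF T] S(2)] insert.prems by blast
    have "x = 0" if x: "x \<in> ?M" "x \<in> gen_eigenspace T \<mu>" for x
    proof (rule ccontr)
      assume "x \<noteq> 0"
      let ?W = "?M \<inter> gen_eigenspace T \<mu>"
      have sW: "complex_vector.subspace ?W"
        by (intro complex_vector.subspace_inter gen_eigenspace_subspace[OF T]) auto
      have fW: "fin_dim ?W" using fin_dim_subset[OF is_basis_fin_dim[OF c]] by blast
      obtain w where w: "is_basis w ?W" using basis_ex[OF sW fW] by blast
      have "w \<noteq> []" using w x \<open>x \<noteq> 0\<close> by (auto simp: is_basis_def)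
      moreover have "blinfun_apply T ` ?W \<subseteq> ?W"
        using inv[of S'] gen_eigenspace_invariant[OF T, of \<mu>] by blast
      ultimately obtain \<nu> y where y: "y \<in> ?W" "y \<noteq> 0" "blinfun_apply T y = \<nu> *\<^sub>C y"
        using eigenvector_ex[OF T w] by blast
      then have "\<nu> = \<mu>" "\<nu> \<in> S'"
        using gen_eigenspace_single_eigenvalue[OF T] ev[of S' y \<nu>] insert.prems by auto
      then show False using insert.hyps by simp
    qed
    then have "?M \<inter> gen_eigenspace T \<mu> = {0}"
      using complex_vector.span_zero complex_vector.subspace_0[OF gen_eigenspace_subspace[OF T]] by blast
    from basis_append_direct[OF b(1) c this]
    have "is_basis (b @ c) (complex_vector.span (?M \<union> gen_eigenspace T \<mu>))" .
    moreover have "complex_vector.span (?M \<union> gen_eigenspace T \<mu>) = complex_vector.span (\<Union>(gen_eigenspace T ` insert \<mu> S'))"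
      by (simp add: Un_commute complex_vector.span_Un complex_vector.span_span)
    ultimately show ?case using b(2) is_basis_length[OF c] insert.hyps
      by (intro exI[of _ "b @ c"]) simp
  qed
  then obtain b where "is_basis b M" "length b = (\<Sum>\<mu>\<in>S. complex_vector.dim (gen_eigenspace T \<mu>))"
    unfolding M_def by blast
  then show "fin_dim M" "complex_vector.dim M = (\<Sum>\<mu>\<in>S. complex_vector.dim (gen_eigenspace T \<mu>))"
    by (simp_all add: is_basis_fin_dim is_basis_length)
qed

section \<open>Finite rank operators\<close>

lemma finite_rank_iff: "F \<in> finite_rank_ops \<longleftrightarrow> F \<in> bounded_ops \<and> fin_dim (range (blinfun_apply F))"
  by (simp add: finite_rank_ops_def fin_dim_def)

lemma finite_rank_bops [simp]: "F \<in> finite_rank_ops \<Longrightarrow> F \<in> bounded_ops"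
  by (simp add: finite_rank_iff)

lemma finite_rankI: "F \<in> bounded_ops \<Longrightarrow> fin_dim V \<Longrightarrow> (\<And>x. blinfun_apply F x \<in> V) \<Longrightarrow> F \<in> finite_rank_ops"
  unfolding finite_rank_iff by (auto intro: fin_dim_subset)

lemma finite_rank_comp_right [simp]:
  "F \<in> finite_rank_ops \<Longrightarrow> B \<in> bounded_ops \<Longrightarrow> F o\<^sub>L B \<in> finite_rank_ops"
  by (rule finite_rankI[of _ "range (blinfun_apply F)"]) (auto simp: finite_rank_iff)

lemma finite_rank_comp_left [simp]:
  "F \<in> finite_rank_ops \<Longrightarrow> B \<in> bounded_ops \<Longrightarrow> B o\<^sub>L F \<in> finite_rank_ops"
  by (rule finite_rankI[of _ "blinfun_apply B ` range (blinfun_apply F)"])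
    (auto simp: finite_rank_iff intro: fin_dim_image)

lemma finite_rank_add [simp]:
  assumes "F \<in> finite_rank_ops" "G \<in> finite_rank_ops"
  shows "F + G \<in> finite_rank_ops"
  by (rule finite_rankI[of _ "complex_vector.span (range (blinfun_apply F) \<union> range (blinfun_apply G))"])
    (use assms in \<open>auto simp: finite_rank_iff op_apply intro!: fin_dim_span_Un
      complex_vector.span_add intro: complex_vector.span_base\<close>)

lemma finite_rank_scaleC [simp]:
  assumes "F \<in> finite_rank_ops"
  shows "c *\<^sub>C F \<in> finite_rank_ops"
proof -
  have "c *\<^sub>C F = F o\<^sub>L (c *\<^sub>C id_blinfun)"
    using assms by (intro blinfun_eqI) (simp add: op_apply bopsD)
  then show ?thesis using assms by simp
qed

lemma finite_rank_uminus [simp]: "F \<in> finite_rank_ops \<Longrightarrow> - F \<in> finite_rank_ops"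
  using finite_rank_scaleC[of F "-1"] by (simp add: scaleC_one)

lemma finite_rank_diff [simp]: "F \<in> finite_rank_ops \<Longrightarrow> G \<in> finite_rank_ops \<Longrightarrow> F - G \<in> finite_rank_ops"
  using finite_rank_add[of F "-G"] by simp

lemma finite_rank_zero [simp]: "0 \<in> finite_rank_ops"
  by (rule finite_rankI[of _ "{0}"]) (auto simp: is_basis_fin_dim[OF is_basis_Nil])

lemma finite_rank_power [simp]: "F \<in> finite_rank_ops \<Longrightarrow> 0 < k \<Longrightarrow> op_power F k \<in> finite_rank_ops"
  by (cases k) auto

lemma range_basis_is_basis:
  assumes "F \<in> finite_rank_ops"
  shows "is_basis (range_basis F) (range (blinfun_apply F))"
proof -
  obtain b where "is_basis b (range (blinfun_apply F))"
    using basis_ex[OF range_op_subspace] assms by (auto simp: finite_rank_iff)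
  then show ?thesis unfolding range_basis_def is_basis_def by (rule someI)
qed

section \<open>Determinant and trace in an arbitrary basis\<close>

text \<open>Sylvester's identity: both sides are the determinant of the block matrix with rows \<open>(1, Z)\<close> and \<open>(Y, 1)\<close>,
  from which \<open>Y\<close> is eliminated by column or by row operations.\<close>

lemma det_one_minus_commute:
  assumes Z: "Z \<in> carrier_mat m d" and Y: "(Y :: complex mat) \<in> carrier_mat d m"
  shows "Determinant.det (1\<^sub>m m - Z * Y) = Determinant.det (1\<^sub>m d - Y * Z)"
proof -
  let ?M = "four_block_mat (1\<^sub>m m) Z Y (1\<^sub>m d)"
  let ?L = "four_block_mat (1\<^sub>m m) (0\<^sub>m m d) (- Y) (1\<^sub>m d)"
  have M: "?M \<in> carrier_mat (m + d) (m + d)" and L: "?L \<in> carrier_mat (m + d) (m + d)"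
    using Z Y by auto
  have dL: "Determinant.det ?L = 1"
    by (subst det_four_block_mat_upper_right_zero[of _ m _ d]) (use Y in auto)
  have "?M * ?L = four_block_mat (1\<^sub>m m - Z * Y) Z (0\<^sub>m d m) (1\<^sub>m d)"
    by (subst mult_four_block_mat[of _ m m _ d _ d _ _ m _ d]) (use Z Y in \<open>auto intro!: cong_four_block_mat\<close>)
  then have 1: "Determinant.det (?M * ?L) = Determinant.det (1\<^sub>m m - Z * Y)"
    by (simp only:) (subst det_four_block_mat_lower_left_zero[of _ m _ d], use Z Y in auto)
  have "?L * ?M = four_block_mat (1\<^sub>m m) Z (0\<^sub>m d m) (1\<^sub>m d - Y * Z)"
    by (subst mult_four_block_mat[of _ m m _ d _ d _ _ m _ d]) (use Z Y in \<open>auto intro!: cong_four_block_mat\<close>)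
  then have 2: "Determinant.det (?L * ?M) = Determinant.det (1\<^sub>m d - Y * Z)"
    by (simp only:) (subst det_four_block_mat_lower_left_zero[of _ m _ d], use Z Y in auto)
  show ?thesis using 1 2 det_mult[OF M L] det_mult[OF L M] dL by simp
qed

definition op_mat :: "'a::complex_normed_vector list \<Rightarrow> ('a \<Rightarrow>\<^sub>L 'a) \<Rightarrow> complex mat"
  where "op_mat b F = mat (length b) (length b) (\<lambda>(i, j). coord b i (blinfun_apply F (b ! j)))"

lemma op_mat_carrier [simp]: "op_mat b F \<in> carrier_mat (length b) (length b)"
  "dim_row (op_mat b F) = length b" "dim_col (op_mat b F) = length b"
  by (simp_all add: op_mat_def)

lemma coord_apply_sum:
  assumes u: "is_basis u U" and b: "is_basis b V" and A: "A \<in> bounded_ops"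
    and AU: "blinfun_apply A ` U \<subseteq> V" and x: "x \<in> U"
  shows "coord b i (blinfun_apply A x) = (\<Sum>k<length u. coord b i (blinfun_apply A (u ! k)) * coord u k x)"
proof -
  have m: "blinfun_apply A (u ! k) \<in> V" if "k < length u" for k
    using is_basis_mem[OF u that] AU by blast
  have "coord b i (blinfun_apply A x) = coord b i (blinfun_apply A (\<Sum>k<length u. coord u k x *\<^sub>C u ! k))"
    by (simp add: coord_sum[OF u x])
  also have "\<dots> = coord b i (\<Sum>k<length u. coord u k x *\<^sub>C blinfun_apply A (u ! k))"
    by (simp add: blinfun.sum_right bopsD[OF A])
  also have "\<dots> = (\<Sum>k<length u. coord b i (coord u k x *\<^sub>C blinfun_apply A (u ! k)))"
    using m is_basis_subspace[OF b] by (intro coord_Sum[OF b]) (auto intro: complex_vector.subspace_scale)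
  also have "\<dots> = (\<Sum>k<length u. coord b i (blinfun_apply A (u ! k)) * coord u k x)"
    using m by (intro sum.cong) (auto simp: coord_scale[OF b] mult.commute)
  finally show ?thesis .
qed

lemma coord_basis_change:
  assumes u: "is_basis u U" and b: "is_basis b V" and UV: "U \<subseteq> V" and x: "x \<in> U"
  shows "coord b i x = (\<Sum>k<length u. coord b i (u ! k) * coord u k x)"
  using coord_apply_sum[OF u b bops_id _ x] UV by simp

text \<open>Determinant and trace may be computed in any basis of any finite-dimensional space that contains the
  range: the matrix there is \<open>Z Y\<close>, the one on the range is \<open>Y Z\<close>, where \<open>Z\<close> expresses the range basis in
  the new basis. This freedom lets several operators share one basis.\<close>

lemma fr_det_trace_basis:
  assumes F: "F \<in> finite_rank_ops" and u: "is_basis u V" and FV: "range (blinfun_apply F) \<subseteq> V"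
  shows "fr_det F = Determinant.det (1\<^sub>m (length u) - op_mat u F)"
    and "fr_trace F = (\<Sum>i<length u. coord u i (blinfun_apply F (u ! i)))"
proof -
  define b where "b = range_basis F"
  have b: "is_basis b (range (blinfun_apply F))" unfolding b_def by (rule range_basis_is_basis[OF F])
  have Fb: "F \<in> bounded_ops" using F by simp
  have rm: "range_matrix F = op_mat b F"
    by (simp add: range_matrix_def op_mat_def b_def coord_def Let_def)
  define Z where "Z = mat (length u) (length b) (\<lambda>(i, k). coord u i (b ! k))"
  define Y where "Y = mat (length b) (length u) (\<lambda>(k, j). coord b k (blinfun_apply F (u ! j)))"
  have Z: "Z \<in> carrier_mat (length u) (length b)" and Y: "Y \<in> carrier_mat (length b) (length u)"
    by (auto simp: Z_def Y_def)
  have bV: "b ! k \<in> V" if "k < length b" for k using is_basis_mem[OF b that] FV by auto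
  have ZY: "coord u i (blinfun_apply F (u ! j)) = (\<Sum>k<length b. coord u i (b ! k) * coord b k (blinfun_apply F (u ! j)))" for i j
    by (rule coord_basis_change[OF b u FV]) auto
  have YZ: "coord b i (blinfun_apply F (b ! j)) = (\<Sum>k<length u. coord b i (blinfun_apply F (u ! k)) * coord u k (b ! j))"
    if "j < length b" for i j
    by (rule coord_apply_sum[OF u b Fb _ bV[OF that]]) auto
  have 1: "op_mat u F = Z * Y"
    by (rule eq_matI) (use Z Y in \<open>auto simp: op_mat_def Z_def Y_def scalar_prod_def ZY atLeast0LessThan\<close>)
  have 2: "op_mat b F = Y * Z"
    by (rule eq_matI) (use Z Y in \<open>auto simp: op_mat_def Z_def Y_def scalar_prod_def YZ atLeast0LessThan\<close>)
  show "fr_det F = Determinant.det (1\<^sub>m (length u) - op_mat u F)"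
    unfolding fr_det_def rm 1 b_def[symmetric] 2 by (rule det_one_minus_commute[OF Z Y, symmetric])
  have "fr_trace F = (\<Sum>i<length b. coord b i (blinfun_apply F (b ! i)))"
    unfolding fr_trace_def rm b_def[symmetric] by (simp add: op_mat_def)
  also have "\<dots> = (\<Sum>i<length b. \<Sum>k<length u. coord b i (blinfun_apply F (u ! k)) * coord u k (b ! i))"
    using YZ by (intro sum.cong) auto
  also have "\<dots> = (\<Sum>k<length u. \<Sum>i<length b. coord u k (b ! i) * coord b i (blinfun_apply F (u ! k)))"
    by (subst sum.swap) (simp add: mult.commute)
  also have "\<dots> = (\<Sum>k<length u. coord u k (blinfun_apply F (u ! k)))"
    by (simp only: ZY[symmetric])
  finally show "fr_trace F = (\<Sum>i<length u. coord u i (blinfun_apply F (u ! i)))" .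
qed

lemma joint_basis_ex:
  assumes "F \<in> finite_rank_ops" "G \<in> finite_rank_ops"
  shows "\<exists>V u. is_basis u V \<and> range (blinfun_apply F) \<subseteq> V \<and> range (blinfun_apply G) \<subseteq> V"
proof -
  let ?V = "complex_vector.span (range (blinfun_apply F) \<union> range (blinfun_apply G))"
  have "fin_dim ?V" using assms by (intro fin_dim_span_Un) (auto simp: finite_rank_iff)
  then obtain u where "is_basis u ?V" using basis_ex by blast
  moreover have "range (blinfun_apply F) \<union> range (blinfun_apply G) \<subseteq> ?V"
    by (rule complex_vector.span_superset)
  ultimately show ?thesis by blast
qed

lemma fr_trace_add:
  assumes F: "F \<in> finite_rank_ops" and G: "G \<in> finite_rank_ops"
  shows "fr_trace (F + G) = fr_trace F + fr_trace G"
proof -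
  obtain V u where u: "is_basis u V" "range (blinfun_apply F) \<subseteq> V" "range (blinfun_apply G) \<subseteq> V"
    using joint_basis_ex[OF F G] by blast
  have "range (blinfun_apply (F + G)) \<subseteq> V"
    using u is_basis_subspace[OF u(1)] by (auto simp: op_apply intro!: complex_vector.subspace_add)
  then show ?thesis
    using u F G by (subst (1 2 3) fr_det_trace_basis(2)[OF _ u(1)])
      (auto simp: op_apply image_subset_iff coord_add[OF u(1)] sum.distrib)
qed

lemma fr_trace_scaleC:
  assumes F: "F \<in> finite_rank_ops"
  shows "fr_trace (c *\<^sub>C F) = c * fr_trace F"
proof -
  obtain V u where u: "is_basis u V" "range (blinfun_apply F) \<subseteq> V"
    using joint_basis_ex[OF F F] by blast
  have "range (blinfun_apply (c *\<^sub>C F)) \<subseteq> V"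
    using u is_basis_subspace[OF u(1)] by (auto simp: op_apply intro!: complex_vector.subspace_scale)
  then show ?thesis
    using u F by (subst (1 2) fr_det_trace_basis(2)[OF _ u(1)])
      (auto simp: op_apply image_subset_iff coord_scale[OF u(1)] sum_distrib_left)
qed

lemma fr_trace_diff:
  assumes F: "F \<in> finite_rank_ops" and G: "G \<in> finite_rank_ops"
  shows "fr_trace (F - G) = fr_trace F - fr_trace G"
  using fr_trace_add[of F "(-1) *\<^sub>C G"] fr_trace_scaleC[OF G, of "-1"] F G by (simp add: scaleC_one)

lemma fr_det_zero [simp]: "fr_det 0 = 1"
  using fr_det_trace_basis(1)[OF finite_rank_zero is_basis_Nil] det_def'[of _ 0]
  by (simp add: op_mat_def minus_carrier_mat)

lemma fr_trace_zero [simp]: "fr_trace 0 = 0"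
  using fr_det_trace_basis(2)[OF finite_rank_zero is_basis_Nil] by simp

lemma fr_trace_commute:
  assumes A: "A \<in> finite_rank_ops" and B: "B \<in> bounded_ops"
  shows "fr_trace (A o\<^sub>L B) = fr_trace (B o\<^sub>L A)"
proof -
  let ?U = "range (blinfun_apply A)" and ?W = "range (blinfun_apply (B o\<^sub>L A))"
  have BA: "B o\<^sub>L A \<in> finite_rank_ops" and AB: "A o\<^sub>L B \<in> finite_rank_ops" using A B by auto
  obtain u where u: "is_basis u ?U"
    using range_basis_is_basis[OF A] by blast
  obtain w where w: "is_basis w ?W"
    using range_basis_is_basis[OF BA] by blast
  have 1: "fr_trace (A o\<^sub>L B) = (\<Sum>i<length u. \<Sum>k<length w. coord u i (blinfun_apply A (w ! k)) * coord w k (blinfun_apply B (u ! i)))"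
  proof -
    have "coord u i (blinfun_apply (A o\<^sub>L B) (u ! i)) =
      (\<Sum>k<length w. coord u i (blinfun_apply A (w ! k)) * coord w k (blinfun_apply B (u ! i)))"
      if "i < length u" for i
      unfolding blinfun_apply_blinfun_compose
      using is_basis_mem[OF u that] A by (intro coord_apply_sum[OF w u]) auto
    then show ?thesis
      using fr_det_trace_basis(2)[OF AB u] by auto
  qed
  have 2: "fr_trace (B o\<^sub>L A) = (\<Sum>k<length w. \<Sum>i<length u. coord w k (blinfun_apply B (u ! i)) * coord u i (blinfun_apply A (w ! k)))"
  proof -
    have "coord w k (blinfun_apply (B o\<^sub>L A) (w ! k)) =
      (\<Sum>i<length u. coord w k (blinfun_apply B (u ! i)) * coord u i (blinfun_apply A (w ! k)))" for k
      unfolding blinfun_apply_blinfun_compose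
      using B by (intro coord_apply_sum[OF u w]) auto
    then show ?thesis
      using fr_det_trace_basis(2)[OF BA w] by auto
  qed
  show ?thesis unfolding 1 2 by (subst sum.swap) (simp add: mult.commute)
qed

text \<open>By cyclicity the trace is that of \<open>G (C B)\<close>, which lives on the fixed range of \<open>G\<close>, where coordinates are
  bounded.\<close>

lemma fr_trace_sandwich_bound:
  assumes G: "G \<in> finite_rank_ops"
  shows "\<exists>c\<ge>0. \<forall>B\<in>bounded_ops. \<forall>C\<in>bounded_ops. cmod (fr_trace (B o\<^sub>L G o\<^sub>L C)) \<le> c * norm B * norm C"
proof -
  obtain u where u: "is_basis u (range (blinfun_apply G))"
    using range_basis_is_basis[OF G] by blast
  obtain K where K: "K \<ge> 0" "\<And>x i. x \<in> range (blinfun_apply G) \<Longrightarrow> i < length u \<Longrightarrow> cmod (coord u i x) \<le> K * norm x"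
    using coord_bounded[OF u] by blast
  define c where "c = (\<Sum>i<length u. K * (norm G * norm (u ! i)))"
  have c0: "c \<ge> 0" unfolding c_def using K(1) by (intro sum_nonneg) auto
  have "cmod (fr_trace (B o\<^sub>L G o\<^sub>L C)) \<le> c * norm B * norm C" if BC: "B \<in> bounded_ops" "C \<in> bounded_ops" for B C
  proof -
    have GCB: "G o\<^sub>L (C o\<^sub>L B) \<in> finite_rank_ops" using G BC by simp
    have "fr_trace (B o\<^sub>L G o\<^sub>L C) = fr_trace (B o\<^sub>L (G o\<^sub>L C))"
      by (rule arg_cong[where f = fr_trace]) (rule blinfun_eqI, simp)
    also have "\<dots> = fr_trace ((G o\<^sub>L C) o\<^sub>L B)"
      using G BC by (intro fr_trace_commute[symmetric]) auto
    also have "(G o\<^sub>L C) o\<^sub>L B = G o\<^sub>L (C o\<^sub>L B)" by (rule blinfun_eqI) simp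
    finally have "fr_trace (B o\<^sub>L G o\<^sub>L C) = (\<Sum>i<length u. coord u i (blinfun_apply (G o\<^sub>L (C o\<^sub>L B)) (u ! i)))"
      using fr_det_trace_basis(2)[OF GCB u] by auto
    also have "cmod \<dots> \<le> (\<Sum>i<length u. K * (norm G * norm (u ! i)) * (norm B * norm C))"
    proof (rule sum_norm_le)
      fix i assume i: "i \<in> {..<length u}"
      have "cmod (coord u i (blinfun_apply (G o\<^sub>L (C o\<^sub>L B)) (u ! i))) \<le> K * norm (blinfun_apply G (blinfun_apply C (blinfun_apply B (u ! i))))"
        using K(2) i by auto
      also have "\<dots> \<le> K * (norm G * (norm C * (norm B * norm (u ! i))))"
        using K(1) by (intro mult_left_mono order_trans[OF norm_blinfun]) (auto intro!: mult_left_mono order_trans[OF norm_blinfun])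
      finally show "cmod (coord u i (blinfun_apply (G o\<^sub>L (C o\<^sub>L B)) (u ! i))) \<le> K * (norm G * norm (u ! i)) * (norm B * norm C)"
        by (simp add: mult_ac)
    qed
    also have "\<dots> = c * norm B * norm C" by (simp add: c_def sum_distrib_right mult.assoc)
    finally show ?thesis .
  qed
  then show ?thesis using c0 by blast
qed

lemma op_mat_compose:
  assumes u: "is_basis u V" and F: "F \<in> bounded_ops" "range (blinfun_apply F) \<subseteq> V"
    and G: "range (blinfun_apply G) \<subseteq> V"
  shows "op_mat u (F o\<^sub>L G) = op_mat u F * op_mat u G"
proof (rule eq_matI)
  fix i j assume "i < dim_row (op_mat u F * op_mat u G)" "j < dim_col (op_mat u F * op_mat u G)"
  then have ij: "i < length u" "j < length u" by auto
  have "coord u i (blinfun_apply F (blinfun_apply G (u ! j)))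
      = (\<Sum>k<length u. coord u i (blinfun_apply F (u ! k)) * coord u k (blinfun_apply G (u ! j)))"
    using F G by (intro coord_apply_sum[OF u u]) auto
  then show "op_mat u (F o\<^sub>L G) $$ (i, j) = (op_mat u F * op_mat u G) $$ (i, j)"
    using ij by (simp add: op_mat_def scalar_prod_def atLeast0LessThan)
qed auto

lemma fr_det_mult:
  assumes F: "F \<in> finite_rank_ops" and G: "G \<in> finite_rank_ops"
  shows "fr_det (F + G - (F o\<^sub>L G)) = fr_det F * fr_det G"
proof -
  obtain V u where u: "is_basis u V" "range (blinfun_apply F) \<subseteq> V" "range (blinfun_apply G) \<subseteq> V"
    using joint_basis_ex[OF F G] by blast
  let ?H = "F + G - (F o\<^sub>L G)" and ?n = "length u"
  have sV: "complex_vector.subspace V" by (rule is_basis_subspace[OF u(1)])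
  have mem: "blinfun_apply F x \<in> V" "blinfun_apply G x \<in> V" for x using u by auto
  have H: "range (blinfun_apply ?H) \<subseteq> V"
    using mem by (auto simp: op_apply intro!: complex_vector.subspace_add[OF sV] complex_vector.subspace_diff[OF sV])
  have HF: "?H \<in> finite_rank_ops" using F G by simp
  have eF: "op_mat u ?H = op_mat u F + op_mat u G - op_mat u F * op_mat u G"
    unfolding op_mat_compose[OF u(1) finite_rank_bops[OF F] u(2,3), symmetric]
    by (rule eq_matI) (use mem sV in \<open>auto simp: op_mat_def op_apply coord_diff[OF u(1)] coord_add[OF u(1)] complex_vector.subspace_add\<close>)
  have "(1\<^sub>m ?n - op_mat u F) * (1\<^sub>m ?n - op_mat u G) = 1\<^sub>m ?n - op_mat u ?H"
  proof -
    have "(1\<^sub>m ?n - op_mat u F) * (1\<^sub>m ?n - op_mat u G)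
        = 1\<^sub>m ?n * (1\<^sub>m ?n - op_mat u G) - op_mat u F * (1\<^sub>m ?n - op_mat u G)"
      by (rule minus_mult_distrib_mat) (auto intro: minus_carrier_mat)
    also have "\<dots> = (1\<^sub>m ?n - op_mat u G) - (op_mat u F * 1\<^sub>m ?n - op_mat u F * op_mat u G)"
      by (subst mult_minus_distrib_mat[of _ ?n ?n]) (auto intro: minus_carrier_mat)
    also have "\<dots> = 1\<^sub>m ?n - op_mat u ?H"
      unfolding eF by (rule eq_matI) auto
    finally show ?thesis .
  qed
  then show ?thesis
    using det_mult[of "1\<^sub>m ?n - op_mat u F" ?n "1\<^sub>m ?n - op_mat u G"]
    unfolding fr_det_trace_basis(1)[OF HF u(1) H] fr_det_trace_basis(1)[OF F u(1,2)]
      fr_det_trace_basis(1)[OF G u(1,3)]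
    by (simp add: minus_carrier_mat)
qed

lemma fr_det_similar:
  assumes S: "inverse_op S S'" "S \<in> bounded_ops" and G: "G \<in> finite_rank_ops"
  shows "fr_det (S o\<^sub>L G o\<^sub>L S') = fr_det G"
proof -
  have S': "S' \<in> bounded_ops" using S by (simp add: inverse_op_def)
  obtain u where u: "is_basis u (range (blinfun_apply G))"
    using range_basis_is_basis[OF G] by blast
  interpret Sl: Vector_Spaces.linear "(*\<^sub>C)" "(*\<^sub>C)" "blinfun_apply S" by (rule op_linear[OF S(2)])
  have inj: "inj (blinfun_apply S)" by (metis injI inverse_op_apply(2)[OF S(1)])
  define w where "w = map (blinfun_apply S) u"
  have w: "is_basis w (blinfun_apply S ` range (blinfun_apply G))"
    using u unfolding is_basis_def w_def
    by (auto simp: distinct_map Sl.span_image inj_on_subset[OF inj] intro!: Sl.independent_inj_image[OF _ inj])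
  have c: "coord w i (blinfun_apply S x) = coord u i x" if "i < length u" "x \<in> range (blinfun_apply G)" for i x
  proof -
    have "blinfun_apply S x = (\<Sum>k<length w. coord u k x *\<^sub>C w ! k)"
      using arg_cong[OF coord_sum[OF u that(2)], of "blinfun_apply S"]
      by (simp add: w_def blinfun.sum_right bopsD[OF S(2)])
    then show ?thesis using coord_unique[OF w] that by (simp add: w_def)
  qed
  have "op_mat w (S o\<^sub>L G o\<^sub>L S') = op_mat u G"
    by (rule eq_matI) (auto simp: op_mat_def w_def inverse_op_apply[OF S(1)] c[unfolded w_def])
  moreover have "fr_det (S o\<^sub>L G o\<^sub>L S') = Determinant.det (1\<^sub>m (length w) - op_mat w (S o\<^sub>L G o\<^sub>L S'))"
    using G S S' by (intro fr_det_trace_basis(1)[OF _ w]) auto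
  moreover have "fr_det G = Determinant.det (1\<^sub>m (length u) - op_mat u G)"
    by (rule fr_det_trace_basis(1)[OF G u]) auto
  ultimately show ?thesis by (simp add: w_def)
qed

lemma coord_span_take:
  assumes b: "is_basis b V" and x: "x \<in> complex_vector.span (set (take j b))" and i: "j \<le> i" "i < length b"
  shows "coord b i x = 0"
proof -
  have sV: "complex_vector.subspace V" by (rule is_basis_subspace[OF b])
  have "complex_vector.subspace {x \<in> V. coord b i x = 0}"
    using sV by (intro complex_vector.subspaceI)
      (auto simp: complex_vector.subspace_0 complex_vector.subspace_add complex_vector.subspace_scale coord_add[OF b] coord_scale[OF b])
  moreover have "set (take j b) \<subseteq> {x \<in> V. coord b i x = 0}"
  proof
    fix y assume "y \<in> set (take j b)"
    then obtain k where k: "k < j" "k < length b" "y = b ! k" by (auto simp: in_set_conv_nth)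
    then show "y \<in> {x \<in> V. coord b i x = 0}"
      using is_basis_mem[OF b k(2)] coord_basis[OF b i(2) k(2)] i by simp
  qed
  ultimately have "complex_vector.span (set (take j b)) \<subseteq> {x \<in> V. coord b i x = 0}"
    by (intro complex_vector.span_minimal)
  then show ?thesis using x by auto
qed

text \<open>In a triangular basis the determinant and the traces of powers are read off the diagonal. The list has one
  entry per dimension of \<open>V\<close>, which may be larger than the range of \<open>F\<close>; this length becomes the number of
  zeros of the perturbation determinant.\<close>

lemma fr_eigenvalue_list:
  assumes F: "F \<in> finite_rank_ops" and V: "complex_vector.subspace V" "fin_dim V" "range (blinfun_apply F) \<subseteq> V"
  shows "\<exists>\<nu>s. length \<nu>s = complex_vector.dim V \<and>
    (\<forall>\<nu>\<in>set \<nu>s. \<exists>x\<in>V. x \<noteq> 0 \<and> blinfun_apply F x = \<nu> *\<^sub>C x) \<and>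
    (\<forall>w. fr_det (w *\<^sub>C F) = (\<Prod>\<nu>\<leftarrow>\<nu>s. 1 - w * \<nu>)) \<and>
    (\<forall>k>0. fr_trace (op_power F k) = (\<Sum>\<nu>\<leftarrow>\<nu>s. \<nu> ^ k))"
proof -
  have Fb: "F \<in> bounded_ops" using F by simp
  have FV: "blinfun_apply F ` V \<subseteq> V" using V(3) by auto
  obtain b \<nu> where b: "is_basis b V" "length \<nu> = length b"
    and all: "\<forall>j<length b. blinfun_apply F (b ! j) - \<nu> ! j *\<^sub>C b ! j \<in> complex_vector.span (set (take j b)) \<and>
      (\<exists>x\<in>V. x \<noteq> 0 \<and> blinfun_apply F x = \<nu> ! j *\<^sub>C x)"
    using triangular_basis_ex[OF Fb V(1,2) FV] by (elim exE conjE) (rule that)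
  have tri: "blinfun_apply F (b ! j) - \<nu> ! j *\<^sub>C b ! j \<in> complex_vector.span (set (take j b))" if "j < length b" for j
    using all that by blast
  let ?U = "\<lambda>j. complex_vector.span (set (take j b))"
  have sub: "complex_vector.subspace (?U j)" for j by simp
  have UV: "?U j \<subseteq> V" for j
    using b(1) unfolding is_basis_def by (metis complex_vector.span_mono set_take_subset)
  have invU: "blinfun_apply F x \<in> ?U j" if "x \<in> ?U j" for x j
  proof -
    have "complex_vector.subspace {x. blinfun_apply F x \<in> ?U j}"
      by (intro complex_vector.subspaceI)
       (auto simp: op_apply bopsD[OF Fb] complex_vector.span_zero complex_vector.span_add complex_vector.span_scale)
    moreover have "set (take j b) \<subseteq> {x. blinfun_apply F x \<in> ?U j}"
    proof
      fix y assume "y \<in> set (take j b)"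
      then obtain k where k: "k < j" "k < length b" "y = b ! k" by (auto simp: in_set_conv_nth)
      have "blinfun_apply F (b ! k) - \<nu> ! k *\<^sub>C b ! k \<in> ?U j"
        using tri[OF k(2)] k complex_vector.span_mono[of "set (take k b)" "set (take j b)"]
        by (meson less_imp_le set_take_subset_set_take subsetD)
      moreover have "\<nu> ! k *\<^sub>C b ! k \<in> ?U j"
        using k \<open>y \<in> _\<close> by (intro complex_vector.span_scale complex_vector.span_base) simp
      ultimately show "y \<in> {x. blinfun_apply F x \<in> ?U j}"
        using complex_vector.span_add[of "blinfun_apply F (b ! k) - \<nu> ! k *\<^sub>C b ! k" _ "\<nu> ! k *\<^sub>C b ! k"] k(3) by simp
    qed
    ultimately have "?U j \<subseteq> {x. blinfun_apply F x \<in> ?U j}"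
      by (intro complex_vector.span_minimal)
    then show ?thesis using that by auto
  qed
  have pow: "blinfun_apply (op_power F k) (b ! j) - \<nu> ! j ^ k *\<^sub>C b ! j \<in> ?U j" if j: "j < length b" for j k
  proof (induction k)
    case 0
    then show ?case by (simp add: scaleC_one complex_vector.span_zero)
  next
    case (Suc k)
    have "blinfun_apply (op_power F (Suc k)) (b ! j) - \<nu> ! j ^ Suc k *\<^sub>C b ! j
      = blinfun_apply F (blinfun_apply (op_power F k) (b ! j) - \<nu> ! j ^ k *\<^sub>C b ! j)
        + \<nu> ! j ^ k *\<^sub>C (blinfun_apply F (b ! j) - \<nu> ! j *\<^sub>C b ! j)"
      by (simp add: op_apply bopsD[OF Fb] scaleC_simps mult.commute)
    then show ?case
      using invU[OF Suc] tri[OF j] by (auto intro!: complex_vector.span_add complex_vector.span_scale)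
  qed
  have coordpow: "coord b i (blinfun_apply (op_power F k) (b ! j)) = (if i = j then \<nu> ! j ^ k else 0)"
    if "j \<le> i" "i < length b" for i j k
  proof -
    have j: "j < length b" using that by simp
    have "blinfun_apply (op_power F k) (b ! j) = (blinfun_apply (op_power F k) (b ! j) - \<nu> ! j ^ k *\<^sub>C b ! j) + \<nu> ! j ^ k *\<^sub>C b ! j"
      by simp
    also have "coord b i \<dots> = 0 + \<nu> ! j ^ k * coord b i (b ! j)"
      using pow[OF j, of k] UV[of j] is_basis_mem[OF b(1) j] coord_span_take[OF b(1) pow[OF j] that] V(1)
      by (subst coord_add[OF b(1)]) (auto simp: coord_scale[OF b(1)] intro: complex_vector.subspace_scale)
    finally show ?thesis using coord_basis[OF b(1) that(2) j] by simp
  qed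
  have "fr_det (w *\<^sub>C F) = (\<Prod>\<nu>\<leftarrow>\<nu>. 1 - w * \<nu>)" for w
  proof -
    let ?A = "1\<^sub>m (length b) - op_mat b (w *\<^sub>C F)"
    have entry: "coord b i (blinfun_apply (w *\<^sub>C F) (b ! j)) = w * (if i = j then \<nu> ! j else 0)"
      if "j \<le> i" "i < length b" for i j
    proof -
      have "blinfun_apply F (b ! j) \<in> V" using V(3) by auto
      then show ?thesis using coordpow[OF that, of 1] by (simp add: op_apply coord_scale[OF b(1)])
    qed
    have A: "?A \<in> carrier_mat (length b) (length b)" by (auto intro: minus_carrier_mat)
    have "upper_triangular ?A"
      by (rule upper_triangularI) (auto simp: op_mat_def entry)
    then have "Determinant.det ?A = prod_list (diag_mat ?A)" using A by (rule det_upper_triangular)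
    also have "diag_mat ?A = map (\<lambda>\<nu>. 1 - w * \<nu>) \<nu>"
      by (rule nth_equalityI) (auto simp: diag_mat_def op_mat_def entry b(2))
    finally show ?thesis
      using F V(3) V(1) by (subst fr_det_trace_basis(1)[OF _ b(1)])
        (auto simp: op_apply intro!: complex_vector.subspace_scale)
  qed
  moreover have "fr_trace (op_power F k) = (\<Sum>\<nu>\<leftarrow>\<nu>. \<nu> ^ k)" if "k > 0" for k
  proof -
    have "range (blinfun_apply (op_power F k)) \<subseteq> V" using that V(3) by (cases k) auto
    then have "fr_trace (op_power F k) = (\<Sum>i<length b. coord b i (blinfun_apply (op_power F k) (b ! i)))"
      using F that by (intro fr_det_trace_basis(2)[OF _ b(1)]) auto
    also have "\<dots> = (\<Sum>i<length b. \<nu> ! i ^ k)" by (simp add: coordpow)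
    also have "\<dots> = (\<Sum>\<nu>\<leftarrow>\<nu>. \<nu> ^ k)" by (simp add: sum_list_sum_nth b(2) atLeast0LessThan)
    finally show ?thesis .
  qed
  moreover have "\<exists>x\<in>V. x \<noteq> 0 \<and> blinfun_apply F x = \<xi> *\<^sub>C x" if "\<xi> \<in> set \<nu>" for \<xi>
    using that all b(2) by (auto simp: in_set_conv_nth)
  ultimately show ?thesis using is_basis_length[OF b(1)] b(2) by (intro exI[of _ \<nu>]) auto
qed

section \<open>Dependence on parameters\<close>

lemma holomorphic_matrix_det:
  assumes "\<And>i j. i < n \<Longrightarrow> j < n \<Longrightarrow> (\<lambda>z. a z i j) holomorphic_on S"
  shows "(\<lambda>z. Determinant.det (mat n n (\<lambda>(i, j). a z i j))) holomorphic_on S"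
proof -
  have e: "Determinant.det (mat n n (\<lambda>(i, j). a z i j)) = (\<Sum>p\<in>{p. p permutes {0..<n}}. signof p * (\<Prod>i = 0..<n. a z i (p i)))" for z
    by (subst det_def'[of _ n]) (auto intro!: sum.cong prod.cong simp: permutes_in_image)
  show ?thesis unfolding e
    using assms by (intro holomorphic_intros) (auto simp: permutes_in_image)
qed

text \<open>A family of finite rank operators with ranges in one common space and holomorphic matrix entries:
  all its determinants and traces are then holomorphic.\<close>

locale holomorphic_family =
  fixes u :: "'a::complex_normed_vector list" and V and G :: "complex \<Rightarrow> 'a \<Rightarrow>\<^sub>L 'a" and S
  assumes u: "is_basis u V" and GF: "z \<in> S \<Longrightarrow> G z \<in> finite_rank_ops"
    and GV: "z \<in> S \<Longrightarrow> range (blinfun_apply (G z)) \<subseteq> V"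
    and hol: "i < length u \<Longrightarrow> j < length u \<Longrightarrow> (\<lambda>z. coord u i (blinfun_apply (G z) (u ! j))) holomorphic_on S"
begin

lemma holomorphic_det: "(\<lambda>z. fr_det (G z)) holomorphic_on S"
proof -
  have "(\<lambda>z. Determinant.det (mat (length u) (length u) (\<lambda>(i, j). (if i = j then 1 else 0) - coord u i (blinfun_apply (G z) (u ! j))))) holomorphic_on S"
    by (intro holomorphic_matrix_det holomorphic_intros hol)
  moreover have "fr_det (G z) = Determinant.det (mat (length u) (length u) (\<lambda>(i, j). (if i = j then 1 else 0) - coord u i (blinfun_apply (G z) (u ! j))))"
    if "z \<in> S" for z
    unfolding fr_det_trace_basis(1)[OF GF[OF that] u GV[OF that]]
    by (rule arg_cong[where f = Determinant.det]) (rule eq_matI, auto simp: op_mat_def)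
  ultimately show ?thesis by (simp cong: holomorphic_cong)
qed

lemma holomorphic_power_entries:
  assumes "i < length u" "j < length u"
  shows "(\<lambda>z. coord u i (blinfun_apply (op_power (G z) (Suc k)) (u ! j))) holomorphic_on S"
  using assms
proof (induction k arbitrary: i j)
  case 0
  then show ?case using hol by simp
next
  case (Suc k)
  have "coord u i (blinfun_apply (op_power (G z) (Suc (Suc k))) (u ! j))
    = (\<Sum>l<length u. coord u i (blinfun_apply (G z) (u ! l)) * coord u l (blinfun_apply (op_power (G z) (Suc k)) (u ! j)))"
    if "z \<in> S" for z
    using GV[OF that] GF[OF that] coord_apply_sum[OF u u, of "G z" "blinfun_apply (op_power (G z) (Suc k)) (u ! j)" i]
    by auto
  moreover have "(\<lambda>z. \<Sum>l<length u. coord u i (blinfun_apply (G z) (u ! l)) * coord u l (blinfun_apply (op_power (G z) (Suc k)) (u ! j))) holomorphic_on S"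
    using Suc by (intro holomorphic_intros hol) auto
  ultimately show ?case by (simp cong: holomorphic_cong)
qed

lemma holomorphic_trace_power: "0 < k \<Longrightarrow> (\<lambda>z. fr_trace (op_power (G z) k)) holomorphic_on S"
proof -
  assume "0 < k"
  then obtain l where k: "k = Suc l" by (cases k) auto
  have "fr_trace (op_power (G z) k) = (\<Sum>i<length u. coord u i (blinfun_apply (op_power (G z) (Suc l)) (u ! i)))" if "z \<in> S" for z
    unfolding k using GV[OF that] GF[OF that] by (intro fr_det_trace_basis(2)[OF _ u]) auto
  moreover have "(\<lambda>z. \<Sum>i<length u. coord u i (blinfun_apply (op_power (G z) (Suc l)) (u ! i))) holomorphic_on S"
    by (intro holomorphic_intros holomorphic_power_entries) auto
  ultimately show ?thesis by (simp cong: holomorphic_cong)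
qed

lemma holomorphic_det_reg: "(\<lambda>z. fr_det_reg p (G z)) holomorphic_on S"
  unfolding fr_det_reg_def
  by (intro holomorphic_intros holomorphic_det holomorphic_trace_power) auto

end

lemma affine_holomorphic_family:
  assumes F: "F \<in> finite_rank_ops" and G: "G \<in> finite_rank_ops"
  shows "\<exists>u V. holomorphic_family u V (\<lambda>z. F + z *\<^sub>C G) UNIV"
proof -
  obtain V u where u: "is_basis u V" "range (blinfun_apply F) \<subseteq> V" "range (blinfun_apply G) \<subseteq> V"
    using joint_basis_ex[OF F G] by blast
  have sV: "complex_vector.subspace V" by (rule is_basis_subspace[OF u(1)])
  have mem: "blinfun_apply F x \<in> V" "blinfun_apply G x \<in> V" for x using u by auto
  have "holomorphic_family u V (\<lambda>z. F + z *\<^sub>C G) UNIV"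
  proof
    show "(\<lambda>z. coord u i (blinfun_apply (F + z *\<^sub>C G) (u ! j))) holomorphic_on UNIV" for i j
      using mem sV by (simp add: op_apply coord_add[OF u(1)] coord_scale[OF u(1)] complex_vector.subspace_scale)
        (intro holomorphic_intros)
  qed (use u F G mem sV in \<open>auto simp: op_apply intro!: complex_vector.subspace_add complex_vector.subspace_scale\<close>)
  then show ?thesis by blast
qed

text \<open>In a basis that begins with a basis of the range of \<open>G\<close>, only the first rows of the matrix depend on \<open>z\<close>.
  The degree bound is independent of \<open>W\<close>.\<close>

lemma fr_det_polynomial:
  assumes W: "W \<in> finite_rank_ops" and G: "G \<in> finite_rank_ops"
  shows "\<exists>q. degree q \<le> complex_vector.dim (range (blinfun_apply G)) \<and> (\<forall>z. fr_det (W + z *\<^sub>C G) = poly q z)"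
proof -
  obtain g where g: "is_basis g (range (blinfun_apply G))"
    using range_basis_is_basis[OF G] by blast
  obtain V u where u: "is_basis u V" "range (blinfun_apply W) \<subseteq> V" "range (blinfun_apply G) \<subseteq> V"
    using joint_basis_ex[OF W G] by blast
  have sV: "complex_vector.subspace V" by (rule is_basis_subspace[OF u(1)])
  obtain c where v: "is_basis (g @ c) V" using basis_extend[OF g u(3) sV is_basis_fin_dim[OF u(1)]] by blast
  let ?v = "g @ c" let ?n = "length ?v"
  have mem: "blinfun_apply W x \<in> V" "blinfun_apply G x \<in> V" for x using u by auto
  have Gz: "coord ?v i (blinfun_apply G x) = 0" if "length g \<le> i" "i < ?n" for i x
  proof (rule coord_span_take[OF v _ that])
    have "complex_vector.span (set g) = range (blinfun_apply G)" using g by (simp add: is_basis_def)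
    then show "blinfun_apply G x \<in> complex_vector.span (set (take (length g) (g @ c)))" by auto
  qed
  define e where "e i j = [: (if i = j then 1 else 0) - coord ?v i (blinfun_apply W (?v ! j)),
    - coord ?v i (blinfun_apply G (?v ! j)) :]" for i j
  define q where "q = (\<Sum>p\<in>{p. p permutes {0..<?n}}. [:signof p:] * (\<Prod>i = 0..<?n. e i (p i)))"
  have de: "degree (e i j) \<le> (if i < length g then 1 else 0)" if "i < ?n" for i j
    using Gz[of i] that by (auto simp: e_def)
  have "degree q \<le> length g"
    unfolding q_def
  proof (rule degree_sum_le)
    fix p assume "p \<in> {p. p permutes {0..<?n}}"
    have "degree ([:signof p:] * (\<Prod>i = 0..<?n. e i (p i))) \<le> degree (\<Prod>i = 0..<?n. e i (p i))"
      by (rule order_trans[OF degree_mult_le]) simp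
    also have "\<dots> \<le> (\<Sum>i = 0..<?n. degree (e i (p i)))" using degree_prod_sum_le[of "{0..<?n}" "\<lambda>i. e i (p i)"] by (simp add: comp_def)
    also have "\<dots> \<le> (\<Sum>i = 0..<?n. if i < length g then 1 else 0)"
      by (intro sum_mono de) auto
    also have "\<dots> = card ({0..<?n} \<inter> {i. i < length g})" by (simp add: sum.If_cases)
    also have "\<dots> \<le> card {0..<length g}" by (intro card_mono) auto
    finally show "degree ([:signof p:] * (\<Prod>i = 0..<?n. e i (p i))) \<le> length g" by simp
  qed (simp add: finite_permutations)
  moreover have "fr_det (W + z *\<^sub>C G) = poly q z" for z
  proof -
    have F: "W + z *\<^sub>C G \<in> finite_rank_ops" "range (blinfun_apply (W + z *\<^sub>C G)) \<subseteq> V"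
      using W G mem sV by (auto simp: op_apply intro!: complex_vector.subspace_add complex_vector.subspace_scale)
    have "fr_det (W + z *\<^sub>C G) = Determinant.det (mat ?n ?n (\<lambda>(i, j). poly (e i j) z))"
      unfolding fr_det_trace_basis(1)[OF F(1) v F(2)]
      by (rule arg_cong[where f = Determinant.det], rule eq_matI)
        (use mem sV in \<open>auto simp: op_mat_def op_apply e_def coord_add[OF v] coord_scale[OF v] complex_vector.subspace_scale\<close>)
    also have "\<dots> = (\<Sum>p\<in>{p. p permutes {0..<?n}}. signof p * (\<Prod>i = 0..<?n. poly (e i (p i)) z))"
      by (subst det_def'[of _ ?n]) (auto intro!: sum.cong prod.cong simp: permutes_in_image)
    also have "\<dots> = poly q z" by (simp add: q_def poly_sum poly_prod)
    finally show ?thesis .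
  qed
  ultimately show ?thesis using is_basis_length[OF g] by metis
qed

lemma op_power_direct_sum:
  assumes "F \<in> bounded_ops" "G \<in> bounded_ops" "F o\<^sub>L G = 0" "G o\<^sub>L F = 0" "0 < k"
  shows "op_power (F + G) k = op_power F k + op_power G k"
proof -
  have z: "blinfun_apply F (blinfun_apply G x) = 0" "blinfun_apply G (blinfun_apply F x) = 0" for x
    using assms(3,4) by (metis blinfun_apply_blinfun_compose blinfun.zero_left)+
  have "op_power (F + G) (Suc l) = op_power F (Suc l) + op_power G (Suc l)" for l
  proof (induction l)
    case 0
    show ?case by (rule blinfun_eqI) (simp add: op_apply)
  next
    case (Suc l)
    show ?case
      by (subst op_power_Suc, subst Suc, rule blinfun_eqI) (simp add: op_apply z)
  qed
  then show ?thesis using assms(5) by (cases k) auto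
qed

lemma fr_det_reg_direct_sum:
  assumes F: "F \<in> finite_rank_ops" and G: "G \<in> finite_rank_ops" and "F o\<^sub>L G = 0" "G o\<^sub>L F = 0"
  shows "fr_det_reg p (F + G) = fr_det_reg p F * fr_det_reg p G"
proof -
  have "fr_det (F + G) = fr_det F * fr_det G" using fr_det_mult[OF F G] assms(3) by simp
  moreover have "(\<Sum>k = 1..<nat \<lceil>p\<rceil>. 1 / of_nat k * fr_trace (op_power (F + G) k))
      = (\<Sum>k = 1..<nat \<lceil>p\<rceil>. 1 / of_nat k * fr_trace (op_power F k))
      + (\<Sum>k = 1..<nat \<lceil>p\<rceil>. 1 / of_nat k * fr_trace (op_power G k))"
    unfolding sum.distrib[symmetric] using assms
    by (intro sum.cong refl) (simp add: op_power_direct_sum fr_trace_add distrib_left)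
  ultimately show ?thesis by (simp add: fr_det_reg_def exp_add)
qed

section \<open>Invertibility of finite rank perturbations of the identity\<close>

text \<open>\<open>I - F\<close> maps the range of \<open>F\<close> injectively into itself, hence onto. If \<open>G\<close> is the inverse of this restriction,
  then \<open>x \<mapsto> x + G (F x)\<close> inverts \<open>I - F\<close>.\<close>

lemma finite_rank_fredholm:
  assumes F: "F \<in> finite_rank_ops" and inj: "\<And>x. blinfun_apply F x = x \<Longrightarrow> x = 0"
  shows "id_blinfun - F \<in> invertibles"
proof -
  have Fb: "F \<in> bounded_ops" using F by simp
  let ?V = "range (blinfun_apply F)"
  obtain b where b: "is_basis b ?V" using range_basis_is_basis[OF F] by blast
  have sV: "complex_vector.subspace ?V" by (rule is_basis_subspace[OF b])
  let ?D = "id_blinfun - F"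
  have Db: "?D \<in> bounded_ops" using Fb by simp
  interpret Dl: Vector_Spaces.linear "(*\<^sub>C)" "(*\<^sub>C)" "blinfun_apply ?D" by (rule op_linear[OF Db])
  have injD: "inj (blinfun_apply ?D)"
  proof (rule injI)
    fix x y assume "blinfun_apply ?D x = blinfun_apply ?D y"
    then have "blinfun_apply F (x - y) = x - y" by (simp add: op_apply algebra_simps)
    then show "x = y" using inj by fastforce
  qed
  define c where "c = map (blinfun_apply ?D) b"
  have DV: "blinfun_apply ?D x \<in> ?V" if "x \<in> ?V" for x
    using that sV by (auto simp: op_apply intro!: complex_vector.subspace_diff)
  have c: "is_basis c (blinfun_apply ?D ` ?V)"
    using b unfolding is_basis_def c_def
    by (auto simp: distinct_map Dl.span_image inj_on_subset[OF injD] intro!: Dl.independent_inj_image[OF _ injD])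
  have "blinfun_apply ?D ` ?V \<subseteq> ?V" using DV by blast
  then obtain d where d: "is_basis (c @ d) ?V"
    using basis_extend[OF c _ sV is_basis_fin_dim[OF b]] by blast
  then have "length (c @ d) = length b" using is_basis_length[OF b] is_basis_length[OF d] by simp
  then have "d = []" by (simp add: c_def)
  then have cV: "is_basis c ?V" using d by simp
  obtain K where K: "K \<ge> 0" "\<And>x i. x \<in> ?V \<Longrightarrow> i < length c \<Longrightarrow> cmod (coord c i x) \<le> K * norm x"
    using coord_bounded[OF cV] by blast
  define S where "S x = x + (\<Sum>i<length c. coord c i (blinfun_apply F x) *\<^sub>C b ! i)" for x
  have DS: "blinfun_apply ?D (S x) = x" for x
  proof -
    have "blinfun_apply ?D (\<Sum>i<length c. coord c i (blinfun_apply F x) *\<^sub>C b ! i)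
        = (\<Sum>i<length c. coord c i (blinfun_apply F x) *\<^sub>C c ! i)"
      by (simp add: blinfun.sum_right bopsD[OF Db] c_def)
    also have "\<dots> = blinfun_apply F x" by (rule coord_sum[OF cV]) auto
    finally show ?thesis by (simp add: S_def blinfun.add_right) (simp add: op_apply)
  qed
  have bS: "bounded_linear S"
  proof (rule bounded_linear_intro[where K = "1 + (\<Sum>i<length c. K * norm F * norm (b ! i))"])
    show "S (x + y) = S x + S y" for x y
      by (simp add: S_def blinfun.add_right coord_add[OF cV] scaleC_add_left sum.distrib)
    show "S (r *\<^sub>R x) = r *\<^sub>R S x" for r x
      by (simp add: S_def scaleC_of_real[symmetric] bopsD[OF Fb] coord_scale[OF cV] scaleC_add_right scaleC_sum_right scaleC_scaleC)
    fix x
    have "norm (S x) \<le> norm x + (\<Sum>i<length c. (K * norm F * norm (b ! i)) * norm x)"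
      unfolding S_def
    proof (rule order_trans[OF norm_triangle_ineq], rule add_left_mono, rule sum_norm_le)
      fix i assume "i \<in> {..<length c}"
      then have "cmod (coord c i (blinfun_apply F x)) \<le> K * (norm F * norm x)"
        using K(2)[of "blinfun_apply F x" i] mult_left_mono[OF norm_blinfun[of F x] K(1)] by (auto intro: order_trans)
      then show "norm (coord c i (blinfun_apply F x) *\<^sub>C b ! i) \<le> (K * norm F * norm (b ! i)) * norm x"
        using mult_right_mono[of _ _ "norm (b ! i)"] by (fastforce simp: norm_scaleC mult_ac)
    qed
    then show "norm (S x) \<le> norm x * (1 + (\<Sum>i<length c. K * norm F * norm (b ! i)))"
      by (simp add: algebra_simps sum_distrib_left)
  qed
  define SS where "SS = Blinfun S"
  have app: "blinfun_apply SS = S" using bS by (simp add: SS_def bounded_linear_Blinfun_apply)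
  have "inverse_op ?D SS"
  proof (rule inverse_opI)
    show "SS \<in> bounded_ops"
      by (rule bopsI) (simp add: app S_def bopsD[OF Fb] coord_scale[OF cV] scaleC_add_right scaleC_sum_right scaleC_scaleC)
    show 1: "blinfun_apply ?D (blinfun_apply SS x) = x" for x by (simp add: app DS)
    show "blinfun_apply SS (blinfun_apply ?D x) = x" for x using injD 1 by (meson injD inj_def)
  qed
  then show ?thesis using Db by (auto simp: invertibles_def)
qed

lemma fr_det_eigenvalue_one:
  assumes F: "F \<in> finite_rank_ops" and x: "x \<noteq> 0" "blinfun_apply F x = x"
  shows "fr_det F = 0"
proof -
  have Fb: "F \<in> bounded_ops" using F by simp
  let ?V = "range (blinfun_apply F)"
  have "is_basis [x] (complex_vector.span {x})"
    using x(1) by (simp add: is_basis_def complex_vector.dependent_single)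
  moreover have "complex_vector.span {x} \<subseteq> ?V"
    using range_op_subspace[OF Fb] x(2) by (intro complex_vector.span_minimal) (auto, metis rangeI)
  ultimately obtain c where b: "is_basis ([x] @ c) ?V"
    using basis_extend range_op_subspace[OF Fb] F by (metis finite_rank_iff)
  let ?n = "length ([x] @ c)"
  let ?A = "1\<^sub>m ?n - op_mat ([x] @ c) F"
  have A: "?A \<in> carrier_mat ?n ?n" by (auto intro: minus_carrier_mat)
  have cx: "coord ([x] @ c) i x = (if i = 0 then 1 else 0)" if "i < ?n" for i
    using coord_basis[OF b that, of 0] by simp
  have "?A *\<^sub>v unit_vec ?n 0 = 0\<^sub>v ?n"
  proof (rule eq_vecI)
    fix i assume "i < dim_vec (0\<^sub>v ?n)"
    then have i: "i < ?n" by simp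
    have "vec_index (?A *\<^sub>v unit_vec ?n 0) i = ?A $$ (i, 0)"
      using i A by (simp add: mult_mat_vec_def scalar_prod_right_unit)
    also have "\<dots> = 0" using i cx[OF i] x(2) by (simp add: op_mat_def)
    finally show "vec_index (?A *\<^sub>v unit_vec ?n 0) i = vec_index (0\<^sub>v ?n) i" using i by simp
  qed (use A in auto)
  moreover have "unit_vec ?n 0 \<noteq> 0\<^sub>v ?n" "unit_vec ?n 0 \<in> carrier_vec ?n" by (auto simp: unit_vec_nonzero)
  ultimately have "Determinant.det ?A = 0" using det_0_iff_vec_prod_zero[OF A] by blast
  then show ?thesis using fr_det_trace_basis(1)[OF F b] by simp
qed

section \<open>Riesz integrals\<close>

definition circ :: "real \<Rightarrow> real \<Rightarrow> complex"
  where "circ r t = of_real r * exp (2 * of_real pi * \<i> * of_real t)"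

lemma circ_nz [simp]: "r \<noteq> 0 \<Longrightarrow> circ r t \<noteq> 0"
  by (simp add: circ_def)

lemma norm_circ [simp]: "0 < r \<Longrightarrow> cmod (circ r t) = r"
  by (simp add: circ_def norm_mult)

lemma continuous_on_circ [continuous_intros]: "continuous_on S (circ r)"
  unfolding circ_def[abs_def] by (intro continuous_intros)

lemma circlepath_circ: "circlepath \<mu> r t = \<mu> + circ r t"
  by (simp add: circlepath circ_def)

text \<open>Orthogonality of the exponentials; the identity operator contributes to the recursion for the moments
  only through \<open>j = 0\<close>.\<close>

lemma integral_circ_powi:
  assumes "0 < r"
  shows "integral {0..1} (\<lambda>t. circ r t powi j) = (if j = 0 then 1 else 0)"
proof (cases "j = 0")
  case False
  define c where "c = 2 * of_real pi * \<i> * of_int j"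
  have c0: "c \<noteq> 0" using False by (simp add: c_def)
  define g where "g t = of_real r powi j * exp (c * of_real t) / c" for t :: real
  have e: "circ r t powi j = of_real r powi j * exp (c * of_real t)" for t
    by (simp add: circ_def power_int_mult_distrib exp_power_int c_def mult_ac)
  have "((\<lambda>t. circ r t powi j) has_integral (g 1 - g 0)) {0..1}"
  proof (rule fundamental_theorem_of_calculus)
    fix t :: real
    have "((\<lambda>z. of_real r powi j * exp (c * z) / c) has_field_derivative of_real r powi j * exp (c * of_real t)) (at (of_real t))"
      using c0 by (auto intro!: derivative_eq_intros)
    from has_vector_derivative_real_field[OF this]
    show "(g has_vector_derivative circ r t powi j) (at t within {0..1})"
      unfolding g_def[abs_def] e by (rule has_vector_derivative_at_within)
  qed simp
  moreover have "exp c = 1" unfolding c_def exp_eq_1 by auto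
  then have "g 1 = g 0" by (simp add: g_def)
  ultimately show ?thesis using False by (simp add: integral_unique)
qed simp

lemma resolvent_commute:
  assumes T: "T \<in> bounded_ops" "\<mu> \<notin> op_spectrum T" and B: "B \<in> bounded_ops"
    and comm: "\<And>x. blinfun_apply B (blinfun_apply T x) = blinfun_apply T (blinfun_apply B x)"
  shows "blinfun_apply B (blinfun_apply (resolvent_op T \<mu>) x) = blinfun_apply (resolvent_op T \<mu>) (blinfun_apply B x)"
proof -
  let ?R = "blinfun_apply (resolvent_op T \<mu>)"
  have R: "resolvent_op T \<mu> \<in> bounded_ops" by (rule resolvent_bops[OF T])
  let ?y = "blinfun_apply B (?R x)"
  have "blinfun_apply B x = \<mu> *\<^sub>C ?y - blinfun_apply T ?y"
    using arg_cong[OF resolvent_apply(1)[OF T, of x], of "blinfun_apply B"]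
    by (simp add: comm blinfun.diff_right bopsD[OF B] algebra_simps)
  then have "?R (blinfun_apply B x) = \<mu> *\<^sub>C ?R ?y - ?R (blinfun_apply T ?y)"
    by (simp add: blinfun.diff_right bopsD[OF R])
  also have "\<dots> = ?y" by (simp add: resolvent_apply(2)[OF T])
  finally show ?thesis ..
qed

lemma eigenvalue_in_spectrum:
  assumes "T \<in> bounded_ops" "blinfun_apply T x = \<nu> *\<^sub>C x" "x \<noteq> 0"
  shows "\<nu> \<in> op_spectrum T"
proof (rule ccontr)
  assume "\<not> ?thesis"
  then have i: "\<nu> *\<^sub>C id_blinfun - T \<in> invertibles" using spectrum_iff_invertibles assms by blast
  have "blinfun_apply (\<nu> *\<^sub>C id_blinfun - T) x = 0" using assms by (simp add: op_apply)
  then show False using inv_op_apply(2)[OF i, of x] assms(3) by (simp add: blinfun.zero_right)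
qed

text \<open>The moments of the resolvent along a circle, that is, its Laurent coefficients at \<open>\<mu>\<close> up to the numbering;
  \<open>j = 1\<close> gives the Riesz projection.\<close>

definition riesz_int :: "('a::complex_banach \<Rightarrow>\<^sub>L 'a) \<Rightarrow> complex \<Rightarrow> real \<Rightarrow> int \<Rightarrow> 'a \<Rightarrow>\<^sub>L 'a"
  where "riesz_int T \<mu> r j = integral {0..1} (\<lambda>t. circ r t powi j *\<^sub>C resolvent_op T (\<mu> + circ r t))"

locale riesz_circle =
  fixes T :: "'a::complex_banach \<Rightarrow>\<^sub>L 'a" and \<mu> :: complex and r :: real
  assumes T: "T \<in> bounded_ops" and r: "0 < r" and disc: "cball \<mu> r \<inter> op_spectrum T \<subseteq> {\<mu>}"
begin

lemma circle_resolvent: "\<mu> + circ r t \<notin> op_spectrum T"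
proof
  assume "\<mu> + circ r t \<in> op_spectrum T"
  moreover have "\<mu> + circ r t \<in> cball \<mu> r" using r by (simp add: dist_norm)
  ultimately have "\<mu> + circ r t = \<mu>" using disc by blast
  then show False using r by simp
qed

lemma continuous_integrand:
  "continuous_on {0..1} (\<lambda>t. circ r t powi j *\<^sub>C resolvent_op T (\<mu> + circ r t))"
proof (intro continuous_intros)
  show "continuous_on {0..1} (\<lambda>t. resolvent_op T (\<mu> + circ r t))"
    by (rule continuous_on_compose2[OF continuous_on_resolvent[OF T]])
      (auto intro!: continuous_intros simp: circle_resolvent)
qed (use r in auto)

lemma riesz_int_apply:
  "((\<lambda>t. circ r t powi j *\<^sub>C blinfun_apply (resolvent_op T (\<mu> + circ r t)) x) has_integral
    blinfun_apply (riesz_int T \<mu> r j) x) {0..1}"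
proof -
  have "((\<lambda>t. circ r t powi j *\<^sub>C resolvent_op T (\<mu> + circ r t)) has_integral riesz_int T \<mu> r j) {0..1}"
    unfolding riesz_int_def by (intro integrable_integral integrable_continuous_real continuous_integrand)
  from has_integral_linear[OF this, of "\<lambda>B. blinfun_apply B x"]
  show ?thesis by (simp add: comp_def scaleC_blinfun.rep_eq)
qed

lemma riesz_int_bops: "riesz_int T \<mu> r j \<in> bounded_ops"
proof (rule bopsI)
  fix c x
  have "((\<lambda>t. c *\<^sub>C (circ r t powi j *\<^sub>C blinfun_apply (resolvent_op T (\<mu> + circ r t)) x)) has_integral
    c *\<^sub>C blinfun_apply (riesz_int T \<mu> r j) x) {0..1}"
    using has_integral_linear[OF riesz_int_apply bounded_linear_scaleC] by (simp add: comp_def)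
  moreover have "((\<lambda>t. c *\<^sub>C (circ r t powi j *\<^sub>C blinfun_apply (resolvent_op T (\<mu> + circ r t)) x)) has_integral
    blinfun_apply (riesz_int T \<mu> r j) (c *\<^sub>C x)) {0..1}"
    using riesz_int_apply[of j "c *\<^sub>C x"]
    by (simp add: bopsD[OF resolvent_bops[OF T circle_resolvent]] scaleC_scaleC mult.commute)
  ultimately show "blinfun_apply (riesz_int T \<mu> r j) (c *\<^sub>C x) = c *\<^sub>C blinfun_apply (riesz_int T \<mu> r j) x"
    using has_integral_unique by blast
qed

lemma riesz_int_commute:
  assumes B: "B \<in> bounded_ops"
    and comm: "\<And>x. blinfun_apply B (blinfun_apply T x) = blinfun_apply T (blinfun_apply B x)"
  shows "blinfun_apply B (blinfun_apply (riesz_int T \<mu> r j) x) = blinfun_apply (riesz_int T \<mu> r j) (blinfun_apply B x)"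
proof -
  have "((\<lambda>t. circ r t powi j *\<^sub>C blinfun_apply (resolvent_op T (\<mu> + circ r t)) (blinfun_apply B x)) has_integral
    blinfun_apply B (blinfun_apply (riesz_int T \<mu> r j) x)) {0..1}"
    using has_integral_linear[OF riesz_int_apply blinfun.bounded_linear_right[of B]]
    by (simp add: comp_def bopsD[OF B] resolvent_commute[OF T circle_resolvent B comm])
  then show ?thesis using riesz_int_apply has_integral_unique by blast
qed

text \<open>Integrate \<open>(T - \<mu>) R(\<mu> + w) = w R(\<mu> + w) - I\<close>: applying \<open>T - \<mu>\<close> raises the index of a moment by one, up to
  the identity that appears at \<open>j = 0\<close>.\<close>

lemma riesz_int_shift:
  "blinfun_apply (T - \<mu> *\<^sub>C id_blinfun) (blinfun_apply (riesz_int T \<mu> r j) x) =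
    blinfun_apply (riesz_int T \<mu> r (j + 1)) x - (if j = 0 then x else 0)"
proof -
  let ?N = "T - \<mu> *\<^sub>C id_blinfun"
  let ?R = "\<lambda>t. blinfun_apply (resolvent_op T (\<mu> + circ r t)) x"
  have N: "?N \<in> bounded_ops" using T by simp
  have NR: "blinfun_apply ?N (circ r t powi j *\<^sub>C ?R t) = circ r t powi (j + 1) *\<^sub>C ?R t - circ r t powi j *\<^sub>C x" for t
  proof -
    have "blinfun_apply ?N (?R t) = circ r t *\<^sub>C ?R t - x"
      using resolvent_apply(1)[OF T circle_resolvent] by (simp add: op_apply scaleC_add_left)
    then show ?thesis using r
      by (simp add: bopsD[OF N] scaleC_diff_right scaleC_scaleC power_int_add_1)
  qed
  have "((\<lambda>t. circ r t powi (j + 1) *\<^sub>C ?R t - circ r t powi j *\<^sub>C x) has_integral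
    blinfun_apply ?N (blinfun_apply (riesz_int T \<mu> r j) x)) {0..1}"
    using has_integral_linear[OF riesz_int_apply[of j x] blinfun.bounded_linear_right[of ?N]]
    by (simp only: comp_def NR)
  moreover have "((\<lambda>t. circ r t powi (j + 1) *\<^sub>C ?R t - circ r t powi j *\<^sub>C x) has_integral
    blinfun_apply (riesz_int T \<mu> r (j + 1)) x - (if j = 0 then 1 else 0) *\<^sub>C x) {0..1}"
  proof (intro has_integral_diff riesz_int_apply)
    have "((\<lambda>t. circ r t powi j) has_integral (if j = 0 then 1 else 0)) {0..1}"
      unfolding integral_circ_powi[OF r, symmetric]
      using r by (intro integrable_integral integrable_continuous_real continuous_intros) auto
    from has_integral_linear[OF this bounded_bilinear.bounded_linear_left[OF bounded_bilinear_scaleC]]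
    show "((\<lambda>t. circ r t powi j *\<^sub>C x) has_integral (if j = 0 then 1 else 0) *\<^sub>C x) {0..1}"
      by (simp only: comp_def)
  qed
  ultimately have "blinfun_apply ?N (blinfun_apply (riesz_int T \<mu> r j) x) =
    blinfun_apply (riesz_int T \<mu> r (j + 1)) x - (if j = 0 then 1 else 0) *\<^sub>C x"
    by (rule has_integral_unique)
  then show ?thesis by (cases "j = 0") (simp_all add: scaleC_one)
qed

lemma riesz_int_norm: "\<exists>C\<ge>0. \<forall>j. norm (riesz_int T \<mu> r j) \<le> r powi j * C"
proof -
  have "compact ((\<lambda>t. norm (circ r t powi 0 *\<^sub>C resolvent_op T (\<mu> + circ r t))) ` {0..1})"
    by (intro compact_continuous_image continuous_intros continuous_integrand) auto
  then obtain C where "\<forall>t\<in>{0..1}. norm (resolvent_op T (\<mu> + circ r t)) \<le> C"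
    by (auto dest!: compact_imp_bounded simp: bounded_iff scaleC_one)
  then have C: "\<And>t. t \<in> {0..1} \<Longrightarrow> norm (resolvent_op T (\<mu> + circ r t)) \<le> C" by blast
  have C0: "0 \<le> C" using C[of 0] norm_ge_zero order_trans by (metis atLeastAtMost_iff order_refl zero_le_one)
  have "norm (riesz_int T \<mu> r j) \<le> (r powi j * C) * (1 - 0)" for j
    unfolding riesz_int_def
    by (rule integral_bound[OF _ continuous_integrand])
      (use C r in \<open>auto simp: norm_scaleC norm_power_int intro!: mult_left_mono\<close>)
  then show ?thesis using C0 by auto
qed

lemma riesz_int_power:
  "blinfun_apply (op_power (T - \<mu> *\<^sub>C id_blinfun) k) (blinfun_apply (riesz_int T \<mu> r 1) x) = blinfun_apply (riesz_int T \<mu> r (int k + 1)) x"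
proof (induction k)
  case (Suc k)
  then show ?case
    using riesz_int_shift[of "int k + 1" x] by (simp add: algebra_simps)
qed simp

lemma riesz_int_power_neg:
  "blinfun_apply (op_power (T - \<mu> *\<^sub>C id_blinfun) (Suc n)) (blinfun_apply (riesz_int T \<mu> r (- int n)) x) = blinfun_apply (riesz_int T \<mu> r 1) x - x"
proof (induction n)
  case 0
  then show ?case using riesz_int_shift[of 0 x] by simp
next
  case (Suc n)
  have "blinfun_apply (op_power (T - \<mu> *\<^sub>C id_blinfun) (Suc (Suc n))) (blinfun_apply (riesz_int T \<mu> r (- int (Suc n))) x)
    = blinfun_apply (op_power (T - \<mu> *\<^sub>C id_blinfun) (Suc n)) (blinfun_apply (T - \<mu> *\<^sub>C id_blinfun) (blinfun_apply (riesz_int T \<mu> r (- int (Suc n))) x))"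
    by (simp only: op_power_apply funpow_Suc_right comp_def)
  also have "blinfun_apply (T - \<mu> *\<^sub>C id_blinfun) (blinfun_apply (riesz_int T \<mu> r (- int (Suc n))) x) = blinfun_apply (riesz_int T \<mu> r (- int n)) x"
    using riesz_int_shift[of "- int (Suc n)" x] by simp
  finally show ?case using Suc by simp
qed

text \<open>Let \<open>P\<close> be the moment with \<open>j = 1\<close>. The norm of \<open>(T - \<mu>)\<^sup>k P\<close> is at most \<open>C r\<^sup>k\<^sup>+\<^sup>1\<close>, so an eigenvalue of \<open>T\<close> on the range
  of \<open>P\<close> lies in the closed disc and must be \<open>\<mu>\<close>; in finite dimension \<open>T - \<mu>\<close> is then nilpotent there.
  Conversely, \<open>P - I = (T - \<mu>) Q\<close> with \<open>Q\<close> the moment \<open>j = 0\<close>, so modulo the range of \<open>P\<close> every vector is in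
  the image of \<open>T - \<mu>\<close>, and a vector killed by a power of \<open>T - \<mu>\<close> is reached after finitely many steps.\<close>

lemma riesz_int_range_gen_eigenspace:
  assumes fin: "fin_dim (range (blinfun_apply (riesz_int T \<mu> r 1)))"
  shows "range (blinfun_apply (riesz_int T \<mu> r 1)) = gen_eigenspace T \<mu>"
proof
  let ?P = "blinfun_apply (riesz_int T \<mu> r 1)" and ?N = "T - \<mu> *\<^sub>C id_blinfun"
  have sub: "complex_vector.subspace (range ?P)" by (rule range_op_subspace[OF riesz_int_bops])
  have inv: "blinfun_apply T ` range ?P \<subseteq> range ?P"
    using riesz_int_commute[OF T] by (auto simp: image_iff)
  have "\<nu> = \<mu>" if x: "x \<in> range ?P" "x \<noteq> 0" "blinfun_apply T x = \<nu> *\<^sub>C x" for \<nu> x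
  proof -
    obtain y where y: "x = ?P y" using x by blast
    obtain C where C: "C \<ge> 0" "\<And>j. norm (riesz_int T \<mu> r j) \<le> r powi j * C" using riesz_int_norm by blast
    have le: "cmod (\<nu> - \<mu>) ^ k * norm x \<le> r ^ k * (r * C * norm y)" for k
    proof -
      have "(\<nu> - \<mu>) ^ k *\<^sub>C x = blinfun_apply (riesz_int T \<mu> r (int k + 1)) y"
        using eigenvector_shift_power[OF T x(3), of \<mu> k] riesz_int_power[of k y] by (simp add: y)
      then have "cmod (\<nu> - \<mu>) ^ k * norm x = norm (blinfun_apply (riesz_int T \<mu> r (int k + 1)) y)"
        by (metis norm_scaleC norm_power)
      also have "\<dots> \<le> (r powi (int k + 1) * C) * norm y"
        by (rule order_trans[OF norm_blinfun mult_right_mono[OF C(2)]]) simp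
      also have "\<dots> = r ^ k * (r * C * norm y)"
        using r by (simp add: power_int_add_1 mult_ac)
      finally show ?thesis .
    qed
    have "cmod (\<nu> - \<mu>) \<le> r"
    proof (rule ccontr)
      assume "\<not> ?thesis"
      then have q: "1 < cmod (\<nu> - \<mu>) / r" using r by simp
      obtain k where k: "r * C * norm y / norm x < (cmod (\<nu> - \<mu>) / r) ^ k"
        using real_arch_pow[OF q] by blast
      have "r * C * norm y < (cmod (\<nu> - \<mu>) / r) ^ k * norm x"
        using k x(2) by (simp add: divide_less_eq)
      then have "r ^ k * (r * C * norm y) < r ^ k * ((cmod (\<nu> - \<mu>) / r) ^ k * norm x)"
        using r by (intro mult_strict_left_mono) auto
      also have "\<dots> = cmod (\<nu> - \<mu>) ^ k * norm x" using r by (simp add: power_divide)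
      finally show False using le[of k] by simp
    qed
    then have "\<nu> \<in> cball \<mu> r \<inter> op_spectrum T"
      using eigenvalue_in_spectrum[OF T x(3,2)] by (simp add: dist_norm norm_minus_commute)
    then show ?thesis using disc by blast
  qed
  then obtain k where "\<And>x. x \<in> range ?P \<Longrightarrow> blinfun_apply (op_power ?N k) x = 0"
    using nilpotent_if_single_eigenvalue[OF T sub fin inv] by metis
  then show "range ?P \<subseteq> gen_eigenspace T \<mu>" by (auto simp: gen_eigenspace_def)
  have "x \<in> range ?P" if "blinfun_apply (op_power ?N k) x = 0" for x k
    using that
  proof (induction k arbitrary: x)
    case 0
    then show ?case using complex_vector.subspace_0[OF sub] by simp
  next
    case (Suc k)
    let ?Q = "blinfun_apply (riesz_int T \<mu> r 0)"
    have N: "?N \<in> bounded_ops" using T by simp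
    have comm: "blinfun_apply (op_power ?N l) (?Q y) = ?Q (blinfun_apply (op_power ?N l) y)" for l y
      by (rule riesz_int_commute[OF bops_power[OF N]])
        (rule op_power_commute[symmetric], simp add: op_apply bopsD[OF T])
    have "blinfun_apply (op_power ?N k) (?P x - x) = blinfun_apply (op_power ?N k) (blinfun_apply ?N (?Q x))"
      using riesz_int_shift[of 0 x] by simp
    also have "\<dots> = blinfun_apply (op_power ?N (Suc k)) (?Q x)"
      by (simp only: op_power_apply funpow_Suc_right comp_def)
    also have "\<dots> = 0" using comm[of "Suc k" x] Suc.prems by (simp only: blinfun.zero_right)
    finally have "?P x - x \<in> range ?P" by (rule Suc.IH)
    then have "?P x - (?P x - x) \<in> range ?P"
      by (rule complex_vector.subspace_diff[OF sub rangeI])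
    then show ?case by simp
  qed
  then show "gen_eigenspace T \<mu> \<subseteq> range ?P" by (auto simp: gen_eigenspace_def)
qed

end

text \<open>\<open>P\<^sub>2 - I\<close> equals \<open>(T - \<mu>)\<^sup>n\<^sup>+\<^sup>1\<close> times a moment of size \<open>r\<^sub>2\<^sup>-\<^sup>n\<close>, while \<open>(T - \<mu>)\<^sup>n\<^sup>+\<^sup>1 P\<^sub>1\<close> has size \<open>r\<^sub>1\<^sup>n\<close>; the product tends
  to 0.\<close>

lemma riesz_int_nested:
  assumes "riesz_circle T \<mu> r1" "riesz_circle T \<mu> r2" "r1 < r2"
  shows "blinfun_apply (riesz_int T \<mu> r2 1) (blinfun_apply (riesz_int T \<mu> r1 1) x) = blinfun_apply (riesz_int T \<mu> r1 1) x"
proof -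
  interpret c1: riesz_circle T \<mu> r1 by fact
  interpret c2: riesz_circle T \<mu> r2 by fact
  let ?N = "T - \<mu> *\<^sub>C id_blinfun"
  let ?y = "blinfun_apply (riesz_int T \<mu> r1 1) x"
  have N: "?N \<in> bounded_ops" using c1.T by simp
  obtain C1 where C1: "C1 \<ge> 0" "\<And>j. norm (riesz_int T \<mu> r1 j) \<le> r1 powi j * C1" using c1.riesz_int_norm by blast
  obtain C2 where C2: "C2 \<ge> 0" "\<And>j. norm (riesz_int T \<mu> r2 j) \<le> r2 powi j * C2" using c2.riesz_int_norm by blast
  have le: "norm (blinfun_apply (riesz_int T \<mu> r2 1) ?y - ?y) \<le> (r1 / r2) ^ n * (C2 * (r1\<^sup>2 * C1 * norm x))" for n
  proof -
    have "blinfun_apply (riesz_int T \<mu> r2 1) ?y - ?y = blinfun_apply (op_power ?N (Suc n)) (blinfun_apply (riesz_int T \<mu> r2 (- int n)) ?y)"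
      by (rule c2.riesz_int_power_neg[symmetric])
    also have "\<dots> = blinfun_apply (riesz_int T \<mu> r2 (- int n)) (blinfun_apply (op_power ?N (Suc n)) ?y)"
      by (rule c2.riesz_int_commute[OF bops_power[OF N]])
        (rule op_power_commute[symmetric], simp add: op_apply bopsD[OF c1.T])
    also have "blinfun_apply (op_power ?N (Suc n)) ?y = blinfun_apply (riesz_int T \<mu> r1 (int n + 2)) x"
      using c1.riesz_int_power[of "Suc n" x] by (simp only: of_nat_Suc) (simp add: algebra_simps)
    also have "norm (blinfun_apply (riesz_int T \<mu> r2 (- int n)) (blinfun_apply (riesz_int T \<mu> r1 (int n + 2)) x))
      \<le> (r2 powi (- int n) * C2) * ((r1 powi (int n + 2) * C1) * norm x)"
      by (rule order_trans[OF norm_blinfun], rule mult_mono[OF C2(2)])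
        (use c2.r C2(1) order_trans[OF norm_blinfun mult_right_mono[OF C1(2)]] in auto)
    also have "\<dots> = (r1 / r2) ^ n * (C2 * (r1\<^sup>2 * C1 * norm x))"
      using c1.r c2.r by (simp add: power_int_minus power_int_add power_divide field_simps)
    finally show ?thesis .
  qed
  have "(\<lambda>n. (r1 / r2) ^ n * (C2 * (r1\<^sup>2 * C1 * norm x))) \<longlonglongrightarrow> 0"
    using c1.r c2.r assms(3) by (intro tendsto_mult_left_zero LIMSEQ_power_zero) auto
  then have "norm (blinfun_apply (riesz_int T \<mu> r2 1) ?y - ?y) \<le> 0"
    by (rule LIMSEQ_le_const) (use le in blast)
  then show ?thesis by simp
qed

lemma riesz_projection_circle:
  assumes T: "T \<in> bounded_ops" and iso: "\<mu> isolated_in op_spectrum T"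
  shows "\<exists>r. riesz_circle T \<mu> r \<and> riesz_projection T \<mu> = riesz_int T \<mu> r 1"
proof -
  define r where "r = (SOME r. 0 < r \<and> cball \<mu> r \<inter> op_spectrum T \<subseteq> {\<mu>})"
  obtain e where e: "e > 0" "\<And>y. y \<in> op_spectrum T \<Longrightarrow> dist \<mu> y < e \<Longrightarrow> y = \<mu>"
    using iso unfolding isolated_in_dist_Ex_iff by blast
  have "0 < e/2 \<and> cball \<mu> (e/2) \<inter> op_spectrum T \<subseteq> {\<mu>}"
    using e by (auto intro!: e(2))
  then have r: "0 < r \<and> cball \<mu> r \<inter> op_spectrum T \<subseteq> {\<mu>}"
    unfolding r_def by (rule someI)
  then have c: "riesz_circle T \<mu> r" using T by unfold_locales auto
  interpret riesz_circle T \<mu> r by (rule c)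
  let ?f = "\<lambda>t. circ r t powi 1 *\<^sub>C resolvent_op T (\<mu> + circ r t)"
  have "vector_contour_integral (circlepath \<mu> r) (resolvent_op T) = integral {0..1} (\<lambda>t. (2 * of_real pi * \<i>) *\<^sub>C ?f t)"
    unfolding vector_contour_integral_def
    by (intro integral_cong) (simp add: vector_derivative_circlepath01 circlepath_circ circ_def scaleC_scaleC mult_ac)
  also have "\<dots> = (2 * of_real pi * \<i>) *\<^sub>C riesz_int T \<mu> r 1"
    unfolding riesz_int_def
    using integral_linear[OF integrable_continuous_real[OF continuous_integrand[of 1]] bounded_linear_scaleC[of "2 * of_real pi * \<i>"]]
    by (simp only: comp_def)
  finally have "riesz_projection T \<mu> = (1 / (2 * complex_of_real pi * \<i>)) *\<^sub>C (2 * of_real pi * \<i>) *\<^sub>C riesz_int T \<mu> r 1"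
    unfolding riesz_projection_def Let_def r_def[symmetric] by simp
  also have "\<dots> = riesz_int T \<mu> r 1" unfolding scaleC_scaleC by (simp add: scaleC_one)
  finally show ?thesis using c by blast
qed

lemma discrete_eigenvalue_gen_eigenspace:
  assumes T: "T \<in> bounded_ops" and \<mu>: "\<mu> \<in> discrete_eigenvalues T"
  shows "range (blinfun_apply (riesz_projection T \<mu>)) = gen_eigenspace T \<mu>"
    "fin_dim (gen_eigenspace T \<mu>)" "alg_mult T \<mu> = complex_vector.dim (gen_eigenspace T \<mu>)"
    "0 < alg_mult T \<mu>"
proof -
  obtain r where rc: "riesz_circle T \<mu> r" "riesz_projection T \<mu> = riesz_int T \<mu> r 1"
    using riesz_projection_circle[OF T] \<mu> by (auto simp: discrete_eigenvalues_def)
  interpret riesz_circle T \<mu> r by (rule rc(1))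
  have f: "fin_dim (range (blinfun_apply (riesz_int T \<mu> r 1)))"
    using \<mu> rc(2) by (simp add: discrete_eigenvalues_def finite_rank_iff)
  show 1: "range (blinfun_apply (riesz_projection T \<mu>)) = gen_eigenspace T \<mu>"
    unfolding rc(2) by (rule riesz_int_range_gen_eigenspace[OF f])
  show 2: "fin_dim (gen_eigenspace T \<mu>)" using f 1 rc(2) by simp
  show 3: "alg_mult T \<mu> = complex_vector.dim (gen_eigenspace T \<mu>)"
    by (simp add: alg_mult_def op_rank_def 1)
  obtain x where x: "x \<noteq> 0" "blinfun_apply T x = \<mu> *\<^sub>C x" using \<mu> by (auto simp: discrete_eigenvalues_def)
  then have "x \<in> gen_eigenspace T \<mu>"
    using eigenvector_shift_power[OF T x(2), of \<mu> 1] by (auto simp: gen_eigenspace_def intro!: exI[of _ 1])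
  moreover obtain b where b: "is_basis b (gen_eigenspace T \<mu>)" using basis_ex[OF gen_eigenspace_subspace[OF T] 2] by blast
  ultimately have "b \<noteq> []" using x(1) by (auto simp: is_basis_def)
  then show "0 < alg_mult T \<mu>" using 3 is_basis_length[OF b] by (metis length_greater_0_conv)
qed

text \<open>With \<open>P\<^sub>\<mu>\<close> the Riesz projections, \<open>I - E\<close> is the product of sufficiently high powers of \<open>I - P\<^sub>\<mu>\<close>. Since
  \<open>P\<^sub>\<mu> - I\<close> is \<open>T - \<mu>\<close> times a commuting operator, these powers vanish on the generalized eigenspaces, and
  \<open>x - (I - P\<^sub>\<mu>)\<^sup>k x\<close> always lies in the range of \<open>P\<^sub>\<mu>\<close>.\<close>

lemma gen_eigenspaces_projection:
  assumes T: "T \<in> bounded_ops" and S: "finite S" "S \<subseteq> discrete_eigenvalues T"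
  defines "M \<equiv> complex_vector.span (\<Union>(gen_eigenspace T ` S))"
  shows "\<exists>E\<in>finite_rank_ops. (\<forall>x. blinfun_apply E x \<in> M) \<and> (\<forall>x\<in>M. blinfun_apply E x = x) \<and>
    (\<forall>x. blinfun_apply E (blinfun_apply T x) = blinfun_apply T (blinfun_apply E x))"
proof -
  have "\<exists>Z\<in>bounded_ops. (\<forall>x. blinfun_apply Z (blinfun_apply T x) = blinfun_apply T (blinfun_apply Z x)) \<and>
    (\<forall>x\<in>complex_vector.span (\<Union>(gen_eigenspace T ` S')). blinfun_apply Z x = 0) \<and>
    (\<forall>x. x - blinfun_apply Z x \<in> complex_vector.span (\<Union>(gen_eigenspace T ` S')))" if "S' \<subseteq> S" for S'
    using finite_subset[OF that S(1)] that
  proof (induction S' rule: finite_induct)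
    case empty
    then show ?case by (intro bexI[of _ id_blinfun]) auto
  next
    case (insert \<mu> S')
    let ?M = "complex_vector.span (\<Union>(gen_eigenspace T ` S'))" and ?G = "gen_eigenspace T \<mu>"
    let ?M2 = "complex_vector.span (\<Union>(gen_eigenspace T ` insert \<mu> S'))"
    from insert obtain Z where Z: "Z \<in> bounded_ops"
      and comm: "\<And>x. blinfun_apply Z (blinfun_apply T x) = blinfun_apply T (blinfun_apply Z x)"
      and kill: "\<And>x. x \<in> ?M \<Longrightarrow> blinfun_apply Z x = 0"
      and diff: "\<And>x. x - blinfun_apply Z x \<in> ?M" by auto
    have \<mu>: "\<mu> \<in> discrete_eigenvalues T" using insert.prems S(2) by auto
    note G = discrete_eigenvalue_gen_eigenspace[OF T \<mu>]
    obtain r where rc: "riesz_circle T \<mu> r" "riesz_projection T \<mu> = riesz_int T \<mu> r 1"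
      using riesz_projection_circle[OF T] \<mu> by (auto simp: discrete_eigenvalues_def)
    interpret riesz_circle T \<mu> r by (rule rc(1))
    let ?N = "T - \<mu> *\<^sub>C id_blinfun"
    obtain k where k: "\<And>x. x \<in> ?G \<Longrightarrow> blinfun_apply (op_power ?N k) x = 0"
      using gen_eigenspace_exponent[OF T G(2)] by blast
    let ?P = "riesz_int T \<mu> r 1" and ?Q = "riesz_int T \<mu> r 0"
    let ?D = "id_blinfun - ?P"
    have N: "?N \<in> bounded_ops" and D: "?D \<in> bounded_ops" using T riesz_int_bops by auto
    have PG: "blinfun_apply ?P x \<in> ?G" for x using G(1) rc(2) by auto
    have sG: "complex_vector.subspace ?G" by (rule gen_eigenspace_subspace[OF T])
    have Dx: "blinfun_apply ?D x = - blinfun_apply ?N (blinfun_apply ?Q x)" for x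
      using riesz_int_shift[of 0 x] by (simp add: op_apply)
    have DT: "blinfun_apply ?D (blinfun_apply T x) = blinfun_apply T (blinfun_apply ?D x)" for x
      using riesz_int_commute[OF T, of 1 x] by (simp add: op_apply)
    have NQ: "blinfun_apply (op_power ?N l) (blinfun_apply ?Q y) = blinfun_apply ?Q (blinfun_apply (op_power ?N l) y)" for l y
      by (rule riesz_int_commute[OF bops_power[OF N]])
        (rule op_power_commute[symmetric], simp add: op_apply bopsD[OF T])
    have Dkill: "blinfun_apply (op_power ?N l) x = 0 \<Longrightarrow> blinfun_apply (op_power ?D l) x = 0" for l x
    proof (induction l arbitrary: x)
      case (Suc l)
      have "blinfun_apply (op_power ?N l) (blinfun_apply ?D x) = - blinfun_apply (op_power ?N (Suc l)) (blinfun_apply ?Q x)"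
        unfolding Dx by (simp only: blinfun.minus_right op_power_apply funpow_Suc_right comp_def)
      also have "\<dots> = 0" using NQ[of "Suc l" x] Suc.prems by (simp only: blinfun.zero_right minus_zero)
      finally have "blinfun_apply (op_power ?D l) (blinfun_apply ?D x) = 0" by (rule Suc.IH)
      then show ?case by (simp only: op_power_apply funpow_Suc_right comp_def)
    qed simp
    have Ddiff: "x - blinfun_apply (op_power ?D l) x \<in> ?G" for l x
    proof (induction l)
      case 0
      then show ?case using complex_vector.subspace_0[OF sG] by simp
    next
      case (Suc l)
      have e: "x - blinfun_apply (op_power ?D (Suc l)) x = (x - blinfun_apply (op_power ?D l) x) + blinfun_apply ?P (blinfun_apply (op_power ?D l) x)"
        by (simp add: op_apply)
      show ?case unfolding e by (rule complex_vector.subspace_add[OF sG Suc PG])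
    qed
    let ?Z = "op_power ?D k o\<^sub>L Z"
    have sub: "?M \<subseteq> ?M2" "?G \<subseteq> ?M2"
      by (intro complex_vector.span_mono) (auto intro: complex_vector.span_base)
    have zG: "blinfun_apply ?Z x = 0" if "x \<in> ?G" for x
      using Dkill[OF k[OF gen_eigenspace_commute[OF comm Z that]]] by simp
    have zM: "blinfun_apply ?Z x = 0" if "x \<in> ?M" for x using kill[OF that] by (simp add: blinfun.zero_right)
    have "complex_vector.subspace {x. blinfun_apply ?Z x = 0}"
      by (rule complex_vector.subspaceI) (use D Z in \<open>auto simp: op_apply bopsD\<close>)
    moreover have "\<Union>(gen_eigenspace T ` insert \<mu> S') \<subseteq> {x. blinfun_apply ?Z x = 0}"
    proof
      fix x assume "x \<in> \<Union>(gen_eigenspace T ` insert \<mu> S')"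
      then have "x \<in> ?G \<or> x \<in> ?M" by (auto intro: complex_vector.span_base)
      then show "x \<in> {x. blinfun_apply ?Z x = 0}" using zG zM by blast
    qed
    ultimately have "?M2 \<subseteq> {x. blinfun_apply ?Z x = 0}" by (intro complex_vector.span_minimal)
    moreover have "x - blinfun_apply ?Z x \<in> ?M2" for x
    proof -
      have e: "x - blinfun_apply ?Z x = (x - blinfun_apply Z x) + (blinfun_apply Z x - blinfun_apply (op_power ?D k) (blinfun_apply Z x))"
        by simp
      show ?thesis unfolding e
        by (rule complex_vector.span_add[OF subsetD[OF sub(1) diff] subsetD[OF sub(2) Ddiff]])
    qed
    moreover have "blinfun_apply ?Z (blinfun_apply T x) = blinfun_apply T (blinfun_apply ?Z x)" for x
      using op_power_commute[of T ?D k, OF DT[symmetric]] by (simp add: comm)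
    ultimately show ?case using D Z by (intro bexI[of _ ?Z]) auto
  qed
  from this[of S] obtain Z where Z: "Z \<in> bounded_ops"
    and comm: "\<And>x. blinfun_apply Z (blinfun_apply T x) = blinfun_apply T (blinfun_apply Z x)"
    and kill: "\<And>x. x \<in> M \<Longrightarrow> blinfun_apply Z x = 0" and diff: "\<And>x. x - blinfun_apply Z x \<in> M"
    unfolding M_def by auto
  have "fin_dim M" unfolding M_def
    using span_Union_gen_eigenspaces(1)[OF T S(1)] discrete_eigenvalue_gen_eigenspace(2)[OF T] S(2) by blast
  then have "id_blinfun - Z \<in> finite_rank_ops"
    using Z diff by (intro finite_rankI[of _ M]) (auto simp: op_apply)
  then show ?thesis
    using kill diff comm by (intro bexI[of _ "id_blinfun - Z"]) (auto simp: op_apply)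
qed

section \<open>Spectra of operators approximable by finite rank operators\<close>

text \<open>Preimages of a basis of the image of \<open>W\<close> span \<open>W\<close>.\<close>

lemma fin_dim_injective:
  assumes G: "G \<in> finite_rank_ops" and W: "complex_vector.subspace W"
    and inj: "\<And>x. x \<in> W \<Longrightarrow> blinfun_apply G x = 0 \<Longrightarrow> x = 0"
  shows "fin_dim W"
proof -
  have Gb: "G \<in> bounded_ops" using G by simp
  interpret Gl: Vector_Spaces.linear "(*\<^sub>C)" "(*\<^sub>C)" "blinfun_apply G" by (rule op_linear[OF Gb])
  have "fin_dim (blinfun_apply G ` W)"
    using G by (auto simp: finite_rank_iff intro: fin_dim_subset)
  then obtain g where g: "is_basis g (blinfun_apply G ` W)"
    using basis_ex Gl.subspace_image[OF W] by blast
  have "\<forall>i<length g. \<exists>w\<in>W. blinfun_apply G w = g ! i" using is_basis_mem[OF g] by (metis imageE)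
  then obtain w where w: "\<And>i. i < length g \<Longrightarrow> w i \<in> W \<and> blinfun_apply G (w i) = g ! i" by metis
  have "W \<subseteq> complex_vector.span (w ` {..<length g})"
  proof
    fix x assume x: "x \<in> W"
    let ?y = "\<Sum>i<length g. coord g i (blinfun_apply G x) *\<^sub>C w i"
    have "blinfun_apply G ?y = (\<Sum>i<length g. coord g i (blinfun_apply G x) *\<^sub>C g ! i)"
      using w by (simp add: blinfun.sum_right bopsD[OF Gb])
    also have "\<dots> = blinfun_apply G x" using x by (intro coord_sum[OF g]) auto
    finally have "blinfun_apply G (x - ?y) = 0" by (simp add: blinfun.diff_right)
    moreover have "x - ?y \<in> W"
      using x w W by (intro complex_vector.subspace_diff complex_vector.subspace_sum complex_vector.subspace_scale) auto
    ultimately have "x = ?y" using inj by fastforce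
    also have "?y \<in> complex_vector.span (w ` {..<length g})"
      by (intro complex_vector.span_sum complex_vector.span_scale complex_vector.span_base) auto
    finally show "x \<in> complex_vector.span (w ` {..<length g})" .
  qed
  then show ?thesis unfolding fin_dim_def by (intro exI[of _ "w ` {..<length g}"]) auto
qed

text \<open>The resolvent identity shows that the difference quotients of \<open>V(z) = (I - z A)\<^sup>-\<^sup>1\<close> are \<open>V(w) A V(z)\<close>, and
  \<open>V\<close> is continuous. Placing \<open>F\<close> on the left keeps the range fixed.\<close>

lemma resolvent_family:
  fixes A :: "'a::complex_banach \<Rightarrow>\<^sub>L 'a"
  assumes A: "A \<in> bounded_ops" and F: "F \<in> finite_rank_ops" and S: "open S"
    and inv: "\<And>z. z \<in> S \<Longrightarrow> id_blinfun - z *\<^sub>C A \<in> invertibles"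
  shows "\<exists>u. holomorphic_family u (range (blinfun_apply F)) (\<lambda>z. F o\<^sub>L (z *\<^sub>C inv_op (id_blinfun - z *\<^sub>C A))) S"
proof -
  define V where "V z = inv_op (id_blinfun - z *\<^sub>C A)" for z
  have Fb: "F \<in> bounded_ops" using F by simp
  have Vb: "V z \<in> bounded_ops" if "z \<in> S" for z unfolding V_def by (rule inv_op_bops[OF inv[OF that]])
  obtain u where u: "is_basis u (range (blinfun_apply F))" using range_basis_is_basis[OF F] by blast
  have contV: "continuous_on S V"
    unfolding V_def[abs_def]
    by (rule continuous_on_compose2[OF continuous_on_inv_op])
      (use inv in \<open>auto intro!: continuous_intros\<close>)
  have res: "blinfun_apply (V w) x - blinfun_apply (V z) x = (w - z) *\<^sub>C blinfun_apply (V w) (blinfun_apply A (blinfun_apply (V z) x))"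
    if "w \<in> S" "z \<in> S" for w z x
  proof -
    define y where "y = blinfun_apply (V z) x"
    define a where "a = blinfun_apply (V w) (blinfun_apply A y)"
    have x: "x = y - z *\<^sub>C blinfun_apply A y"
      using inv_op_apply(1)[OF inv[OF that(2)], of x] by (simp add: V_def y_def op_apply)
    have "y = blinfun_apply (V w) (y - w *\<^sub>C blinfun_apply A y)"
      using inv_op_apply(2)[OF inv[OF that(1)], of y] by (simp add: V_def op_apply)
    then have 1: "y = blinfun_apply (V w) y - w *\<^sub>C a"
      by (simp add: blinfun.diff_right bopsD[OF Vb[OF that(1)]] a_def)
    have 2: "blinfun_apply (V w) x = blinfun_apply (V w) y - z *\<^sub>C a"
      by (subst x) (simp add: blinfun.diff_right bopsD[OF Vb[OF that(1)]] a_def)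
    have "blinfun_apply (V w) x - y = (blinfun_apply (V w) y - z *\<^sub>C a) - (blinfun_apply (V w) y - w *\<^sub>C a)"
      using 1 2 by (simp only:)
    then show ?thesis unfolding a_def y_def by (simp add: scaleC_diff_left)
  qed
  obtain K where K: "K \<ge> 0" "\<And>x i. x \<in> range (blinfun_apply F) \<Longrightarrow> i < length u \<Longrightarrow> cmod (coord u i x) \<le> K * norm x"
    using coord_bounded[OF u] by blast
  have lin: "bounded_linear (\<lambda>x. coord u i (blinfun_apply F x))" if "i < length u" for i
  proof (rule bounded_linear_intro[where K = "K * norm F"])
    show "coord u i (blinfun_apply F (x + y)) = coord u i (blinfun_apply F x) + coord u i (blinfun_apply F y)" for x y
      by (simp add: blinfun.add_right coord_add[OF u])
    show "coord u i (blinfun_apply F (r *\<^sub>R x)) = r *\<^sub>R coord u i (blinfun_apply F x)" for r x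
      by (simp only: scaleC_of_real[symmetric] bopsD[OF Fb] coord_scale[OF u rangeI] scaleC_complex_def)
    show "norm (coord u i (blinfun_apply F x)) \<le> norm x * (K * norm F)" for x
      using K(2)[OF rangeI that, of x] mult_left_mono[OF norm_blinfun[of F x] K(1)] by (simp add: mult_ac)
  qed
  have hol: "(\<lambda>z. coord u i (blinfun_apply F (blinfun_apply (V z) x))) holomorphic_on S" if i: "i < length u" for i x
  proof (rule holomorphic_onI)
    fix z assume z: "z \<in> S"
    define f where "f w = coord u i (blinfun_apply F (blinfun_apply (V w) x))" for w
    let ?y = "blinfun_apply A (blinfun_apply (V z) x)"
    let ?g = "\<lambda>w. coord u i (blinfun_apply F (blinfun_apply (V w) ?y))"
    have "continuous_on S ?g"
      by (intro bounded_linear.continuous_on[OF lin[OF i]] bounded_linear.continuous_on[OF bounded_linear_apply_blinfun] contV)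
    then have "isCont ?g z" using S z continuous_on_eq_continuous_at by blast
    then have "(?g \<longlongrightarrow> ?g z) (at z)" by (simp add: isCont_def)
    moreover have "\<forall>\<^sub>F w in at z. ?g w = (f w - f z) / (w - z)"
    proof -
      have "\<forall>\<^sub>F w in at z. w \<in> S - {z}" using S z by (rule eventually_at_in_open)
      then show ?thesis
      proof (rule eventually_mono)
        fix w assume w: "w \<in> S - {z}"
        have "f w - f z = coord u i (blinfun_apply F (blinfun_apply (V w) x - blinfun_apply (V z) x))"
          by (simp add: f_def blinfun.diff_right coord_diff[OF u])
        also have "\<dots> = (w - z) * ?g w"
          using w z by (simp add: res bopsD[OF Fb] coord_scale[OF u])
        finally show "?g w = (f w - f z) / (w - z)" using w by simp
      qed
    qed
    ultimately have "((\<lambda>w. (f w - f z) / (w - z)) \<longlongrightarrow> ?g z) (at z)"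
      by (rule Lim_transform_eventually)
    then have "(f has_field_derivative ?g z) (at z)" by (simp add: has_field_derivative_iff)
    then show "(\<lambda>z. coord u i (blinfun_apply F (blinfun_apply (V z) x))) field_differentiable at z within S"
      unfolding f_def[abs_def, symmetric]
      by (meson field_differentiable_def has_field_derivative_at_within)
  qed
  have "holomorphic_family u (range (blinfun_apply F)) (\<lambda>z. F o\<^sub>L (z *\<^sub>C V z)) S"
  proof
    fix i j assume i: "i < length u"
    show "(\<lambda>z. coord u i (blinfun_apply (F o\<^sub>L (z *\<^sub>C V z)) (u ! j))) holomorphic_on S"
      by (simp add: op_apply bopsD[OF Fb] coord_scale[OF u]) (intro holomorphic_intros hol[OF i])
  qed (use u F Vb in auto)
  then show ?thesis by (auto simp: V_def)
qed

definition approximable :: "('a::complex_normed_vector \<Rightarrow>\<^sub>L 'a) \<Rightarrow> bool"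
  where "approximable L \<longleftrightarrow> L \<in> bounded_ops \<and> (\<forall>e>0. \<exists>F\<in>finite_rank_ops. norm (L - F) < e)"

lemma approximable_comp_right:
  assumes "approximable L" "B \<in> bounded_ops"
  shows "approximable (L o\<^sub>L B)"
  unfolding approximable_def
proof (intro conjI allI impI)
  show "L o\<^sub>L B \<in> bounded_ops" using assms by (simp add: approximable_def)
  fix e :: real assume e: "e > 0"
  then have "0 < e / (norm B + 1)" by (simp add: add_nonneg_pos)
  then obtain F where F: "F \<in> finite_rank_ops" "norm (L - F) < e / (norm B + 1)"
    using assms(1) unfolding approximable_def by blast
  have "(L o\<^sub>L B) - (F o\<^sub>L B) = (L - F) o\<^sub>L B" by (rule blinfun_eqI) (simp add: op_apply)
  then have "norm ((L o\<^sub>L B) - (F o\<^sub>L B)) \<le> norm (L - F) * norm B" by (simp add: norm_blinfun_compose)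
  also have "\<dots> \<le> norm (L - F) * (norm B + 1)" by (intro mult_left_mono) auto
  also have "\<dots> < e" using F(2) by (simp add: add_nonneg_pos pos_less_divide_eq)
  finally show "\<exists>F\<in>finite_rank_ops. norm ((L o\<^sub>L B) - F) < e"
    using F(1) assms(2) by (intro bexI[of _ "F o\<^sub>L B"]) auto
qed

text \<open>Choose \<open>F\<close> of finite rank with \<open>S = L - F\<close> of norm less than \<open>\<bar>\<mu>\<bar> / 2\<close>. For \<open>\<bar>z\<bar> < 2 / \<bar>\<mu>\<bar>\<close>,
  \<open>I - z L = (I - G(z)) (I - z S)\<close> with \<open>G(z) = z F (I - z S)\<^sup>-\<^sup>1\<close>. Hence spectral points near \<open>\<mu>\<close> are eigenvalues and
  correspond to zeros of the holomorphic function \<open>z \<mapsto> det (I - G(z))\<close>, which is 1 at the origin.\<close>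

lemma approximable_spectrum:
  fixes L :: "'a::complex_banach \<Rightarrow>\<^sub>L 'a"
  assumes L: "approximable L" and \<mu>: "\<mu> \<in> op_spectrum L" "\<mu> \<noteq> 0"
  shows "\<mu> isolated_in op_spectrum L" "\<exists>x. x \<noteq> 0 \<and> blinfun_apply L x = \<mu> *\<^sub>C x"
proof -
  have Lb: "L \<in> bounded_ops" using L by (simp add: approximable_def)
  obtain F where F: "F \<in> finite_rank_ops" "norm (L - F) < cmod \<mu> / 2"
    using L \<mu>(2) unfolding approximable_def by (metis half_gt_zero zero_less_norm_iff)
  define S where "S = L - F"
  have Fb: "F \<in> bounded_ops" and Sb: "S \<in> bounded_ops" using F Lb by (auto simp: S_def)
  define B where "B = ball (0::complex) (2 / cmod \<mu>)"
  have inv: "id_blinfun - z *\<^sub>C S \<in> invertibles" if "z \<in> B" for z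
  proof (rule invertible_id_minus)
    have "cmod z * norm S \<le> (2 / cmod \<mu>) * norm S"
      using that by (intro mult_right_mono) (auto simp: B_def)
    also have "\<dots> < (2 / cmod \<mu>) * (cmod \<mu> / 2)"
      using F(2) \<mu>(2) by (intro mult_strict_left_mono) (auto simp: S_def)
    finally show "norm (z *\<^sub>C S) < 1" using \<mu>(2) by (simp add: norm_scaleC)
  qed (use Sb in simp)
  define V where "V z = inv_op (id_blinfun - z *\<^sub>C S)" for z
  have Vb: "V z \<in> bounded_ops" if "z \<in> B" for z unfolding V_def by (rule inv_op_bops[OF inv[OF that]])
  define G where "G z = F o\<^sub>L (z *\<^sub>C V z)" for z
  have GF: "G z \<in> finite_rank_ops" if "z \<in> B" for z using Vb[OF that] F by (simp add: G_def)
  have "open B" by (simp add: B_def)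
  have "(\<lambda>z. F o\<^sub>L (z *\<^sub>C inv_op (id_blinfun - z *\<^sub>C S))) = G" by (rule ext) (simp add: G_def V_def)
  then obtain u where "holomorphic_family u (range (blinfun_apply F)) G B"
    using resolvent_family[OF Sb F(1) \<open>open B\<close> inv] by auto
  then interpret holomorphic_family u "range (blinfun_apply F)" G B .
  have fac: "(id_blinfun - G z) o\<^sub>L (id_blinfun - z *\<^sub>C S) = id_blinfun - z *\<^sub>C L" if "z \<in> B" for z
  proof (rule blinfun_eqI)
    fix x
    have "blinfun_apply (G z) (blinfun_apply (id_blinfun - z *\<^sub>C S) x) = z *\<^sub>C blinfun_apply F x"
      using inv_op_apply(2)[OF inv[OF that], of x] Fb by (simp add: G_def V_def scaleC_blinfun.rep_eq bopsD)
    then show "blinfun_apply ((id_blinfun - G z) o\<^sub>L (id_blinfun - z *\<^sub>C S)) x = blinfun_apply (id_blinfun - z *\<^sub>C L) x"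
      by (simp add: blinfun.diff_left scaleC_blinfun.rep_eq S_def scaleC_diff_right)
  qed
  have key: "\<exists>x y. x \<noteq> 0 \<and> y \<noteq> 0 \<and> blinfun_apply L x = \<nu> *\<^sub>C x \<and> blinfun_apply (G (inverse \<nu>)) y = y"
    if \<nu>: "\<nu> \<in> op_spectrum L" "cmod \<mu> / 2 < cmod \<nu>" for \<nu>
  proof -
    let ?z = "inverse \<nu>"
    have \<nu>0: "\<nu> \<noteq> 0" using \<nu>(2) \<mu>(2) by auto
    have pos: "0 < cmod \<mu> * cmod \<nu>" using \<mu>(2) \<nu>0 by simp
    have "inverse (cmod \<nu>) < 2 / cmod \<mu>" using \<nu> \<nu>0 \<mu>(2) pos by (simp add: field_simps)
    then have z: "?z \<in> B" by (simp add: B_def norm_inverse)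
    have "id_blinfun - G ?z \<notin> invertibles"
    proof
      assume "id_blinfun - G ?z \<in> invertibles"
      then have "inverse_op ((id_blinfun - G ?z) o\<^sub>L (id_blinfun - ?z *\<^sub>C S)) (inv_op (id_blinfun - ?z *\<^sub>C S) o\<^sub>L inv_op (id_blinfun - G ?z))"
        by (intro inverse_op_compose inv_op_inverse inv[OF z])
      then have "id_blinfun - ?z *\<^sub>C L \<in> invertibles"
        unfolding fac[OF z] using Lb by (auto simp: invertibles_def)
      then show False using spectrum_reciprocal[OF Lb \<nu>0] \<nu>(1) by blast
    qed
    then obtain y where y: "blinfun_apply (G ?z) y = y" "y \<noteq> 0"
      using finite_rank_fredholm[OF GF[OF z]] by blast
    let ?x = "blinfun_apply (V ?z) y"
    have 1: "y = ?x - ?z *\<^sub>C blinfun_apply S ?x"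
      using inv_op_apply(1)[OF inv[OF z], of y] by (simp add: V_def op_apply)
    have 2: "y = ?z *\<^sub>C blinfun_apply F ?x" using y(1) Fb by (simp add: G_def scaleC_blinfun.rep_eq bopsD)
    have "?x = ?z *\<^sub>C blinfun_apply F ?x + ?z *\<^sub>C blinfun_apply S ?x" using 1 2 by (metis diff_add_cancel)
    also have "\<dots> = ?z *\<^sub>C blinfun_apply L ?x" by (simp add: S_def op_apply scaleC_diff_right)
    finally have "\<nu> *\<^sub>C ?x = \<nu> *\<^sub>C ?z *\<^sub>C blinfun_apply L ?x" by simp
    then have "blinfun_apply L ?x = \<nu> *\<^sub>C ?x" using \<nu>0 by (simp add: scaleC_scaleC scaleC_one)
    moreover have "?x \<noteq> 0" using 1 y(2) by auto
    ultimately show ?thesis using y by blast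
  qed
  show "\<exists>x. x \<noteq> 0 \<and> blinfun_apply L x = \<mu> *\<^sub>C x" using key[OF \<mu>(1)] \<mu>(2) by auto
  have G0: "fr_det (G 0) = 1" by (simp add: G_def)
  have "inverse (cmod \<mu>) < 2 / cmod \<mu>" using \<mu>(2) by (simp add: field_simps)
  then have z0: "inverse \<mu> \<in> B" by (simp add: B_def norm_inverse)
  have "\<forall>\<^sub>F z in at (inverse \<mu>). fr_det (G z) \<noteq> 0 \<and> z \<in> B"
    by (rule non_zero_neighbour_alt[OF holomorphic_det _ _ z0, of 0]) (use G0 \<mu>(2) in \<open>auto simp: B_def\<close>)
  moreover have "filterlim inverse (at (inverse \<mu>)) (at \<mu>)"
    unfolding filterlim_at using \<mu>(2)
    by (auto intro!: tendsto_intros simp: eventually_at_filter)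
  ultimately have "\<forall>\<^sub>F \<nu> in at \<mu>. fr_det (G (inverse \<nu>)) \<noteq> 0 \<and> inverse \<nu> \<in> B"
    by (rule eventually_compose_filterlim)
  moreover have "\<forall>\<^sub>F \<nu> in at \<mu>. cmod \<mu> / 2 < cmod \<nu>"
    using \<mu>(2) by (intro order_tendstoD(1)[OF tendsto_norm[OF tendsto_ident_at]]) simp
  ultimately have "\<forall>\<^sub>F \<nu> in at \<mu>. \<nu> \<notin> op_spectrum L"
  proof eventually_elim
    case (elim \<nu>)
    then show ?case using key[of \<nu>] fr_det_eigenvalue_one[OF GF] by blast
  qed
  then have "\<not> \<mu> islimpt op_spectrum L"
    by (simp add: islimpt_iff_eventually)
  then show "\<mu> isolated_in op_spectrum L" using \<mu>(1) by (simp add: isolated_in_islimpt_iff)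
qed

text \<open>By \<open>riesz_int_nested\<close> the range of the Riesz projection is fixed by the Riesz integral over a slightly larger
  circle. If the circle does not enclose 0, that integral is \<open>L B\<close> with a bounded \<open>B\<close>; a fixed vector of \<open>L B\<close>
  cannot be killed by \<open>F B\<close> when \<open>F\<close> is close to \<open>L\<close>, so the space of fixed vectors is finite-dimensional. The
  circle can enclose 0 only if \<open>L\<close> is invertible, and then the whole space is finite-dimensional.\<close>

lemma approximable_discrete:
  fixes L :: "'a::complex_banach \<Rightarrow>\<^sub>L 'a"
  assumes L: "approximable L" and \<mu>: "\<mu> \<in> op_spectrum L" "\<mu> \<noteq> 0"
  shows "\<mu> \<in> discrete_eigenvalues L"
proof -
  have Lb: "L \<in> bounded_ops" using L by (simp add: approximable_def)
  note iso = approximable_spectrum[OF assms]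
  obtain r where rc: "riesz_circle L \<mu> r" "riesz_projection L \<mu> = riesz_int L \<mu> r 1"
    using riesz_projection_circle[OF Lb iso(1)] by blast
  interpret riesz_circle L \<mu> r by (rule rc(1))
  let ?P = "riesz_int L \<mu> r 1"
  have fin: "fin_dim W" if W: "complex_vector.subspace W" and B: "B \<in> bounded_ops"
    and fx: "\<And>x. x \<in> W \<Longrightarrow> blinfun_apply L (blinfun_apply B x) = x" for W B
  proof -
    have "0 < 1 / (norm B + 1)" by (simp add: add_nonneg_pos)
    then obtain F where F: "F \<in> finite_rank_ops" "norm (L - F) < 1 / (norm B + 1)"
      using L unfolding approximable_def by blast
    show ?thesis
    proof (rule fin_dim_injective[of "F o\<^sub>L B", OF _ W])
      show "F o\<^sub>L B \<in> finite_rank_ops" using F B by simp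
      fix x assume x: "x \<in> W" "blinfun_apply (F o\<^sub>L B) x = 0"
      have "x = blinfun_apply (L - F) (blinfun_apply B x)" using fx[OF x(1)] x(2) by (simp add: op_apply)
      then have "norm x \<le> norm (L - F) * norm (blinfun_apply B x)" by (metis norm_blinfun)
      also have "\<dots> \<le> norm (L - F) * (norm B * norm x)" by (intro mult_left_mono norm_blinfun) auto
      finally have "norm x \<le> (norm (L - F) * norm B) * norm x" by (simp add: mult.assoc)
      moreover have "norm (L - F) * norm B < 1"
      proof -
        have "norm (L - F) * norm B \<le> norm (L - F) * (norm B + 1)" by (intro mult_left_mono) auto
        also have "\<dots> < 1" using F(2) by (simp add: add_nonneg_pos pos_less_divide_eq)
        finally show ?thesis .
      qed
      ultimately show "x = 0"
        by (metis mult_less_cancel_right2 norm_le_zero_iff not_le)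
    qed
  qed
  have "fin_dim (range (blinfun_apply ?P))"
  proof (cases "0 \<in> op_spectrum L")
    case False
    let ?R = "resolvent_op L 0"
    have "blinfun_apply L (blinfun_apply (- ?R) x) = x" for x
      using resolvent_apply(1)[OF Lb False, of x] by (simp add: op_apply)
    then have "fin_dim (UNIV :: 'a set)"
      using resolvent_bops[OF Lb False] by (intro fin[of _ "- ?R"]) auto
    then show ?thesis by (rule fin_dim_subset) simp
  next
    case True
    have sp: "op_spectrum L - {\<mu>} = op_spectrum L - ball \<mu> r"
      using disc r by (auto simp: subset_iff)
    have "closed (op_spectrum L - {\<mu>})"
      unfolding sp by (intro closed_Diff spectrum_closed[OF Lb]) auto
    moreover have "cball \<mu> r \<inter> (op_spectrum L - {\<mu>}) = {}" using disc by blast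
    ultimately obtain d where d: "d > 0" "\<And>x y. x \<in> cball \<mu> r \<Longrightarrow> y \<in> op_spectrum L - {\<mu>} \<Longrightarrow> d \<le> dist x y"
      using separate_compact_closed[of "cball \<mu> r" "op_spectrum L - {\<mu>}"] by auto
    \<comment> \<open>A slightly larger circle that still encloses no other spectral point.\<close>
    define R where "R = r + d/2"
    have cR: "riesz_circle L \<mu> R"
    proof
      show "L \<in> bounded_ops" "0 < R" using Lb riesz_circle.r[OF \<open>riesz_circle L \<mu> r\<close>] d by (auto simp: R_def)
      show "cball \<mu> R \<inter> op_spectrum L \<subseteq> {\<mu>}"
      proof
        fix y assume y: "y \<in> cball \<mu> R \<inter> op_spectrum L"
        show "y \<in> {\<mu>}"
        proof (rule ccontr)
          assume "y \<notin> {\<mu>}"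
          then have yo: "y \<in> op_spectrum L - {\<mu>}" using y by simp
          then have far: "r < dist \<mu> y" using d(2)[of y y] d(1) by force
          define x where "x = \<mu> + (r / dist \<mu> y) *\<^sub>R (y - \<mu>)"
          have r0: "0 < r" using \<open>riesz_circle L \<mu> r\<close> by (simp add: riesz_circle_def)
          have "dist \<mu> x = r" using far r0 by (auto simp: x_def dist_norm norm_minus_commute)
          moreover have "dist x y = dist \<mu> y - r"
          proof -
            have "x - y = (r / dist \<mu> y - 1) *\<^sub>R (y - \<mu>)" by (simp add: x_def algebra_simps)
            then have "dist x y = \<bar>r / dist \<mu> y - 1\<bar> * dist \<mu> y"
              by (simp add: dist_norm norm_minus_commute)
            also have "\<dots> = (1 - r / dist \<mu> y) * dist \<mu> y"
            proof -
              have "0 < dist \<mu> y" using far r0 by linarith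
              then have "r / dist \<mu> y < 1" using far by (simp add: divide_less_eq)
              then show ?thesis by (simp add: abs_if)
            qed
            also have "\<dots> = dist \<mu> y - r" using far r0 by (auto simp: field_simps)
            finally show ?thesis .
          qed
          ultimately show False using d(1) d(2)[OF _ yo, of x] y by (simp add: R_def)
        qed
      qed
    qed
    interpret R: riesz_circle L \<mu> R by (rule cR)
    have rR: "r < R" using d by (simp add: R_def)
    have R\<mu>: "R < cmod \<mu>"
    proof (rule ccontr)
      assume "\<not> ?thesis"
      then have "0 \<in> cball \<mu> R \<inter> op_spectrum L" using True by simp
      then show False using R.disc \<mu>(2) by blast
    qed
    define h where "h t = circ R t / (\<mu> + circ R t)" for t
    have nz: "\<mu> + circ R t \<noteq> 0" for t
    proof
      assume "\<mu> + circ R t = 0"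
      then have "\<mu> = - circ R t" by (simp add: add_eq_0_iff2)
      then show False using R\<mu> R.r by simp
    qed
    \<comment> \<open>The circle does not enclose 0, so \<open>1 / \<lambda>\<close> integrates to 0 and \<open>R(\<lambda>)\<close> may be replaced by \<open>L R(\<lambda>) / \<lambda>\<close>.\<close>
    have int_h: "integral {0..1} h = 0"
    proof -
      have "((\<lambda>z. 1 / z) has_contour_integral 0) (circlepath \<mu> R)"
      proof (rule Cauchy_theorem_convex_simple[of _ "ball \<mu> (cmod \<mu>)"])
        show "(\<lambda>z. 1 / z) holomorphic_on ball \<mu> (cmod \<mu>)"
          by (intro holomorphic_intros) (auto simp: dist_norm)
        show "path_image (circlepath \<mu> R) \<subseteq> ball \<mu> (cmod \<mu>)" using R\<mu> R.r by (auto simp: path_image_circlepath)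
      qed auto
      then have "((\<lambda>t. (2 * of_real pi * \<i>) * h t) has_integral 0) {0..1}"
        unfolding has_contour_integral_def
        by (rule has_integral_eq[rotated])
          (simp add: vector_derivative_circlepath01 circlepath_circ h_def circ_def mult_ac)
      from has_integral_mult_right[OF this, of "1 / (2 * of_real pi * \<i>)"]
      have "(h has_integral 0) {0..1}" by simp
      then show ?thesis by (rule integral_unique)
    qed
    have conth: "continuous_on {0..1} h" unfolding h_def[abs_def] using nz by (intro continuous_intros) auto
    define B where "B = integral {0..1} (\<lambda>t. h t *\<^sub>C resolvent_op L (\<mu> + circ R t))"
    have contB: "continuous_on {0..1} (\<lambda>t. h t *\<^sub>C resolvent_op L (\<mu> + circ R t))"
      using R.continuous_integrand[of 0] conth by (intro continuous_intros) (simp_all add: scaleC_one)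
    have hasB: "((\<lambda>t. h t *\<^sub>C blinfun_apply (resolvent_op L (\<mu> + circ R t)) x) has_integral blinfun_apply B x) {0..1}" for x
    proof -
      have "((\<lambda>t. h t *\<^sub>C resolvent_op L (\<mu> + circ R t)) has_integral B) {0..1}"
        unfolding B_def by (intro integrable_integral integrable_continuous_real contB)
      from has_integral_linear[OF this, of "\<lambda>B. blinfun_apply B x"]
      show ?thesis by (simp add: comp_def scaleC_blinfun.rep_eq)
    qed
    have Bb: "B \<in> bounded_ops"
    proof (rule bopsI)
      fix c x
      have "((\<lambda>t. c *\<^sub>C (h t *\<^sub>C blinfun_apply (resolvent_op L (\<mu> + circ R t)) x)) has_integral c *\<^sub>C blinfun_apply B x) {0..1}"
        using has_integral_linear[OF hasB bounded_linear_scaleC] by (simp add: comp_def)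
      moreover have "((\<lambda>t. c *\<^sub>C (h t *\<^sub>C blinfun_apply (resolvent_op L (\<mu> + circ R t)) x)) has_integral blinfun_apply B (c *\<^sub>C x)) {0..1}"
        using hasB[of "c *\<^sub>C x"]
        by (simp add: bopsD[OF resolvent_bops[OF Lb R.circle_resolvent]] scaleC_scaleC mult.commute)
      ultimately show "blinfun_apply B (c *\<^sub>C x) = c *\<^sub>C blinfun_apply B x"
        using has_integral_unique by blast
    qed
    have LB: "blinfun_apply L (blinfun_apply B x) = blinfun_apply (riesz_int L \<mu> R 1) x" for x
    proof -
      let ?Rx = "\<lambda>t. blinfun_apply (resolvent_op L (\<mu> + circ R t)) x"
      have "((\<lambda>t. circ R t powi 1 *\<^sub>C ?Rx t - h t *\<^sub>C x) has_integral blinfun_apply (riesz_int L \<mu> R 1) x - 0 *\<^sub>C x) {0..1}"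
      proof (intro has_integral_diff R.riesz_int_apply)
        have "(h has_integral 0) {0..1}"
          using int_h conth by (metis integrable_continuous_real integrable_integral)
        from has_integral_linear[OF this bounded_bilinear.bounded_linear_left[OF bounded_bilinear_scaleC]]
        show "((\<lambda>t. h t *\<^sub>C x) has_integral 0 *\<^sub>C x) {0..1}" by (simp only: comp_def)
      qed
      moreover have "circ R t powi 1 *\<^sub>C ?Rx t - h t *\<^sub>C x = blinfun_apply L (h t *\<^sub>C ?Rx t)" for t
        using nz[of t] resolvent_apply(1)[OF Lb R.circle_resolvent, of t x]
        by (simp add: bopsD[OF Lb] scaleC_diff_right scaleC_scaleC h_def)
      ultimately have "((\<lambda>t. blinfun_apply L (h t *\<^sub>C ?Rx t)) has_integral blinfun_apply (riesz_int L \<mu> R 1) x) {0..1}"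
        by simp
      moreover have "((\<lambda>t. blinfun_apply L (h t *\<^sub>C ?Rx t)) has_integral blinfun_apply L (blinfun_apply B x)) {0..1}"
        using has_integral_linear[OF hasB blinfun.bounded_linear_right[of L]] by (simp only: comp_def)
      ultimately show ?thesis using has_integral_unique by blast
    qed
    show ?thesis
      by (rule fin[OF range_op_subspace[OF riesz_int_bops] Bb])
        (use riesz_int_nested[OF rc(1) cR rR] LB in auto)
  qed
  then have "riesz_projection L \<mu> \<in> finite_rank_ops" using riesz_int_bops rc(2) by (simp add: finite_rank_iff)
  then show ?thesis using iso by (simp add: discrete_eigenvalues_def)
qed

section \<open>Growth and zeros of holomorphic functions\<close>

text \<open>The maximum principle for the reversed polynomial \<open>z\<^sup>g q(1 / z)\<close>.\<close>

lemma polynomial_growth: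
  fixes q :: "complex poly"
  assumes deg: "degree q \<le> g" and bound: "\<And>z. cmod z = 1 \<Longrightarrow> cmod (poly q z) \<le> B" and w: "1 \<le> cmod w"
  shows "cmod (poly q w) \<le> cmod w ^ g * B"
proof -
  define r where "r z = (\<Sum>i\<le>g. coeff q i * z ^ (g - i))" for z
  have q: "poly q x = (\<Sum>i\<le>g. coeff q i * x ^ i)" for x
    unfolding poly_altdef by (rule sum.mono_neutral_left) (use deg in \<open>auto simp: coeff_eq_0\<close>)
  have rq: "r z = z ^ g * poly q (inverse z)" if "z \<noteq> 0" for z
    unfolding r_def q sum_distrib_left
    by (intro sum.cong refl) (use that in \<open>simp add: power_diff power_inverse field_simps\<close>)
  have "cmod (r (inverse w)) \<le> B"
  proof (rule maximum_modulus_frontier[of r "cball 0 1"])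
    show "r holomorphic_on interior (cball 0 1)" "continuous_on (closure (cball 0 1)) r"
      unfolding r_def[abs_def] by (intro holomorphic_intros continuous_intros)+
    fix z :: complex assume "z \<in> frontier (cball 0 1)"
    then have z: "cmod z = 1" by (simp add: frontier_cball)
    then have "z \<noteq> 0" by auto
    then have "cmod (r z) = cmod (poly q (inverse z))" using rq z by (simp add: norm_mult norm_power)
    also have "\<dots> \<le> B" using z by (intro bound) (simp add: norm_inverse)
    finally show "cmod (r z) \<le> B" .
  qed (use w in \<open>auto simp: norm_inverse inverse_le_1_iff\<close>)
  moreover have "w \<noteq> 0" using w by auto
  then have "r (inverse w) = inverse w ^ g * poly q w" using rq[of "inverse w"] by simp
  ultimately have "cmod (poly q w) / cmod w ^ g \<le> B"
    by (simp add: norm_mult norm_power norm_inverse divide_inverse power_inverse mult.commute)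
  then show ?thesis using \<open>w \<noteq> 0\<close> by (simp add: field_simps)
qed

text \<open>On the circle, \<open>\<bar>1 - z \<nu>\<bar> = \<bar>z - \<rho>\<^sup>2 cnj \<nu>\<bar> / \<rho>\<close>. Replacing the factors \<open>1 - z \<nu>\<close> accordingly leaves the modulus on
  the circle unchanged and makes the value at 0 equal to \<open>\<Prod> \<rho> \<bar>\<nu>\<bar>\<close>; then apply the maximum principle.\<close>

lemma zero_count_jensen:
  assumes g: "g holomorphic_on ball 0 \<rho>'" and \<rho>: "0 < \<rho>" "\<rho> < \<rho>'" and g0: "g 0 = 1"
    and bound: "\<And>z. cmod z = \<rho> \<Longrightarrow> cmod (g z * (\<Prod>\<nu>\<leftarrow>\<nu>s. 1 - z * \<nu>)) \<le> B"
    and s: "0 \<le> s" "\<And>\<nu>. \<nu> \<in> set \<nu>s \<Longrightarrow> s \<le> cmod \<nu>"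
  shows "(s * \<rho>) ^ length \<nu>s \<le> B"
proof -
  define b where "b \<nu> z = (z - of_real (\<rho>\<^sup>2) * cnj \<nu>) / of_real \<rho>" for \<nu> z
  define h where "h z = g z * (\<Prod>\<nu>\<leftarrow>\<nu>s. b \<nu> z)" for z
  have hol: "(\<lambda>z. \<Prod>\<nu>\<leftarrow>xs. b \<nu> z) holomorphic_on S" for xs S
    by (induction xs) (auto simp: b_def intro!: holomorphic_intros \<open>0 < \<rho>\<close>[THEN less_imp_neq, THEN not_sym])
  have hh: "h holomorphic_on ball 0 \<rho>'"
    unfolding h_def[abs_def] by (intro holomorphic_intros g hol)
  have beq: "cmod (b \<nu> z) = cmod (1 - z * \<nu>)" if z: "cmod z = \<rho>" for \<nu> z
  proof -
    have "of_real (\<rho>\<^sup>2) = z * cnj z" using z complex_norm_square[of z] by simp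
    then have "z - of_real (\<rho>\<^sup>2) * cnj \<nu> = z * cnj (1 - z * \<nu>)" by (simp add: algebra_simps)
    then have "cmod (z - of_real (\<rho>\<^sup>2) * cnj \<nu>) = \<rho> * cmod (1 - z * \<nu>)"
      by (simp only: norm_mult complex_mod_cnj z)
    then show ?thesis using \<rho>(1) by (simp add: b_def norm_divide)
  qed
  have peq: "cmod (\<Prod>\<nu>\<leftarrow>xs. b \<nu> z) = cmod (\<Prod>\<nu>\<leftarrow>xs. 1 - z * \<nu>)" if "cmod z = \<rho>" for xs z
    by (induction xs) (simp_all add: norm_mult beq[OF that])
  have "cmod (h 0) \<le> B"
  proof (rule maximum_modulus_frontier[of h "cball 0 \<rho>"])
    show "h holomorphic_on interior (cball 0 \<rho>)"
      by (rule holomorphic_on_subset[OF hh]) (use \<rho> in auto)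
    show "continuous_on (closure (cball 0 \<rho>)) h"
      by (rule continuous_on_subset[OF holomorphic_on_imp_continuous_on[OF hh]]) (use \<rho> in auto)
    fix z :: complex assume "z \<in> frontier (cball 0 \<rho>)"
    then have z: "cmod z = \<rho>" by (simp add: frontier_cball)
    then show "cmod (h z) \<le> B" using bound[OF z] by (simp add: h_def norm_mult peq[OF z])
  qed (use \<rho> in auto)
  moreover have "(s * \<rho>) ^ length xs \<le> cmod (\<Prod>\<nu>\<leftarrow>xs. b \<nu> 0)" if "set xs \<subseteq> set \<nu>s" for xs
    using that
  proof (induction xs)
    case (Cons \<nu> xs)
    have "cmod (b \<nu> 0) = cmod \<nu> * \<rho>" using \<rho>(1) by (simp add: b_def norm_divide norm_mult power2_eq_square)
    then have "s * \<rho> \<le> cmod (b \<nu> 0)" using s(2)[of \<nu>] Cons.prems \<rho>(1) by (simp add: mult_right_mono)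
    then show ?case using Cons s(1) \<rho>(1) by (auto simp: norm_mult intro!: mult_mono)
  qed simp
  from this[of \<nu>s] have "(s * \<rho>) ^ length \<nu>s \<le> cmod (h 0)" by (simp add: h_def g0)
  ultimately show ?thesis by simp
qed

text \<open>Schwarz's lemma for \<open>(f(\<rho> z) - f(0)) / (2 B + 1)\<close>; the added 1 makes the bound strict.\<close>

lemma bounded_holomorphic_difference:
  assumes f: "f holomorphic_on UNIV" and \<rho>: "1 < \<rho>" and B: "\<And>z. cmod z < \<rho> \<Longrightarrow> cmod (f z) \<le> B"
  shows "cmod (f 1 - f 0) \<le> (2 * B + 1) / \<rho>"
proof -
  have "cmod (f 0) \<le> B" using B[of 0] \<rho> by simp
  then have B0: "0 \<le> B" by (rule order_trans[OF norm_ge_zero])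
  define F where "F z = (f (of_real \<rho> * z) - f 0) / of_real (2 * B + 1)" for z
  have "cmod (F (1 / of_real \<rho>)) \<le> cmod (1 / of_real \<rho>)"
  proof (rule Schwarz_Lemma)
    show "F holomorphic_on ball 0 1"
    proof -
      have hc: "(\<lambda>w. f (of_real \<rho> * w)) holomorphic_on ball 0 1"
        by (rule holomorphic_on_compose_gen[OF _ f, unfolded comp_def]) (auto intro!: holomorphic_intros)
      have "complex_of_real (2 * B + 1) \<noteq> 0" unfolding of_real_eq_0_iff using B0 by simp
      then show ?thesis unfolding F_def[abs_def] by (intro holomorphic_intros hc)
    qed
    show "F 0 = 0" by (simp add: F_def)
    show "cmod (F z) < 1" if z: "cmod z < 1" for z
    proof -
      have "cmod (of_real \<rho> * z) < \<rho>" using z \<rho> by (simp add: norm_mult)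
      then have "cmod (f (of_real \<rho> * z) - f 0) \<le> B + B"
        using B[of "of_real \<rho> * z"] B[of 0] \<rho> norm_triangle_ineq4[of "f (of_real \<rho> * z)" "f 0"] by auto
      then have "cmod (f (of_real \<rho> * z) - f 0) < 2 * B + 1" by linarith
      then show ?thesis unfolding F_def norm_divide norm_of_real using B0 by (simp add: divide_less_eq)
    qed
    show "cmod (1 / of_real \<rho>) < 1" using \<rho> by (simp add: norm_divide)
  qed
  note le = this
  have "F (1 / of_real \<rho>) = (f 1 - f 0) / of_real (2 * B + 1)" using \<rho> by (simp add: F_def)
  then have "cmod (f 1 - f 0) / \<bar>2 * B + 1\<bar> \<le> 1 / \<bar>\<rho>\<bar>"
    using le by (simp only: norm_divide norm_of_real norm_one)
  then show ?thesis using B0 \<rho> by (simp add: field_simps)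
qed

text \<open>Schwarz's lemma for \<open>h / (2 A - h)\<close>, which maps the disc into the unit disc because \<open>Re h < A\<close>.\<close>

lemma borel_caratheodory_half:
  assumes h: "h holomorphic_on ball 0 \<rho>" and \<rho>: "0 < \<rho>" and h0: "h 0 = 0"
    and re: "\<And>z. cmod z < \<rho> \<Longrightarrow> Re (h z) < A" and z: "cmod z \<le> \<rho> / 2"
  shows "cmod (h z) \<le> 2 * A"
proof -
  have A: "0 < A" using re[of 0] h0 \<rho> by simp
  have lt: "cmod (h w) < cmod (of_real (2 * A) - h w)" if "cmod w < \<rho>" for w
  proof -
    have "(Re (h w))\<^sup>2 < (2 * A - Re (h w))\<^sup>2"
      using re[OF that] A by (simp add: power2_eq_square algebra_simps)
    then have "(cmod (h w))\<^sup>2 < (cmod (of_real (2 * A) - h w))\<^sup>2"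
      by (simp add: cmod_power2)
    then show ?thesis by (rule power_less_imp_less_base) simp
  qed
  have nz: "of_real (2 * A) - h w \<noteq> 0" if "cmod w < \<rho>" for w
    using lt[OF that] norm_ge_zero[of "h w"] by (metis norm_zero not_le)
  define F where "F w = h (of_real \<rho> * w) / (of_real (2 * A) - h (of_real \<rho> * w))" for w
  let ?w = "z / of_real \<rho>"
  have w: "cmod ?w \<le> 1 / 2" using z \<rho> by (simp add: norm_divide field_simps)
  have inb: "cmod (of_real \<rho> * w) < \<rho>" if "cmod w < 1" for w
    using that \<rho> by (simp add: norm_mult)
  have hc: "(\<lambda>w. h (of_real \<rho> * w)) holomorphic_on ball 0 1"
    by (rule holomorphic_on_compose_gen[OF _ h, unfolded comp_def]) (use inb in \<open>auto intro!: holomorphic_intros\<close>)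
  have "cmod (F ?w) \<le> cmod ?w"
  proof (rule Schwarz_Lemma)
    show "F holomorphic_on ball 0 1"
      unfolding F_def[abs_def] using nz inb by (intro holomorphic_intros hc) auto
    show "F 0 = 0" by (simp add: F_def h0)
    show "cmod (F v) < 1" if v: "cmod v < 1" for v
      using lt[OF inb[OF v]] nz[OF inb[OF v]] by (simp add: F_def norm_divide divide_less_eq)
    show "cmod ?w < 1" using w by simp
  qed
  then have le: "cmod (F ?w) \<le> 1 / 2" using w by linarith
  have eq: "F ?w = h z / (of_real (2 * A) - h z)" using \<rho> by (simp add: F_def)
  have zr: "cmod z < \<rho>" using z \<rho> by simp
  have pos: "0 < cmod (of_real (2 * A) - h z)" using nz[OF zr] by simp
  have "cmod (h z) / cmod (of_real (2 * A) - h z) \<le> 1 / 2" using le unfolding eq norm_divide .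
  then have "cmod (h z) \<le> cmod (of_real (2 * A) - h z) / 2" using pos by (simp add: field_simps)
  also have "\<dots> \<le> (cmod (of_real (2 * A)) + cmod (h z)) / 2"
    by (intro divide_right_mono norm_triangle_ineq4) simp
  also have "cmod (of_real (2 * A)) = 2 * A" unfolding norm_of_real using A by simp
  finally show ?thesis by simp
qed

text \<open>Cauchy's inequalities on the circle of radius \<open>\<rho> / 2\<close> bound the \<open>k\<close>-th coefficient by \<open>2 A (2 / \<rho>)\<^sup>k\<close>; for \<open>\<rho> \<ge> 4\<close> the
  geometric series at most doubles the first term.\<close>

lemma taylor_tail_bound:
  assumes sums: "\<And>z. cmod z < \<rho> \<Longrightarrow> (\<lambda>k. b k * z ^ k) sums h z"
    and \<rho>: "4 \<le> \<rho>" and b0: "b 0 = 0"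
    and re: "\<And>z. cmod z < \<rho> \<Longrightarrow> Re (h z) < A"
  shows "cmod (\<Sum>k. b (k + m)) \<le> 4 * A * (2 / \<rho>) ^ m"
proof -
  define F where "F = Abs_fps b"
  have rad: "fps_conv_radius F \<ge> \<rho>"
    unfolding fps_conv_radius_def F_def fps_nth_Abs_fps
    by (rule conv_radius_geI_ex') (auto intro!: sums_summable[OF sums])
  have ev: "eval_fps F z = h z" if "cmod z < \<rho>" for z
    using sums[OF that] by (simp add: eval_fps_def F_def sums_iff)
  have "eval_fps F holomorphic_on ball 0 \<rho>"
    by (rule holomorphic_on_subset[OF holomorphic_on_eval_fps[OF order_refl]])
      (auto simp: in_eball_iff intro!: less_le_trans[OF _ rad])
  then have hol: "h holomorphic_on ball 0 \<rho>"
    by (rule holomorphic_transform) (simp add: ev)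
  have exp: "h has_fps_expansion F"
  proof -
    have "\<forall>\<^sub>F z in nhds 0. z \<in> ball (0::complex) \<rho>"
      using \<rho> by (intro eventually_nhds_in_open) auto
    then have "\<forall>\<^sub>F z in nhds 0. eval_fps F z = h z"
      by (rule eventually_mono) (simp add: ev)
    moreover have "fps_conv_radius F > 0" using rad \<rho> by (intro less_le_trans[OF _ rad]) simp
    ultimately show ?thesis by (simp add: has_fps_expansion_def)
  qed
  have h0: "h 0 = 0" using ev[of 0] \<rho> b0 by (simp add: eval_fps_at_0 F_def)
  have A: "0 < A" using re[of 0] h0 \<rho> by simp
  let ?s = "\<rho> / 2"
  have bk: "cmod (b k) \<le> 2 * A * (2 / \<rho>) ^ k" for k
  proof -
    have "cmod ((deriv ^^ k) h 0) \<le> fact k * (2 * A) / ?s ^ k"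
    proof (rule Cauchy_inequality)
      show "h holomorphic_on ball 0 ?s" by (rule holomorphic_on_subset[OF hol]) (use \<rho> in auto)
      show "continuous_on (cball 0 ?s) h"
        by (rule continuous_on_subset[OF holomorphic_on_imp_continuous_on[OF hol]]) (use \<rho> in auto)
      show "cmod (h x) \<le> 2 * A" if "cmod (0 - x) = ?s" for x
        using that \<rho> by (intro borel_caratheodory_half[OF hol _ h0 re]) auto
    qed (use \<rho> in auto)
    note le = this
    have "b k = (deriv ^^ k) h 0 / fact k"
      using fps_nth_fps_expansion[OF exp, of k] by (simp add: F_def)
    then have "cmod (b k) = cmod ((deriv ^^ k) h 0) / fact k" by (simp add: norm_divide)
    also have "\<dots> \<le> (fact k * (2 * A) / ?s ^ k) / fact k" by (rule divide_right_mono[OF le]) simp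
    also have "\<dots> = 2 * A * (2 / \<rho>) ^ k" by (simp add: power_divide)
    finally show ?thesis .
  qed
  let ?g = "\<lambda>k. (2 * A * (2 / \<rho>) ^ m) * (2 / \<rho>) ^ k"
  have q: "2 / \<rho> \<le> 1 / 2" "0 \<le> 2 / \<rho>" using \<rho> by (simp_all add: field_simps)
  have sg: "?g sums ((2 * A * (2 / \<rho>) ^ m) * (1 / (1 - 2 / \<rho>)))"
    by (intro sums_mult geometric_sums) (use q in simp)
  have "cmod (\<Sum>k. b (k + m)) \<le> suminf ?g"
  proof (rule norm_suminf_le)
    show "cmod (b (k + m)) \<le> ?g k" for k
      using bk[of "k + m"] by (simp add: power_add mult_ac)
  qed (use sg in \<open>simp add: sums_iff\<close>)
  also have "suminf ?g = (2 * A * (2 / \<rho>) ^ m) * (1 / (1 - 2 / \<rho>))" using sg by (simp add: sums_iff)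
  also have "\<dots> \<le> (2 * A * (2 / \<rho>) ^ m) * 2"
    using q A \<rho> by (intro mult_left_mono) (auto simp: field_simps)
  finally show ?thesis by (simp add: mult_ac)
qed

text \<open>The logarithm \<open>h\<close> of the bounded function differs from the logarithm of the regularized product by a
  polynomial of degree less than \<open>m\<close>, and the latter logarithm starts at order \<open>m\<close>. So its value at 1 is the
  Taylor remainder of \<open>h\<close> of order \<open>m\<close>, whatever the polynomial \<open>q\<close> is.\<close>

lemma regularized_product_bound:
  assumes small: "\<And>\<nu>. \<nu> \<in> set \<nu>s \<Longrightarrow> cmod \<nu> * \<rho> \<le> 1" and \<rho>: "4 \<le> \<rho>" and m: "1 \<le> m"
    and bound: "\<And>z. cmod z < \<rho> \<Longrightarrow> cmod (exp (\<Sum>k = 1..<m. q k * z ^ k) * (\<Prod>\<nu>\<leftarrow>\<nu>s. 1 - z * \<nu>)) < exp A"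
  shows "cmod ((\<Prod>\<nu>\<leftarrow>\<nu>s. 1 - \<nu>) * exp (\<Sum>k = 1..<m. 1 / of_nat k * (\<Sum>\<nu>\<leftarrow>\<nu>s. \<nu> ^ k))) \<le> exp (4 * A * (2 / \<rho>) ^ m)"
proof -
  define b where "b k = (if 1 \<le> k \<and> k < m then q k else 0) - (\<Sum>\<nu>\<leftarrow>\<nu>s. \<nu> ^ k) / of_nat k" for k
  define h where "h z = (\<Sum>k = 1..<m. q k * z ^ k) + (\<Sum>\<nu>\<leftarrow>\<nu>s. Ln (1 - z * \<nu>))" for z
  have lt: "cmod (z * \<nu>) < 1" if "cmod z < \<rho>" "\<nu> \<in> set \<nu>s" for z \<nu>
  proof (cases "\<nu> = 0")
    case False
    then have "cmod z * cmod \<nu> < \<rho> * cmod \<nu>" using that by (intro mult_strict_right_mono) auto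
    then show ?thesis using small[OF that(2)] by (simp add: norm_mult mult.commute)
  qed simp
  have Ln_sums: "(\<lambda>k. - ((\<Sum>\<nu>\<leftarrow>xs. \<nu> ^ k) / of_nat k) * z ^ k) sums (\<Sum>\<nu>\<leftarrow>xs. Ln (1 - z * \<nu>))"
    if "cmod z < \<rho>" "set xs \<subseteq> set \<nu>s" for z xs
    using that(2)
  proof (induction xs)
    case (Cons \<nu> xs)
    have "(\<lambda>k. - ((z * \<nu>) ^ k) / of_nat k) sums Ln (1 - z * \<nu>)"
      using Ln_series'[of "- (z * \<nu>)"] lt[OF that(1), of \<nu>] Cons.prems by simp
    from sums_add[OF this Cons.IH] show ?case
      using Cons.prems by (simp add: power_mult_distrib field_simps add_divide_distrib)
  qed simp
  have poly_sums: "(\<lambda>k. (if 1 \<le> k \<and> k < m then q k else 0) * z ^ k) sums (\<Sum>k = 1..<m. q k * z ^ k)" for z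
  proof -
    have "(\<lambda>k. (if 1 \<le> k \<and> k < m then q k else 0) * z ^ k) sums (\<Sum>k\<in>{1..<m}. (if 1 \<le> k \<and> k < m then q k else 0) * z ^ k)"
      by (rule sums_finite) auto
    also have "(\<Sum>k\<in>{1..<m}. (if 1 \<le> k \<and> k < m then q k else 0) * z ^ k) = (\<Sum>k = 1..<m. q k * z ^ k)"
      by (intro sum.cong) auto
    finally show ?thesis .
  qed
  have sums: "(\<lambda>k. b k * z ^ k) sums h z" if "cmod z < \<rho>" for z
    using sums_add[OF poly_sums[of z] Ln_sums[OF that order_refl]]
    by (simp add: b_def h_def algebra_simps)
  have exp_Ln: "exp (\<Sum>\<nu>\<leftarrow>xs. Ln (1 - z * \<nu>)) = (\<Prod>\<nu>\<leftarrow>xs. 1 - z * \<nu>)" if "cmod z < \<rho>" "set xs \<subseteq> set \<nu>s" for z xs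
    using that(2)
  proof (induction xs)
    case (Cons \<nu> xs)
    have "z * \<nu> \<noteq> 1" using lt[OF that(1), of \<nu>] Cons.prems by auto
    then show ?case using Cons by (simp add: exp_add)
  qed simp
  have re: "Re (h z) < A" if "cmod z < \<rho>" for z
  proof -
    have "exp (Re (h z)) = cmod (exp (h z))" by simp
    also have "exp (h z) = exp (\<Sum>k = 1..<m. q k * z ^ k) * (\<Prod>\<nu>\<leftarrow>\<nu>s. 1 - z * \<nu>)"
      by (simp add: h_def exp_add exp_Ln[OF that order_refl])
    finally have "exp (Re (h z)) < exp A" using bound[OF that] by simp
    then show ?thesis by simp
  qed
  have b0: "b 0 = 0" by (simp add: b_def)
  have tail: "cmod (\<Sum>k. b (k + m)) \<le> 4 * A * (2 / \<rho>) ^ m"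
    by (rule taylor_tail_bound[OF sums \<rho> b0 re])
  let ?c = "\<lambda>k. - ((\<Sum>\<nu>\<leftarrow>\<nu>s. \<nu> ^ k) / of_nat k)"
  have "?c sums (\<Sum>\<nu>\<leftarrow>\<nu>s. Ln (1 - \<nu>))" using Ln_sums[of 1 \<nu>s] \<rho> by simp
  then have "(\<lambda>k. ?c (k + m)) sums ((\<Sum>\<nu>\<leftarrow>\<nu>s. Ln (1 - \<nu>)) - (\<Sum>k<m. ?c k))"
    by (rule sums_split_initial_segment)
  moreover have "?c (k + m) = b (k + m)" for k by (simp add: b_def)
  ultimately have "(\<Sum>k. b (k + m)) = (\<Sum>\<nu>\<leftarrow>\<nu>s. Ln (1 - \<nu>)) - (\<Sum>k<m. ?c k)" by (simp add: sums_iff)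
  also have "(\<Sum>k<m. ?c k) = (\<Sum>k = 1..<m. ?c k)"
    by (rule sum.mono_neutral_right) auto
  also have "(\<Sum>\<nu>\<leftarrow>\<nu>s. Ln (1 - \<nu>)) - (\<Sum>k = 1..<m. ?c k) = (\<Sum>\<nu>\<leftarrow>\<nu>s. Ln (1 - \<nu>)) + (\<Sum>k = 1..<m. 1 / of_nat k * (\<Sum>\<nu>\<leftarrow>\<nu>s. \<nu> ^ k))"
    by (simp add: sum_negf)
  finally have "exp (\<Sum>k. b (k + m)) = (\<Prod>\<nu>\<leftarrow>\<nu>s. 1 - \<nu>) * exp (\<Sum>k = 1..<m. 1 / of_nat k * (\<Sum>\<nu>\<leftarrow>\<nu>s. \<nu> ^ k))"
    using exp_Ln[of 1 \<nu>s] \<rho> by (simp add: exp_add)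
  then have "cmod ((\<Prod>\<nu>\<leftarrow>\<nu>s. 1 - \<nu>) * exp (\<Sum>k = 1..<m. 1 / of_nat k * (\<Sum>\<nu>\<leftarrow>\<nu>s. \<nu> ^ k))) \<le> exp (cmod (\<Sum>k. b (k + m)))"
    by (metis norm_exp)
  also have "\<dots> \<le> exp (4 * A * (2 / \<rho>) ^ m)" using tail by simp
  finally show ?thesis .
qed

section \<open>Regularized determinants of finite rank operators\<close>

lemma op_power_scaleC:
  "F \<in> bounded_ops \<Longrightarrow> op_power (c *\<^sub>C F) k = c ^ k *\<^sub>C op_power F k"
proof (induction k)
  case 0
  then show ?case by (simp add: scaleC_one)
next
  case (Suc k)
  then show ?case
    by (intro blinfun_eqI) (simp add: scaleC_blinfun.rep_eq bopsD scaleC_scaleC)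
qed

lemma fr_det_reg_list:
  assumes F: "F \<in> finite_rank_ops"
    and det: "\<forall>w. fr_det (w *\<^sub>C F) = (\<Prod>\<nu>\<leftarrow>\<nu>s. 1 - w * \<nu>)"
    and tr: "\<forall>k>0. fr_trace (op_power F k) = (\<Sum>\<nu>\<leftarrow>\<nu>s. \<nu> ^ k)"
  shows "fr_det_reg p (w *\<^sub>C F) = (\<Prod>\<nu>\<leftarrow>\<nu>s. 1 - w * \<nu>) *
    exp (\<Sum>k = 1..<nat \<lceil>p\<rceil>. (1 / of_nat k * (\<Sum>\<nu>\<leftarrow>\<nu>s. \<nu> ^ k)) * w ^ k)"
proof -
  have "fr_trace (op_power (w *\<^sub>C F) k) = w ^ k * (\<Sum>\<nu>\<leftarrow>\<nu>s. \<nu> ^ k)" if "0 < k" for k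
    using F tr that by (simp add: op_power_scaleC fr_trace_scaleC)
  then show ?thesis unfolding fr_det_reg_def using det by (simp add: mult_ac)
qed

text \<open>Telescoping: \<open>Z\<^sup>k\<^sup>+\<^sup>1 - X\<^sup>k\<^sup>+\<^sup>1 = Z (Z\<^sup>k - X\<^sup>k) + (Z - X) X\<^sup>k\<close>. Every term contains one factor \<open>z G\<close>, whose
  trace is under control.\<close>

lemma trace_power_difference_bound:
  assumes X: "X \<in> finite_rank_ops" and Z: "Z \<in> finite_rank_ops" and G: "G \<in> finite_rank_ops"
    and ZX: "Z - X = z *\<^sub>C G" and c: "0 \<le> c"
    and bound: "\<forall>B\<in>bounded_ops. \<forall>C\<in>bounded_ops. cmod (fr_trace (B o\<^sub>L G o\<^sub>L C)) \<le> c * norm B * norm C"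
    and \<rho>: "norm Z \<le> \<rho>" "norm X \<le> \<rho>" and B: "B \<in> bounded_ops"
  shows "cmod (fr_trace (B o\<^sub>L (op_power Z k - op_power X k))) \<le> real k * (c * cmod z) * norm B * \<rho> ^ (k - 1)"
  using B
proof (induction k arbitrary: B)
  case 0
  show ?case by simp
next
  case (Suc k)
  have \<rho>0: "0 \<le> \<rho>" using \<rho>(1) norm_ge_zero order_trans by blast
  let ?D = "op_power Z k - op_power X k"
  have D: "?D \<in> finite_rank_ops" using X Z by (cases k) auto
  have b: "X \<in> bounded_ops" "Z \<in> bounded_ops" "G \<in> bounded_ops" using X Z G by auto
  have zx: "blinfun_apply Z x = blinfun_apply X x + z *\<^sub>C blinfun_apply G x" for x
    using arg_cong[OF ZX, of "\<lambda>T. blinfun_apply T x"] by (simp add: op_apply algebra_simps)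
  have e: "B o\<^sub>L (op_power Z (Suc k) - op_power X (Suc k)) = ((B o\<^sub>L Z) o\<^sub>L ?D) + z *\<^sub>C (B o\<^sub>L G o\<^sub>L op_power X k)"
  proof (rule blinfun_eqI)
    fix x
    show "blinfun_apply (B o\<^sub>L (op_power Z (Suc k) - op_power X (Suc k))) x
      = blinfun_apply (((B o\<^sub>L Z) o\<^sub>L ?D) + z *\<^sub>C (B o\<^sub>L G o\<^sub>L op_power X k)) x"
      by (simp add: blinfun.diff_left blinfun.add_left blinfun.diff_right scaleC_blinfun.rep_eq zx
        blinfun.add_right bopsD[OF Suc.prems])
  qed
  have BZ: "norm (B o\<^sub>L Z) \<le> norm B * \<rho>"
    using norm_blinfun_compose[of B Z] mult_left_mono[OF \<rho>(1), of "norm B"] by simp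
  have nX: "norm (op_power X k) \<le> \<rho> ^ k"
    using norm_op_power[of X k] power_mono[OF \<rho>(2), of k] by simp
  have "fr_trace (B o\<^sub>L (op_power Z (Suc k) - op_power X (Suc k)))
      = fr_trace ((B o\<^sub>L Z) o\<^sub>L ?D) + z * fr_trace (B o\<^sub>L G o\<^sub>L op_power X k)"
    unfolding e using Suc.prems b D G by (simp add: fr_trace_add fr_trace_scaleC)
  also have "cmod \<dots> \<le> cmod (fr_trace ((B o\<^sub>L Z) o\<^sub>L ?D)) + cmod z * cmod (fr_trace (B o\<^sub>L G o\<^sub>L op_power X k))"
    by (rule order_trans[OF norm_triangle_ineq]) (simp add: norm_mult)
  also have "\<dots> \<le> real k * (c * cmod z) * norm B * \<rho> ^ k + c * cmod z * norm B * \<rho> ^ k"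
  proof (rule add_mono)
    show "cmod (fr_trace ((B o\<^sub>L Z) o\<^sub>L ?D)) \<le> real k * (c * cmod z) * norm B * \<rho> ^ k"
    proof (cases k)
      case 0
      then show ?thesis by simp
    next
      case (Suc l)
      have "cmod (fr_trace ((B o\<^sub>L Z) o\<^sub>L ?D)) \<le> real k * (c * cmod z) * norm (B o\<^sub>L Z) * \<rho> ^ (k - 1)"
        by (rule Suc.IH) (use \<open>B \<in> bounded_ops\<close> b in auto)
      also have "\<dots> \<le> real k * (c * cmod z) * (norm B * \<rho>) * \<rho> ^ (k - 1)"
        using BZ c \<rho>0 by (intro mult_right_mono mult_left_mono) auto
      also have "\<dots> = real k * (c * cmod z) * norm B * \<rho> ^ k" using Suc by simp
      finally show ?thesis .
    qed
    have "cmod (fr_trace (B o\<^sub>L G o\<^sub>L op_power X k)) \<le> c * norm B * norm (op_power X k)"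
      using bound Suc.prems b by auto
    also have "\<dots> \<le> c * norm B * \<rho> ^ k" using nX c by (intro mult_left_mono) auto
    finally show "cmod z * cmod (fr_trace (B o\<^sub>L G o\<^sub>L op_power X k)) \<le> c * cmod z * norm B * \<rho> ^ k"
      using mult_left_mono[of _ _ "cmod z"] by (fastforce simp: mult_ac)
  qed
  also have "\<dots> = real (Suc k) * (c * cmod z) * norm B * \<rho> ^ (Suc k - 1)" by (simp add: algebra_simps)
  finally show ?case .
qed

lemma gen_eigenspace_dim_mono:
  assumes "gen_eigenspace T \<mu> \<subseteq> gen_eigenspace T' \<mu>" "T \<in> bounded_ops" "T' \<in> bounded_ops" "fin_dim (gen_eigenspace T' \<mu>)"
  shows "complex_vector.dim (gen_eigenspace T \<mu>) \<le> complex_vector.dim (gen_eigenspace T' \<mu>)"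
proof -
  obtain b where b: "is_basis b (gen_eigenspace T \<mu>)"
    using basis_ex[OF gen_eigenspace_subspace[OF assms(2)] fin_dim_subset[OF assms(4,1)]] by blast
  obtain c where "is_basis (b @ c) (gen_eigenspace T' \<mu>)"
    using basis_extend[OF b assms(1) gen_eigenspace_subspace[OF assms(3)] assms(4)] by blast
  then show ?thesis using is_basis_length[OF b] is_basis_length by fastforce
qed

lemma powr_sum_le:
  fixes x y p :: real
  assumes "0 \<le> x" "0 \<le> y" "0 < p"
  shows "(x + y) powr p \<le> 2 powr p * (x powr p + y powr p)"
proof -
  have "(x + y) powr p \<le> (2 * max x y) powr p" using assms by (intro powr_mono2) auto
  also have "\<dots> = 2 powr p * max x y powr p" using assms by (simp add: powr_mult)
  also have "max x y powr p \<le> x powr p + y powr p" by (simp add: max_def)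
  finally show ?thesis by (simp add: mult_left_mono)
qed

text \<open>Collects the terms that are negligible in the growth estimate for determinants.\<close>

lemma eventually_lower_order:
  fixes p \<kappa> :: real
  assumes p: "0 < p" and a: "a < p" and \<kappa>: "0 < \<kappa>"
  shows "\<forall>\<^sub>F r in at_top. g * ln r + c * r powr a + d \<le> \<kappa> * r powr p"
proof -
  have l1: "((\<lambda>r. ln r / r powr p) \<longlongrightarrow> 0) at_top" using p by real_asymp
  have l2: "((\<lambda>r. r powr (a - p)) \<longlongrightarrow> 0) at_top" by (rule tendsto_neg_powr) (use a filterlim_ident in auto)
  have l3: "((\<lambda>r. r powr (- p)) \<longlongrightarrow> 0) at_top" by (rule tendsto_neg_powr) (use p filterlim_ident in auto)
  have "((\<lambda>r. g * (ln r / r powr p) + c * r powr (a - p) + d * r powr (- p)) \<longlongrightarrow> g * 0 + c * 0 + d * 0) at_top"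
    by (intro tendsto_intros l1 l2 l3)
  then have "\<forall>\<^sub>F r in at_top. g * (ln r / r powr p) + c * r powr (a - p) + d * r powr (- p) < \<kappa>"
    using \<kappa> by (intro order_tendstoD) auto
  then show ?thesis using eventually_gt_at_top[of 0]
  proof eventually_elim
    case (elim r)
    have r: "0 < r powr p" using elim by simp
    have "g * ln r + c * r powr a + d = (g * (ln r / r powr p) + c * r powr (a - p) + d * r powr (- p)) * r powr p"
      using elim(2) r by (simp add: powr_diff powr_minus field_simps)
    also have "\<dots> \<le> \<kappa> * r powr p" using elim r by (intro mult_right_mono) auto
    finally show ?case .
  qed
qed

section \<open>Determinant estimates in an \<open>l\<^sub>p\<close>-ideal\<close>

locale det_ideal = lp_ideal p \<I> N \<gamma>
  for p :: real and \<I> :: "('a::complex_banach \<Rightarrow>\<^sub>L 'a) set" and N \<gamma> +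
  fixes \<Gamma> :: real
  assumes p: "0 < p" and \<Gamma>: "0 < \<Gamma>"
    and det_bound: "F \<in> (finite_rank_ops :: ('a \<Rightarrow>\<^sub>L 'a) set) \<Longrightarrow> cmod (fr_det_reg p F) \<le>
      exp (\<Gamma> * (\<Sum>\<^sub>\<infinity>\<mu> \<in> discrete_eigenvalues F. real (alg_mult F \<mu>) * cmod \<mu> powr p))"
begin

definition eig_sum :: "('a \<Rightarrow>\<^sub>L 'a) \<Rightarrow> real"
  where "eig_sum L = (\<Sum>\<^sub>\<infinity>\<mu> \<in> discrete_eigenvalues L. real (alg_mult L \<mu>) * cmod \<mu> powr p)"

definition det_type :: real
  where "det_type = \<Gamma> * \<gamma> powr p"

lemma det_type_nonneg: "0 \<le> det_type"
  using \<Gamma> by (simp add: det_type_def)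

lemma ideal_subspace: "complex_vector.subspace \<I>"
  using quasi_norm by (simp add: quasi_norm_on_def)

lemma N_nonneg: "L \<in> \<I> \<Longrightarrow> 0 \<le> N L"
  using quasi_norm by (simp add: quasi_norm_on_def)

lemma N_zero: "L \<in> \<I> \<Longrightarrow> N L = 0 \<longleftrightarrow> L = 0"
  using quasi_norm by (simp add: quasi_norm_on_def)

lemma N_scale: "L \<in> \<I> \<Longrightarrow> N (c *\<^sub>C L) = cmod c * N L"
  using quasi_norm by (simp add: quasi_norm_on_def)

lemma N_minus_commute: "L \<in> \<I> \<Longrightarrow> M \<in> \<I> \<Longrightarrow> N (L - M) = N (M - L)"
  using N_scale[of "L - M" "-1"] complex_vector.subspace_diff[OF ideal_subspace, of L M]
  by (simp add: scaleC_one)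

lemma quasi_triangle:
  obtains q where "1 \<le> q" "\<And>x y. x \<in> \<I> \<Longrightarrow> y \<in> \<I> \<Longrightarrow> N (x + y) \<le> q * (N x + N y)"
proof -
  have "\<exists>q\<ge>1. \<forall>x\<in>\<I>. \<forall>y\<in>\<I>. N (x + y) \<le> q * (N x + N y)"
    using quasi_norm by (simp add: quasi_norm_on_def)
  then show ?thesis using that by (elim exE conjE) simp
qed

lemma ideal_closed:
  "L \<in> \<I> \<Longrightarrow> M \<in> \<I> \<Longrightarrow> L + M \<in> \<I>" "L \<in> \<I> \<Longrightarrow> M \<in> \<I> \<Longrightarrow> L - M \<in> \<I>" "L \<in> \<I> \<Longrightarrow> c *\<^sub>C L \<in> \<I>"
  by (rule complex_vector.subspace_add[OF ideal_subspace] complex_vector.subspace_diff[OF ideal_subspace]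
    complex_vector.subspace_scale[OF ideal_subspace]; assumption)+

lemma ideal_bops: "L \<in> \<I> \<Longrightarrow> L \<in> bounded_ops"
  using subset_bounded_ops by blast

lemma ideal_finite_rank: "F \<in> finite_rank_ops \<Longrightarrow> F \<in> \<I>"
  using finite_rank_subset by blast

lemma ideal_comp_right:
  assumes "L \<in> \<I>" "B \<in> bounded_ops"
  shows "L o\<^sub>L B \<in> \<I>" "N (L o\<^sub>L B) \<le> N L * norm B"
proof -
  have e: "id_blinfun o\<^sub>L L o\<^sub>L B = L o\<^sub>L B" by (rule blinfun_eqI) simp
  show "L o\<^sub>L B \<in> \<I>" using ideal[OF assms(1) bops_id assms(2)] e by simp
  have "N (L o\<^sub>L B) \<le> norm (id_blinfun :: 'a \<Rightarrow>\<^sub>L 'a) * N L * norm B"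
    using ideal_norm[OF assms(1) bops_id assms(2)] e by simp
  also have "\<dots> \<le> 1 * N L * norm B"
    using N_nonneg[OF assms(1)] norm_blinfun_id_le by (intro mult_right_mono) auto
  finally show "N (L o\<^sub>L B) \<le> N L * norm B" by simp
qed

lemma eig_sum_nonneg: "0 \<le> eig_sum L"
  unfolding eig_sum_def by (rule infsum_nonneg) simp

lemma eig_sum_le: "L \<in> \<I> \<Longrightarrow> eig_sum L \<le> \<gamma> powr p * N L powr p"
proof -
  assume L: "L \<in> \<I>"
  have le: "eig_sum L powr (1 / p) \<le> \<gamma> * N L"
    using eigenvalue_constant[OF L] by (simp add: eig_sum_def)
  have "eig_sum L = (eig_sum L powr (1 / p)) powr p"
    using p eig_sum_nonneg by (simp add: powr_powr)
  also have "\<dots> \<le> (\<gamma> * N L) powr p" using le p by (intro powr_mono2) auto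
  also have "\<dots> = \<gamma> powr p * N L powr p"
  proof (cases "N L = 0")
    case True
    then show ?thesis by simp
  next
    case False
    then have "0 < N L" using N_nonneg[OF L] by simp
    moreover have "0 \<le> \<gamma> * N L" using le by (rule order_trans[OF powr_ge_zero])
    ultimately have "0 \<le> \<gamma>" by (simp add: zero_le_mult_iff)
    then show ?thesis using \<open>0 < N L\<close> by (simp add: powr_mult)
  qed
  finally show ?thesis .
qed

lemma det_le: "F \<in> finite_rank_ops \<Longrightarrow> cmod (fr_det_reg p F) \<le> exp (det_type * N F powr p)"
proof -
  assume F: "F \<in> finite_rank_ops"
  have "cmod (fr_det_reg p F) \<le> exp (\<Gamma> * eig_sum F)" using det_bound[OF F] by (simp add: eig_sum_def)
  also have "\<dots> \<le> exp (det_type * N F powr p)"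
    using mult_left_mono[OF eig_sum_le[OF ideal_finite_rank[OF F]], of \<Gamma>] \<Gamma> by (simp add: det_type_def mult.assoc)
  finally show ?thesis .
qed

text \<open>The ball of radius \<open>e\<close> about \<open>L\<close> need not be open for a quasi-norm, but the set \<open>U\<close> of its interior points is, by
  the quasi-triangle inequality, and it contains \<open>L\<close>.\<close>

lemma finite_rank_approximation:
  assumes L: "L \<in> \<I>" and e: "0 < e"
  shows "\<exists>F\<in>finite_rank_ops. N (F - L) < e"
proof -
  obtain q where q: "1 \<le> q" "\<And>x y. x \<in> \<I> \<Longrightarrow> y \<in> \<I> \<Longrightarrow> N (x + y) \<le> q * (N x + N y)"
    using quasi_triangle by blast
  define U where "U = {x \<in> \<I>. \<exists>n\<ge>1. {y \<in> \<I>. N (y - x) \<le> 1 / real n} \<subseteq> {y \<in> \<I>. N (y - L) < e}}"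
  have "openin (quasi_norm_topology \<I> N) U"
    unfolding openin_quasi_norm_topology
  proof (intro conjI ballI)
    fix x assume "x \<in> U"
    then obtain n where x: "x \<in> \<I>" and n: "n \<ge> 1" and sub: "{y \<in> \<I>. N (y - x) \<le> 1 / real n} \<subseteq> {y \<in> \<I>. N (y - L) < e}"
      by (auto simp: U_def)
    obtain k :: nat where k: "2 * q * real n \<le> real k" using real_arch_simple by blast
    have kpos: "0 < real k" using k q(1) n by (smt (verit) mult_pos_pos of_nat_0_less_iff One_nat_def Suc_le_eq)
    have le: "q * (1 / real k + 1 / real k) \<le> 1 / real n"
      using k kpos n q(1) by (simp add: field_simps)
    have "{y \<in> \<I>. N (y - x) \<le> 1 / real k} \<subseteq> U"
    proof
      fix y assume y: "y \<in> {y \<in> \<I>. N (y - x) \<le> 1 / real k}"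
      have "{w \<in> \<I>. N (w - y) \<le> 1 / real k} \<subseteq> {y \<in> \<I>. N (y - x) \<le> 1 / real n}"
      proof
        fix w assume w: "w \<in> {w \<in> \<I>. N (w - y) \<le> 1 / real k}"
        have "N ((w - y) + (y - x)) \<le> q * (N (w - y) + N (y - x))"
          using w y x by (intro q(2) ideal_closed) auto
        also have "\<dots> \<le> q * (1 / real k + 1 / real k)"
          using w y q(1) by (intro mult_left_mono add_mono) auto
        finally show "w \<in> {y \<in> \<I>. N (y - x) \<le> 1 / real n}" using le w by simp
      qed
      then show "y \<in> U" using sub y kpos unfolding U_def by (auto intro!: exI[of _ k])
    qed
    then show "\<exists>n\<ge>1. {y \<in> \<I>. N (y - x) \<le> 1 / real n} \<subseteq> U" using kpos by (intro exI[of _ k]) auto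
  qed (auto simp: U_def)
  moreover have "L \<in> U"
  proof -
    obtain n :: nat where n: "1 / e < real n" using reals_Archimedean2 by blast
    have "0 < 1 / e" using e by simp
    then have n0: "0 < real n" using n by linarith
    then have "1 / real n < e" using n e by (simp add: field_simps)
    then show ?thesis using L n0 unfolding U_def by (auto intro!: exI[of _ n])
  qed
  moreover have "L \<in> quasi_norm_topology \<I> N closure_of finite_rank_ops"
    using finite_rank_dense L by simp
  ultimately obtain F where F: "F \<in> finite_rank_ops" "F \<in> U" by (auto simp: in_closure_of)
  then obtain n :: nat where "n \<ge> 1" "{y \<in> \<I>. N (y - F) \<le> 1 / real n} \<subseteq> {y \<in> \<I>. N (y - L) < e}" "F \<in> \<I>"
    by (auto simp: U_def)
  moreover have "N (F - F) = 0" using N_zero[OF ideal_finite_rank[OF finite_rank_zero]] by simp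
  ultimately have "N (F - L) < e" by (auto simp: subset_iff)
  then show ?thesis using F(1) by blast
qed

lemma ideal_approximable: "L \<in> \<I> \<Longrightarrow> approximable L"
  unfolding approximable_def
proof (intro conjI allI impI)
  assume L: "L \<in> \<I>"
  then show "L \<in> bounded_ops" by (rule ideal_bops)
  fix e :: real assume "0 < e"
  then obtain F where F: "F \<in> finite_rank_ops" "N (F - L) < e" using finite_rank_approximation[OF L] by blast
  have "norm (L - F) \<le> N (F - L)"
    using norm_le[OF ideal_closed(2)[OF ideal_finite_rank[OF F(1)] L]] by (simp add: norm_minus_commute)
  then show "\<exists>F\<in>finite_rank_ops. norm (L - F) < e" using F by force
qed

text \<open>\<open>f(z) = det\<^sub>p (I - F - z (G - F))\<close> is entire and bounded on the disc of radius \<open>1 / N(G - F)\<close>, on which \<open>N\<close> of the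
  argument is at most \<open>q (a + 1)\<close>; Schwarz's lemma compares \<open>f(1)\<close> with \<open>f(0)\<close>.\<close>

lemma det_lipschitz:
  "\<exists>C\<ge>0. \<forall>F\<in>finite_rank_ops. \<forall>G\<in>finite_rank_ops. N F \<le> a \<longrightarrow> N (G - F) \<le> 1 / 2 \<longrightarrow>
    cmod (fr_det_reg p G - fr_det_reg p F) \<le> C * N (G - F)"
proof -
  obtain q where q: "1 \<le> q" "\<And>x y. x \<in> \<I> \<Longrightarrow> y \<in> \<I> \<Longrightarrow> N (x + y) \<le> q * (N x + N y)"
    using quasi_triangle by blast
  define B where "B = exp (det_type * (q * (a + 1)) powr p)"
  have "cmod (fr_det_reg p G - fr_det_reg p F) \<le> (2 * B + 1) * N (G - F)"
    if F: "F \<in> finite_rank_ops" "N F \<le> a" and G: "G \<in> finite_rank_ops" "N (G - F) \<le> 1 / 2" for F G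
  proof (cases "G = F")
    case True
    then show ?thesis using N_nonneg[OF ideal_finite_rank[OF finite_rank_zero]] by (simp add: B_def)
  next
    case False
    let ?D = "G - F"
    have D: "?D \<in> finite_rank_ops" using F G by simp
    then have DI: "?D \<in> \<I>" by (rule ideal_finite_rank)
    have ND: "0 < N ?D" using N_nonneg[OF DI] N_zero[OF DI] False by simp
    define f where "f z = fr_det_reg p (F + z *\<^sub>C ?D)" for z
    obtain u V where "holomorphic_family u V (\<lambda>z. F + z *\<^sub>C ?D) UNIV"
      using affine_holomorphic_family[OF F(1) D] by blast
    then have hol: "f holomorphic_on UNIV"
      unfolding f_def[abs_def] by (rule holomorphic_family.holomorphic_det_reg)
    have "cmod (f 1 - f 0) \<le> (2 * B + 1) / (1 / N ?D)"
    proof (rule bounded_holomorphic_difference[OF hol])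
      show "1 < 1 / N ?D" using ND G(2) by simp
      fix z assume z: "cmod z < 1 / N ?D"
      have "cmod z * N ?D \<le> 1" using z ND by (simp add: pos_less_divide_eq)
      then have NzD: "N (z *\<^sub>C ?D) \<le> 1" by (simp only: N_scale[OF DI])
      have "N (F + z *\<^sub>C ?D) \<le> q * (N F + N (z *\<^sub>C ?D))"
        by (intro q(2) ideal_finite_rank) (use F D in auto)
      also have "\<dots> \<le> q * (a + 1)"
        using F(2) NzD q(1) by (intro mult_left_mono add_mono) auto
      finally have "N (F + z *\<^sub>C ?D) powr p \<le> (q * (a + 1)) powr p"
        using p N_nonneg[OF ideal_finite_rank[of "F + z *\<^sub>C ?D"]] F D by (intro powr_mono2) auto
      then have "exp (det_type * N (F + z *\<^sub>C ?D) powr p) \<le> B"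
        unfolding B_def using det_type_nonneg by (simp add: mult_left_mono)
      then show "cmod (f z) \<le> B"
        using det_le[of "F + z *\<^sub>C ?D"] F D unfolding f_def by simp
    qed
    then show ?thesis by (simp add: f_def scaleC_one)
  qed
  moreover have "0 \<le> 2 * B + 1" by (simp add: B_def)
  ultimately show ?thesis by blast
qed

text \<open>Fix \<open>G\<close> of finite rank close to \<open>L\<close>. Every \<open>F\<close> close to \<open>L\<close> is \<open>G + W\<close> with \<open>N W\<close> small. As a function of a
  separate variable \<open>z\<close>, \<open>det (I - w W - z G)\<close> is a polynomial whose degree is at most the rank of \<open>G\<close>. On
  \<open>\<bar>z\<bar> = 1\<close> it is bounded by \<open>exp (c (\<bar>w\<bar> N W)\<^sup>p)\<close> up to lower order terms, so at \<open>z = w\<close> it is larger by a power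
  of \<open>\<bar>w\<bar>\<close> at most. The regularizing exponentials at \<open>z\<close> and at 0 differ by traces of terms that contain \<open>G\<close>,
  hence by the exponential of \<open>O(\<bar>w\<bar>\<^sup>m\<^sup>-\<^sup>1)\<close> with \<open>m - 1 < p\<close>.\<close>

lemma det_growth:
  assumes L: "L \<in> \<I>" and \<kappa>: "0 < \<kappa>"
  shows "\<exists>e>0. \<exists>r0\<ge>1. \<forall>F\<in>finite_rank_ops. N (F - L) \<le> e \<longrightarrow>
    (\<forall>w. r0 \<le> cmod w \<longrightarrow> cmod (fr_det_reg p (w *\<^sub>C F)) \<le> exp (\<kappa> * cmod w powr p))"
proof -
  obtain q where q: "1 \<le> q" "\<And>x y. x \<in> \<I> \<Longrightarrow> y \<in> \<I> \<Longrightarrow> N (x + y) \<le> q * (N x + N y)"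
    using quasi_triangle by blast
  define m where "m = nat \<lceil>p\<rceil>"
  have m: "1 \<le> m" "real (m - 1) < p" using p unfolding m_def by linarith+
  define c1 where "c1 = det_type * (q powr p * 2 powr p)"
  have c1: "0 \<le> c1" using det_type_nonneg by (simp add: c1_def)
  \<comment> \<open>The radius \<open>e2\<close> is so small that the leading term \<open>c1 (e2 r)\<^sup>p\<close> uses half of \<open>\<kappa>\<close>; the other half absorbs the lower order.\<close>
  define e2 where "e2 = min 1 ((\<kappa> / (2 * (c1 + 1))) powr (1 / p))"
  have e2: "0 < e2" "e2 \<le> 1" using \<kappa> c1 by (auto simp: e2_def)
  have c1e2: "c1 * e2 powr p \<le> \<kappa> / 2"
  proof -
    have "e2 powr p \<le> ((\<kappa> / (2 * (c1 + 1))) powr (1 / p)) powr p"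
      using e2 p by (intro powr_mono2) (auto simp: e2_def)
    also have "\<dots> = \<kappa> / (2 * (c1 + 1))" using p \<kappa> c1 by (simp add: powr_powr)
    finally have "c1 * e2 powr p \<le> c1 * (\<kappa> / (2 * (c1 + 1)))" using c1 by (intro mult_left_mono)
    also have "\<dots> \<le> (c1 + 1) * (\<kappa> / (2 * (c1 + 1)))" using \<kappa> c1 by (intro mult_right_mono) auto
    also have "\<dots> = \<kappa> / 2" using c1 by (simp add: field_simps)
    finally show ?thesis .
  qed
  define e1 where "e1 = e2 / (2 * q)"
  have e1: "0 < e1" using e2 q by (simp add: e1_def)
  obtain G where G: "G \<in> finite_rank_ops" "N (G - L) < e1" using finite_rank_approximation[OF L e1] by blast
  define g where "g = complex_vector.dim (range (blinfun_apply G))"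
  obtain c where c: "0 \<le> c" "\<forall>B\<in>bounded_ops. \<forall>C\<in>bounded_ops. cmod (fr_trace (B o\<^sub>L G o\<^sub>L C)) \<le> c * norm B * norm C"
    using fr_trace_sandwich_bound[OF G(1)] by blast
  define b where "b = 1 + norm G"
  have b: "1 \<le> b" by (simp add: b_def)
  \<comment> \<open>\<open>C2 r\<^sup>m\<^sup>-\<^sup>1\<close> bounds the effect of \<open>G\<close> on the traces in the regularizing exponent.\<close>
  define C2 where "C2 = real m * (c * b ^ (m - 1))"
  have C2: "0 \<le> C2" using c b by (simp add: C2_def)
  have "\<forall>\<^sub>F r in at_top. real g * ln r + (2 * C2) * r powr real (m - 1) + c1 * N G powr p \<le> (\<kappa> / 2) * r powr p"
    using \<kappa> by (intro eventually_lower_order[OF p m(2)]) simp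
  then obtain r1 where r1: "\<And>r. r1 \<le> r \<Longrightarrow> real g * ln r + (2 * C2) * r powr real (m - 1) + c1 * N G powr p \<le> (\<kappa> / 2) * r powr p"
    unfolding eventually_at_top_linorder by blast
  define r0 where "r0 = max 1 r1"
  have "cmod (fr_det_reg p (w *\<^sub>C F)) \<le> exp (\<kappa> * cmod w powr p)"
    if F: "F \<in> finite_rank_ops" "N (F - L) \<le> e1" and w: "r0 \<le> cmod w" for F w
  proof -
    define r where "r = cmod w"
    have r: "1 \<le> r" "r1 \<le> r" using w by (auto simp: r0_def r_def)
    define W where "W = F - G"
    have W: "W \<in> finite_rank_ops" using F G by (simp add: W_def)
    have NW: "N W \<le> e2"
    proof -
      have I: "F - L \<in> \<I>" "L - G \<in> \<I>"
        using ideal_closed(2)[OF ideal_finite_rank[OF F(1)] L] ideal_closed(2)[OF L ideal_finite_rank[OF G(1)]] by auto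
      have "N ((F - L) + (L - G)) \<le> q * (N (F - L) + N (L - G))" by (rule q(2)[OF I])
      also have "\<dots> \<le> q * (e1 + e1)"
        using F(2) G(2) q(1) N_minus_commute[OF L ideal_finite_rank[OF G(1)]] by (intro mult_left_mono add_mono) auto
      also have "\<dots> = e2" using q(1) by (simp add: e1_def)
      finally show ?thesis by (simp add: W_def)
    qed
    have nW: "norm W \<le> 1" using norm_le[OF ideal_finite_rank[OF W]] NW e2 by linarith
    define X where "X = w *\<^sub>C W"
    have X: "X \<in> finite_rank_ops" using W by (simp add: X_def)
    \<comment> \<open>\<open>\<rho>\<close> dominates the norms of \<open>X\<close> and of \<open>X + z G\<close> both for \<open>\<bar>z\<bar> = 1\<close> and for \<open>z = w\<close>.\<close>
    define \<rho> where "\<rho> = b * r"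
    have nX: "norm X \<le> r" using mult_left_mono[OF nW, of r] r by (simp add: X_def norm_scaleC r_def)
    have rr: "r \<le> \<rho>" "1 \<le> \<rho>" using b r mult_mono[of 1 b r r] mult_mono[of 1 b 1 r] by (auto simp: \<rho>_def)
    define T where "T z = (\<Sum>k = 1..<m. 1 / of_nat k * fr_trace (op_power (X + z *\<^sub>C G) k))" for z
    have Tdiff: "cmod (T z - T 0) \<le> C2 * r powr real (m - 1)" if z: "cmod z \<le> r" "cmod z = 1 \<or> cmod z = r" for z
    proof -
      have Z: "X + z *\<^sub>C G \<in> finite_rank_ops" using X G by simp
      have nZ: "norm (X + z *\<^sub>C G) \<le> \<rho>"
      proof -
        have "norm (X + z *\<^sub>C G) \<le> r + cmod z * norm G"
          using norm_triangle_ineq[of X "z *\<^sub>C G"] nX by (simp add: norm_scaleC)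
        also have "\<dots> \<le> r + r * norm G" using z by (simp add: mult_right_mono)
        finally show ?thesis by (simp add: \<rho>_def b_def algebra_simps)
      qed
      have summand: "cmod (1 / of_nat k * fr_trace (op_power (X + z *\<^sub>C G) k) - 1 / of_nat k * fr_trace (op_power X k))
          \<le> c * b ^ (m - 1) * r powr real (m - 1)" if k: "k \<in> {1..<m}" for k
      proof -
        have k0: "0 < k" using k by simp
        have "fr_trace (op_power (X + z *\<^sub>C G) k) - fr_trace (op_power X k) = fr_trace (id_blinfun o\<^sub>L (op_power (X + z *\<^sub>C G) k - op_power X k))"
        proof -
          have "id_blinfun o\<^sub>L (op_power (X + z *\<^sub>C G) k - op_power X k) = op_power (X + z *\<^sub>C G) k - op_power X k"
            by (rule blinfun_eqI) simp
          then show ?thesis using X Z k0 by (simp only: fr_trace_diff finite_rank_power)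
        qed
        also have "cmod \<dots> \<le> real k * (c * cmod z) * norm (id_blinfun :: 'a \<Rightarrow>\<^sub>L 'a) * \<rho> ^ (k - 1)"
          by (rule trace_power_difference_bound[OF X Z G(1) _ c nZ]) (use nX rr in auto)
        also have "\<dots> \<le> real k * (c * cmod z) * 1 * \<rho> ^ (k - 1)"
          using c rr norm_blinfun_id_le by (intro mult_right_mono mult_left_mono) auto
        also have "\<dots> \<le> real k * (c * \<rho>) * 1 * \<rho> ^ (k - 1)"
          using c rr z by (intro mult_right_mono mult_left_mono) auto
        also have "\<dots> = real k * (c * \<rho> ^ k)" using k0 by (cases k) auto
        also have "\<dots> \<le> real k * (c * \<rho> ^ (m - 1))"
          using c rr k by (intro mult_left_mono power_increasing) auto
        also have "\<rho> ^ (m - 1) = b ^ (m - 1) * r powr real (m - 1)"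
          using r by (simp add: \<rho>_def power_mult_distrib powr_realpow)
        finally have "cmod (fr_trace (op_power (X + z *\<^sub>C G) k) - fr_trace (op_power X k)) / real k \<le> c * b ^ (m - 1) * r powr real (m - 1)"
          using k0 by (simp add: field_simps)
        then show ?thesis by (simp add: right_diff_distrib[symmetric] norm_mult norm_divide norm_inverse divide_inverse mult.commute)
      qed
      have "T z - T 0 = (\<Sum>k = 1..<m. 1 / of_nat k * fr_trace (op_power (X + z *\<^sub>C G) k) - 1 / of_nat k * fr_trace (op_power X k))"
        by (simp add: T_def sum_subtractf)
      also have "cmod \<dots> \<le> (\<Sum>k = 1..<m. c * b ^ (m - 1) * r powr real (m - 1))"
        by (rule sum_norm_le[OF summand])
      also have "\<dots> = real (m - 1) * (c * b ^ (m - 1) * r powr real (m - 1))"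
        by (simp only: sum_constant card_atLeastLessThan)
      also have "\<dots> \<le> real m * (c * b ^ (m - 1) * r powr real (m - 1))"
        using c b by (intro mult_right_mono) auto
      finally show ?thesis by (simp add: C2_def mult_ac)
    qed
    obtain Q where Q: "degree Q \<le> g" "\<And>z. fr_det (X + z *\<^sub>C G) = poly Q z"
      using fr_det_polynomial[OF X G(1)] by (auto simp: g_def)
    define M where "M = c1 * (e2 powr p * r powr p) + c1 * N G powr p"
    have reg: "fr_det_reg p (X + z *\<^sub>C G) = poly Q z * exp (T z)" for z
      by (simp add: fr_det_reg_def Q T_def m_def)
    have circle: "cmod (poly Q z) \<le> exp (M + C2 * r powr real (m - 1)) / cmod (exp (T 0))" if z: "cmod z = 1" for z
    proof -
      have Z: "X + z *\<^sub>C G \<in> finite_rank_ops" using X G by simp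
      have I: "X \<in> \<I>" "z *\<^sub>C G \<in> \<I>" "W \<in> \<I>" "G \<in> \<I>" using X G W by (auto intro!: ideal_finite_rank)
      have "N (X + z *\<^sub>C G) \<le> q * (N X + N (z *\<^sub>C G))" by (rule q(2)[OF I(1,2)])
      also have "\<dots> \<le> q * (r * e2 + N G)"
        using NW q(1) r z by (intro mult_left_mono add_mono) (auto simp: X_def N_scale I r_def mult_left_mono)
      finally have "N (X + z *\<^sub>C G) powr p \<le> (q * (r * e2 + N G)) powr p"
        using p N_nonneg[OF ideal_finite_rank[OF Z]] by (intro powr_mono2) auto
      also have "\<dots> = q powr p * (r * e2 + N G) powr p"
        using q(1) r e2 N_nonneg[OF I(4)] by (simp add: powr_mult)
      also have "\<dots> \<le> q powr p * (2 powr p * ((r * e2) powr p + N G powr p))"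
        using q(1) r e2 N_nonneg[OF I(4)] p by (intro mult_left_mono powr_sum_le) auto
      finally have "det_type * N (X + z *\<^sub>C G) powr p \<le> det_type * (q powr p * (2 powr p * ((r * e2) powr p + N G powr p)))"
        using det_type_nonneg by (intro mult_left_mono)
      also have "\<dots> = M" using r e2 by (simp add: M_def c1_def powr_mult algebra_simps)
      finally have "cmod (poly Q z * exp (T z)) \<le> exp M"
        using det_le[OF Z] unfolding reg by (meson exp_le_cancel_iff order_trans)
      then have "cmod (poly Q z) * cmod (exp (T z)) \<le> exp M" by (simp only: norm_mult)
      then have "cmod (poly Q z) * cmod (exp (T z)) * cmod (exp (T 0 - T z)) \<le> exp M * exp (C2 * r powr real (m - 1))"
      proof (rule mult_mono)
        have "cmod (exp (T 0 - T z)) \<le> exp (cmod (T z - T 0))" by (metis norm_exp norm_minus_commute)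
        also have "\<dots> \<le> exp (C2 * r powr real (m - 1))" using Tdiff[of z] z r by simp
        finally show "cmod (exp (T 0 - T z)) \<le> exp (C2 * r powr real (m - 1))" .
      qed auto
      also have "cmod (poly Q z) * cmod (exp (T z)) * cmod (exp (T 0 - T z)) = cmod (poly Q z) * cmod (exp (T 0))"
        by (simp add: mult.assoc norm_mult[symmetric] exp_add[symmetric] del: norm_exp_eq_Re)
      finally have "cmod (poly Q z) * cmod (exp (T 0)) \<le> exp (M + C2 * r powr real (m - 1))" by (simp add: exp_add)
      moreover have "0 < cmod (exp (T 0))" by simp
      ultimately show ?thesis by (simp only: pos_le_divide_eq)
    qed
    have "w *\<^sub>C F = X + w *\<^sub>C G" by (simp add: X_def W_def scaleC_diff_right)
    then have "cmod (fr_det_reg p (w *\<^sub>C F)) = cmod (poly Q w) * cmod (exp (T w))" by (simp only: reg norm_mult)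
    also have "\<dots> \<le> (r ^ g * (exp (M + C2 * r powr real (m - 1)) / cmod (exp (T 0)))) * cmod (exp (T w))"
      using polynomial_growth[OF Q(1) circle] r by (intro mult_right_mono) (auto simp: r_def simp del: norm_exp_eq_Re)
    also have "\<dots> = r ^ g * exp (M + C2 * r powr real (m - 1)) * cmod (exp (T w - T 0))"
      by (simp add: exp_diff norm_divide del: norm_exp_eq_Re)
    also have "\<dots> \<le> r ^ g * exp (M + C2 * r powr real (m - 1)) * exp (C2 * r powr real (m - 1))"
    proof (rule mult_left_mono)
      have "cmod (exp (T w - T 0)) \<le> exp (cmod (T w - T 0))" by (rule norm_exp)
      also have "\<dots> \<le> exp (C2 * r powr real (m - 1))" using Tdiff[of w] r by (simp add: r_def)
      finally show "cmod (exp (T w - T 0)) \<le> exp (C2 * r powr real (m - 1))" .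
    qed (use r in simp)
    also have "\<dots> = exp (real g * ln r + (2 * C2) * r powr real (m - 1) + c1 * N G powr p + c1 * e2 powr p * r powr p)"
    proof -
      have "r ^ g = exp (real g * ln r)" using r by (simp add: exp_of_nat_mult)
      then show ?thesis by (simp add: M_def exp_add[symmetric] algebra_simps)
    qed
    also have "\<dots> \<le> exp (\<kappa> * r powr p)"
    proof -
      have "c1 * e2 powr p * r powr p \<le> \<kappa> / 2 * r powr p" using c1e2 by (intro mult_right_mono) auto
      then show ?thesis using r1[OF r(2)] by (simp add: field_simps)
    qed
    finally show ?thesis by (simp add: r_def)
  qed
  moreover have "1 \<le> r0" by (simp add: r0_def)
  ultimately show ?thesis using e1 by blast
qed

text \<open>Each eigenvalue contributes at least \<open>\<delta>\<^sup>p\<close> to a convergent sum.\<close>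

lemma finite_large_eigenvalues:
  assumes L: "L \<in> \<I>" and \<delta>: "0 < \<delta>"
  shows "finite {\<mu> \<in> discrete_eigenvalues L. \<delta> < cmod \<mu>}"
proof (rule finite_if_finite_subsets_card_bdd[THEN conjunct1])
  let ?f = "\<lambda>\<mu>. real (alg_mult L \<mu>) * cmod \<mu> powr p"
  have Lb: "L \<in> bounded_ops" by (rule ideal_bops[OF L])
  fix S assume S: "S \<subseteq> {\<mu> \<in> discrete_eigenvalues L. \<delta> < cmod \<mu>}" "finite S"
  have "real (card S) * \<delta> powr p = (\<Sum>\<mu>\<in>S. \<delta> powr p)" by simp
  also have "\<dots> \<le> sum ?f S"
  proof (rule sum_mono)
    fix \<mu> assume \<mu>: "\<mu> \<in> S"
    have "1 * \<delta> powr p \<le> ?f \<mu>"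
    proof (rule mult_mono)
      show "1 \<le> real (alg_mult L \<mu>)"
        using discrete_eigenvalue_gen_eigenspace(4)[OF Lb, of \<mu>] S(1) \<mu> by force
      show "\<delta> powr p \<le> cmod \<mu> powr p" using S(1) \<mu> \<delta> p by (intro powr_mono2) auto
    qed auto
    then show "\<delta> powr p \<le> ?f \<mu>" by simp
  qed
  also have "\<dots> \<le> eig_sum L"
    unfolding eig_sum_def using S by (intro finite_sum_le_infsum eigenvalues_summable[OF L]) auto
  finally have "real (card S) \<le> eig_sum L / \<delta> powr p" using \<delta> by (simp add: pos_le_divide_eq)
  then show "card S \<le> nat \<lceil>eig_sum L / \<delta> powr p\<rceil>" by linarith
qed

text \<open>Let \<open>E\<close> project onto the generalized eigenspaces of \<open>L\<close> for eigenvalues of modulus greater than \<open>\<delta>\<close>, and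
  \<open>D = I - E\<close>. The approximation is \<open>F = L E + D F\<^sub>0 D\<close> with \<open>F\<^sub>0\<close> close to \<open>L\<close>. Its two parts annihilate each
  other, so the determinant is a product. The nonzero eigenvalues of \<open>L\<^sub>1 = L E\<close> are eigenvalues of \<open>L\<close> of no larger
  multiplicity. The eigenvalues of \<open>H = D F\<^sub>0 D\<close> are at most \<open>2 \<delta>\<close> in modulus, since \<open>L D\<close> has no spectrum beyond
  \<open>\<delta>\<close> and \<open>H\<close> is close to \<open>L D\<close>.\<close>

lemma approximation_with_determinant_bound:
  assumes L: "L \<in> \<I>" and \<eta>: "0 < \<eta>"
  shows "\<exists>F\<in>finite_rank_ops. N (F - L) < \<eta> \<and> cmod (fr_det_reg p F) \<le> exp (det_type * N L powr p + \<eta>)"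
proof -
  have Lb: "L \<in> bounded_ops" by (rule ideal_bops[OF L])
  define m where "m = nat \<lceil>p\<rceil>"
  have m: "1 \<le> m" "p \<le> real m" using p unfolding m_def by linarith+
  \<comment> \<open>Chosen so that the final exponent \<open>4 B (4 \<delta>)\<^sup>m\<close>, where \<open>B = 2 \<kappa> (2 / \<delta>)\<^sup>p\<close>, is at most \<open>\<eta>\<close>.\<close>
  define \<kappa> where "\<kappa> = \<eta> / (8 * 2 powr p * 4 ^ m)"
  have \<kappa>: "0 < \<kappa>" using \<eta> by (simp add: \<kappa>_def)
  obtain e r0 where e: "0 < e" and r0: "1 \<le> r0"
    and growth: "\<And>F w. F \<in> finite_rank_ops \<Longrightarrow> N (F - L) \<le> e \<Longrightarrow> r0 \<le> cmod w \<Longrightarrow>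
      cmod (fr_det_reg p (w *\<^sub>C F)) \<le> exp (\<kappa> * cmod w powr p)"
    using det_growth[OF L \<kappa>] by blast
  \<comment> \<open>\<open>\<delta> \<le> 1/8\<close> gives radius \<open>1 / (2 \<delta>) \<ge> 4\<close>; \<open>r0 \<le> 2 / \<delta>\<close> makes the growth estimate apply on the circle of radius \<open>2 / \<delta>\<close>.\<close>
  define \<delta> where "\<delta> = min (1/8) (2 / r0)"
  have \<delta>: "0 < \<delta>" "\<delta> \<le> 1/8" "r0 \<le> 2 / \<delta>"
    using r0 by (auto simp: \<delta>_def min_def field_simps)
  define S where "S = {\<mu> \<in> discrete_eigenvalues L. \<delta> < cmod \<mu>}"
  have S: "finite S" "S \<subseteq> discrete_eigenvalues L" using finite_large_eigenvalues[OF L \<delta>(1)] by (auto simp: S_def)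
  define M where "M = complex_vector.span (\<Union>(gen_eigenspace L ` S))"
  have fin: "\<And>\<mu>. \<mu> \<in> S \<Longrightarrow> fin_dim (gen_eigenspace L \<mu>)"
    using discrete_eigenvalue_gen_eigenspace(2)[OF Lb] S(2) by blast
  note Mprops = span_Union_gen_eigenspaces[OF Lb S(1) fin, folded M_def]
  obtain E where E: "E \<in> finite_rank_ops" and EM: "\<And>x. blinfun_apply E x \<in> M"
    and Eid: "\<And>x. x \<in> M \<Longrightarrow> blinfun_apply E x = x"
    and EL: "\<And>x. blinfun_apply E (blinfun_apply L x) = blinfun_apply L (blinfun_apply E x)"
    using gen_eigenspaces_projection[OF Lb S, folded M_def] by blast
  have sM: "complex_vector.subspace M" by (simp add: M_def)
  have Eb: "E \<in> bounded_ops" using E by simp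
  define D where "D = id_blinfun - E"
  have D: "D \<in> bounded_ops" using Eb by (simp add: D_def)
  have Dx: "blinfun_apply D x = x - blinfun_apply E x" for x by (simp add: D_def op_apply)
  have EE: "blinfun_apply E (blinfun_apply E x) = blinfun_apply E x" for x by (rule Eid[OF EM])
  define L1 where "L1 = L o\<^sub>L E"
  define L2 where "L2 = L o\<^sub>L D"
  have L1: "L1 \<in> finite_rank_ops" using Lb E by (simp add: L1_def)
  have L2b: "L2 \<in> bounded_ops" using Lb D by (simp add: L2_def)
  have L2x: "blinfun_apply L2 x = blinfun_apply D (blinfun_apply L (blinfun_apply D x))" for x
    by (simp add: L2_def Dx blinfun.diff_right EL EE)
  have specL2: "id_blinfun - z *\<^sub>C L2 \<in> invertibles" if z: "cmod z \<le> 1 / (2 * \<delta>)" for z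
  proof (cases "z = 0")
    case True
    then show ?thesis using invertible_id_minus[of "0 :: 'a \<Rightarrow>\<^sub>L 'a"] by simp
  next
    case False
    let ?\<nu> = "inverse z"
    have \<nu>: "?\<nu> \<noteq> 0" "\<delta> < cmod ?\<nu>"
    proof -
      have "0 < cmod z" using False by simp
      then have "cmod z * (2 * \<delta>) \<le> 1" "0 < cmod z * \<delta>" using z \<delta>(1) by (auto simp: field_simps)
      then have "cmod z * \<delta> < 1" by linarith
      then have "\<delta> < inverse (cmod z)" using \<open>0 < cmod z\<close> by (simp add: field_simps)
      then show "\<delta> < cmod ?\<nu>" by (simp add: norm_inverse)
    qed (use False in simp)
    have "?\<nu> \<notin> op_spectrum L2"
    proof
      assume sp: "?\<nu> \<in> op_spectrum L2"
      have appr: "approximable L2"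
        unfolding L2_def by (rule approximable_comp_right[OF ideal_approximable[OF L] D])
      obtain x where x: "x \<noteq> 0" "blinfun_apply L2 x = ?\<nu> *\<^sub>C x"
        using approximable_spectrum(2)[OF appr sp \<nu>(1)] by (elim exE conjE) (rule that)
      have "blinfun_apply E (?\<nu> *\<^sub>C x) = 0"
        unfolding x(2)[symmetric] L2x by (simp add: Dx blinfun.diff_right EE)
      then have Ex: "blinfun_apply E x = 0" using \<nu>(1) by (simp add: bopsD[OF Eb])
      then have Lx: "blinfun_apply L x = ?\<nu> *\<^sub>C x" using x(2) by (simp add: L2_def Dx)
      then have "?\<nu> \<in> op_spectrum L" using eigenvalue_in_spectrum[OF Lb Lx x(1)] by simp
      then have "?\<nu> \<in> S"
        using approximable_discrete[OF ideal_approximable[OF L] _ \<nu>(1)] \<nu>(2) by (simp add: S_def)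
      moreover have "x \<in> gen_eigenspace L ?\<nu>"
        using eigenvector_shift_power[OF Lb Lx, of ?\<nu> 1] by (auto simp: gen_eigenspace_def intro!: exI[of _ 1])
      ultimately have "x \<in> M" unfolding M_def by (intro complex_vector.span_base) auto
      then show False using Eid Ex x(1) by simp
    qed
    then show ?thesis using spectrum_reciprocal[OF L2b \<nu>(1)] by simp
  qed
  have "compact ((\<lambda>z. inv_op (id_blinfun - z *\<^sub>C L2)) ` cball 0 (1 / (2 * \<delta>)))"
  proof (rule compact_continuous_image)
    show "continuous_on (cball 0 (1 / (2 * \<delta>))) (\<lambda>z. inv_op (id_blinfun - z *\<^sub>C L2))"
      by (rule continuous_on_compose2[OF continuous_on_inv_op])
        (use specL2 in \<open>auto intro!: continuous_intros\<close>)
  qed simp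
  then obtain C where C: "0 < C" "\<And>z. cmod z \<le> 1 / (2 * \<delta>) \<Longrightarrow> norm (inv_op (id_blinfun - z *\<^sub>C L2)) \<le> C"
    using bounded_pos[of "(\<lambda>z. inv_op (id_blinfun - z *\<^sub>C L2)) ` cball 0 (1 / (2 * \<delta>))"] compact_imp_bounded by auto
  \<comment> \<open>\<open>N (F - L)\<close> must fall below \<open>e\<close> and \<open>\<eta>\<close>, and below \<open>\<delta> / C\<close> so that \<open>H\<close> has no eigenvalue beyond \<open>2 \<delta>\<close>.\<close>
  define e' where "e' = min (min e (\<eta> / 2)) (\<delta> / C) / (norm D * norm D + 1)"
  have nD: "0 < norm D * norm D + 1" by (simp add: add_nonneg_pos)
  have e': "0 < e'" using e \<eta> \<delta>(1) C(1) nD by (simp add: e'_def)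
  obtain F0 where F0: "F0 \<in> finite_rank_ops" "N (F0 - L) < e'" using finite_rank_approximation[OF L e'] by blast
  define H where "H = D o\<^sub>L F0 o\<^sub>L D"
  have H: "H \<in> finite_rank_ops" using F0 D by (simp add: H_def)
  have Hb: "H \<in> bounded_ops" using H by simp
  have HL2: "H - L2 = D o\<^sub>L (F0 - L) o\<^sub>L D"
    by (rule blinfun_eqI) (simp add: H_def blinfun.diff_left L2x blinfun.diff_right)
  have F0L: "F0 - L \<in> \<I>" by (rule ideal_closed(2)[OF ideal_finite_rank[OF F0(1)] L])
  have HI: "H - L2 \<in> \<I>" unfolding HL2 by (rule ideal[OF F0L D D])
  have NH: "N (H - L2) < min (min e (\<eta> / 2)) (\<delta> / C)"
  proof -
    have "N (H - L2) \<le> norm D * N (F0 - L) * norm D" unfolding HL2 by (rule ideal_norm[OF F0L D D])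
    also have "\<dots> = N (F0 - L) * (norm D * norm D)" by simp
    also have "\<dots> \<le> N (F0 - L) * (norm D * norm D + 1)" using N_nonneg[OF F0L] by (intro mult_left_mono) auto
    also have "\<dots> < e' * (norm D * norm D + 1)" using F0(2) nD by (intro mult_strict_right_mono) auto
    also have "\<dots> = min (min e (\<eta> / 2)) (\<delta> / C)" using nD by (simp add: e'_def)
    finally show ?thesis .
  qed
  define F where "F = L1 + H"
  have F: "F \<in> finite_rank_ops" using L1 H by (simp add: F_def)
  have FL: "F - L = H - L2"
    by (rule blinfun_eqI) (simp add: F_def L1_def L2_def Dx blinfun.diff_left blinfun.add_left blinfun.diff_right)
  have NF: "N (F - L) \<le> e" "N (F - L) < \<eta>" using NH \<eta> by (auto simp: FL)
  have Heig: "cmod \<nu> \<le> 2 * \<delta>" if x: "x \<noteq> 0" "blinfun_apply H x = \<nu> *\<^sub>C x" for x \<nu>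
  proof (rule ccontr)
    assume "\<not> ?thesis"
    then have big: "2 * \<delta> < cmod \<nu>" by simp
    let ?z = "inverse \<nu>"
    have \<nu>0: "\<nu> \<noteq> 0" using big \<delta>(1) by auto
    have "inverse (cmod \<nu>) \<le> 1 / (2 * \<delta>)" using big \<delta>(1) \<nu>0 by (simp add: field_simps)
    then have zle: "cmod ?z \<le> 1 / (2 * \<delta>)" by (simp add: norm_inverse)
    have i: "id_blinfun - ?z *\<^sub>C L2 \<in> invertibles" by (rule specL2[OF zle])
    let ?V = "inv_op (id_blinfun - ?z *\<^sub>C L2)"
    have "x = ?z *\<^sub>C blinfun_apply H x" using x(2) \<nu>0 by (simp add: scaleC_scaleC scaleC_one)
    then have "blinfun_apply (id_blinfun - ?z *\<^sub>C L2) x = ?z *\<^sub>C blinfun_apply (H - L2) x"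
      by (simp add: blinfun.diff_left scaleC_blinfun.rep_eq scaleC_diff_right)
    then have "x = blinfun_apply ?V (?z *\<^sub>C blinfun_apply (H - L2) x)"
      using inv_op_apply(2)[OF i, of x] by simp
    then have "norm x \<le> norm ?V * norm (?z *\<^sub>C blinfun_apply (H - L2) x)"
      using norm_blinfun[of ?V "?z *\<^sub>C blinfun_apply (H - L2) x"] by simp
    also have "\<dots> \<le> norm ?V * (cmod ?z * (norm (H - L2) * norm x))"
      unfolding norm_scaleC by (intro mult_left_mono norm_blinfun) auto
    also have "\<dots> \<le> C * (1 / (2 * \<delta>) * (\<delta> / C * norm x))"
      using C zle norm_le[OF HI] NH \<delta>(1) by (intro mult_mono) auto
    also have "\<dots> = norm x / 2" using C(1) \<delta>(1) by simp
    finally show False using x(1) by simp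
  qed
  obtain \<mu>s where \<mu>s: "\<forall>\<nu>\<in>set \<mu>s. \<exists>x\<in>range (blinfun_apply L1). x \<noteq> 0 \<and> blinfun_apply L1 x = \<nu> *\<^sub>C x"
    "\<forall>w. fr_det (w *\<^sub>C L1) = (\<Prod>\<nu>\<leftarrow>\<mu>s. 1 - w * \<nu>)"
    "\<forall>k>0. fr_trace (op_power L1 k) = (\<Sum>\<nu>\<leftarrow>\<mu>s. \<nu> ^ k)"
    using fr_eigenvalue_list[OF L1 range_op_subspace[OF finite_rank_bops[OF L1]] _ order_refl] L1
    by (auto simp: finite_rank_iff)
  obtain \<nu>s where \<nu>s: "\<forall>\<nu>\<in>set \<nu>s. \<exists>x\<in>range (blinfun_apply H). x \<noteq> 0 \<and> blinfun_apply H x = \<nu> *\<^sub>C x"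
    "\<forall>w. fr_det (w *\<^sub>C H) = (\<Prod>\<nu>\<leftarrow>\<nu>s. 1 - w * \<nu>)"
    "\<forall>k>0. fr_trace (op_power H k) = (\<Sum>\<nu>\<leftarrow>\<nu>s. \<nu> ^ k)"
    using fr_eigenvalue_list[OF H range_op_subspace[OF Hb] _ order_refl] H
    by (auto simp: finite_rank_iff)
  have LM: "blinfun_apply L x \<in> M" if "x \<in> M" for x using Mprops(2) that by blast
  have L1M: "blinfun_apply L1 x \<in> M" for x by (simp add: L1_def LM[OF EM])
  have L1L: "blinfun_apply L1 x = blinfun_apply L x" if "x \<in> M" for x by (simp add: L1_def Eid[OF that])
  have big: "\<delta> < cmod \<nu>" if "\<nu> \<in> set \<mu>s" for \<nu>
  proof -
    obtain x where x: "x \<in> range (blinfun_apply L1)" "x \<noteq> 0" "blinfun_apply L1 x = \<nu> *\<^sub>C x"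
      using bspec[OF \<mu>s(1) \<open>\<nu> \<in> set \<mu>s\<close>] by (elim bexE conjE)
    have "x \<in> M" using x(1) L1M by auto
    then have "\<nu> \<in> S" using Mprops(3)[of x \<nu>] x L1L by auto
    then show ?thesis by (simp add: S_def)
  qed
  have HL1: "L1 o\<^sub>L H = 0" "H o\<^sub>L L1 = 0"
  proof -
    show "L1 o\<^sub>L H = 0"
      by (rule blinfun_eqI) (simp add: L1_def H_def Dx blinfun.diff_right EE blinfun.zero_right)
    have "blinfun_apply D (blinfun_apply L1 x) = 0" for x using Eid[OF L1M, of x] by (simp add: Dx)
    then show "H o\<^sub>L L1 = 0" by (intro blinfun_eqI) (simp add: H_def blinfun.zero_right)
  qed
  define qq where "qq k = 1 / of_nat k * (\<Sum>\<nu>\<leftarrow>\<mu>s. \<nu> ^ k) + 1 / of_nat k * (\<Sum>\<nu>\<leftarrow>\<nu>s. \<nu> ^ k)" for k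
  define J where "J w = exp (\<Sum>k = 1..<m. qq k * w ^ k) * (\<Prod>\<nu>\<leftarrow>\<nu>s. 1 - w * \<nu>)" for w
  have DF: "fr_det_reg p (w *\<^sub>C F) = (\<Prod>\<nu>\<leftarrow>\<mu>s. 1 - w * \<nu>) * J w" for w
  proof -
    have "(w *\<^sub>C L1) o\<^sub>L (w *\<^sub>C H) = 0" "(w *\<^sub>C H) o\<^sub>L (w *\<^sub>C L1) = 0"
    proof -
      have "blinfun_apply L1 (blinfun_apply H x) = 0" "blinfun_apply H (blinfun_apply L1 x) = 0" for x
        using HL1 by (metis blinfun_apply_blinfun_compose blinfun.zero_left)+
      then show "(w *\<^sub>C L1) o\<^sub>L (w *\<^sub>C H) = 0" "(w *\<^sub>C H) o\<^sub>L (w *\<^sub>C L1) = 0"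
        using Hb L1 by (auto intro!: blinfun_eqI simp: scaleC_blinfun.rep_eq bopsD)
    qed
    then have "fr_det_reg p (w *\<^sub>C F) = fr_det_reg p (w *\<^sub>C L1) * fr_det_reg p (w *\<^sub>C H)"
      unfolding F_def scaleC_add_right using L1 H by (intro fr_det_reg_direct_sum) auto
    also have "\<dots> = (\<Prod>\<nu>\<leftarrow>\<mu>s. 1 - w * \<nu>) * J w"
      unfolding fr_det_reg_list[OF L1 \<mu>s(2,3)] fr_det_reg_list[OF H \<nu>s(2,3)] m_def[symmetric] J_def qq_def
      by (simp add: distrib_right sum.distrib exp_add)
    finally show ?thesis .
  qed
  \<comment> \<open>On \<open>\<bar>w\<bar> = 2 / \<delta>\<close> each factor for an eigenvalue of \<open>L1\<close> has modulus at least 1, so dividing by them cannot enlarge the determinant.\<close>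
  have Jcircle: "cmod (J w) \<le> exp (\<kappa> * (2 / \<delta>) powr p)" if w: "cmod w = 2 / \<delta>" for w
  proof -
    have "1 \<le> cmod (\<Prod>\<nu>\<leftarrow>xs. 1 - w * \<nu>)" if "set xs \<subseteq> set \<mu>s" for xs
      using that
    proof (induction xs)
      case (Cons \<nu> xs)
      have "2 = (2 / \<delta>) * \<delta>" using \<delta>(1) by simp
      also have "\<dots> \<le> cmod w * cmod \<nu>" unfolding w using big[of \<nu>] Cons.prems \<delta>(1) by (intro mult_left_mono) auto
      finally have "1 \<le> cmod (1 - w * \<nu>)"
        using norm_triangle_ineq2[of "w * \<nu>" 1] by (simp add: norm_mult norm_minus_commute)
      then have "1 * 1 \<le> cmod (1 - w * \<nu>) * cmod (\<Prod>\<nu>\<leftarrow>xs. 1 - w * \<nu>)"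
        using Cons by (intro mult_mono) auto
      then show ?case by (simp add: norm_mult)
    qed simp
    then have "1 * cmod (J w) \<le> cmod (\<Prod>\<nu>\<leftarrow>\<mu>s. 1 - w * \<nu>) * cmod (J w)" by (intro mult_right_mono) auto
    also have "\<dots> = cmod (fr_det_reg p (w *\<^sub>C F))" by (simp add: DF norm_mult)
    also have "\<dots> \<le> exp (\<kappa> * cmod w powr p)" using \<delta>(3) w by (intro growth[OF F NF(1)]) simp
    finally show ?thesis by (simp add: w)
  qed
  have holp: "(\<lambda>w. \<Prod>\<nu>\<leftarrow>xs. 1 - w * \<nu>) holomorphic_on A" for xs A
    by (induction xs) (auto intro!: holomorphic_intros)
  have holJ: "J holomorphic_on A" for A
    unfolding J_def[abs_def] by (intro holomorphic_intros holp)
  define B where "B = 2 * (\<kappa> * (2 / \<delta>) powr p)"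
  have Jball: "cmod (J w) < exp B" if w: "cmod w < 1 / (2 * \<delta>)" for w
  proof -
    have "1 / (2 * \<delta>) \<le> 2 / \<delta>" using \<delta>(1) by (simp add: field_simps)
    then have wb: "w \<in> cball 0 (2 / \<delta>)" using w by simp
    have "cmod (J w) \<le> exp (\<kappa> * (2 / \<delta>) powr p)"
    proof (rule maximum_modulus_frontier[of J "cball 0 (2 / \<delta>)", OF holJ _ _ _ wb])
      show "continuous_on (closure (cball 0 (2 / \<delta>))) J" by (rule holomorphic_on_imp_continuous_on[OF holJ])
      show "cmod (J z) \<le> exp (\<kappa> * (2 / \<delta>) powr p)" if "z \<in> frontier (cball 0 (2 / \<delta>))" for z
        using that by (intro Jcircle) (simp add: frontier_cball)
    qed simp
    also have "\<dots> < exp B" using \<kappa> \<delta>(1) by (simp add: B_def)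
    finally show ?thesis .
  qed
  have detH: "cmod (fr_det_reg p H) \<le> exp \<eta>"
  proof -
    have "cmod ((\<Prod>\<nu>\<leftarrow>\<nu>s. 1 - \<nu>) * exp (\<Sum>k = 1..<m. 1 / of_nat k * (\<Sum>\<nu>\<leftarrow>\<nu>s. \<nu> ^ k))) \<le> exp (4 * B * (2 / (1 / (2 * \<delta>))) ^ m)"
    proof (rule regularized_product_bound[OF _ _ m(1), of _ _ qq])
      show "cmod \<nu> * (1 / (2 * \<delta>)) \<le> 1" if "\<nu> \<in> set \<nu>s" for \<nu>
        using Heig[of _ \<nu>] \<nu>s(1) that \<delta>(1) by (auto simp: field_simps)
      show "4 \<le> 1 / (2 * \<delta>)" using \<delta>(1,2) by (simp add: field_simps)
      show "cmod (exp (\<Sum>k = 1..<m. qq k * z ^ k) * (\<Prod>\<nu>\<leftarrow>\<nu>s. 1 - z * \<nu>)) < exp B" if "cmod z < 1 / (2 * \<delta>)" for z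
        using Jball[OF that] by (simp only: J_def)
    qed
    also have "4 * B * (2 / (1 / (2 * \<delta>))) ^ m \<le> \<eta>"
    proof -
      have "4 * B * (2 / (1 / (2 * \<delta>))) ^ m = (8 * 2 powr p * 4 ^ m) * \<kappa> * (\<delta> ^ m / \<delta> powr p)"
        using \<delta>(1) by (simp add: B_def power_mult_distrib powr_divide)
      also have "(8 * 2 powr p * 4 ^ m) * \<kappa> = \<eta>" by (simp add: \<kappa>_def)
      also have "\<eta> * (\<delta> ^ m / \<delta> powr p) \<le> \<eta> * 1"
      proof (rule mult_left_mono)
        have "\<delta> ^ m = \<delta> powr real m" using \<delta>(1) by (simp add: powr_realpow)
        also have "\<dots> \<le> \<delta> powr p" using \<delta>(1,2) m(2) by (intro powr_mono') auto
        finally show "\<delta> ^ m / \<delta> powr p \<le> 1" using \<delta>(1) by (simp add: divide_le_eq_1)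
      qed (use \<eta> in simp)
      finally show ?thesis by simp
    qed
    finally have "cmod ((\<Prod>\<nu>\<leftarrow>\<nu>s. 1 - \<nu>) * exp (\<Sum>k = 1..<m. 1 / of_nat k * (\<Sum>\<nu>\<leftarrow>\<nu>s. \<nu> ^ k))) \<le> exp \<eta>"
      by simp
    then show ?thesis
      using fr_det_reg_list[OF H \<nu>s(2,3), of p 1] by (simp add: scaleC_one m_def)
  qed
  have es: "eig_sum L1 \<le> eig_sum L"
  proof -
    have L1I: "L1 \<in> \<I>" by (rule ideal_finite_rank[OF L1])
    have L1b: "L1 \<in> bounded_ops" using L1 by simp
    have key: "\<mu> \<in> discrete_eigenvalues L \<and> alg_mult L1 \<mu> \<le> alg_mult L \<mu>"
      if \<mu>: "\<mu> \<in> discrete_eigenvalues L1" "\<mu> \<noteq> 0" for \<mu>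
    proof -
      obtain x where x: "x \<noteq> 0" "blinfun_apply L1 x = \<mu> *\<^sub>C x" using \<mu>(1) by (auto simp: discrete_eigenvalues_def)
      have inM: "y \<in> M" if "blinfun_apply (op_power (L1 - \<mu> *\<^sub>C id_blinfun) k) y = 0" for k y
        using that
      proof (induction k arbitrary: y)
        case 0
        then show ?case using complex_vector.subspace_0[OF sM] by simp
      next
        case (Suc k)
        let ?y = "blinfun_apply (L1 - \<mu> *\<^sub>C id_blinfun) y"
        have "?y \<in> M" by (rule Suc.IH) (use Suc.prems in \<open>simp only: op_power_apply funpow_Suc_right comp_def\<close>)
        then have "inverse \<mu> *\<^sub>C (blinfun_apply L1 y - ?y) \<in> M"
          by (intro complex_vector.subspace_scale[OF sM] complex_vector.subspace_diff[OF sM] L1M)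
        moreover have "inverse \<mu> *\<^sub>C (blinfun_apply L1 y - ?y) = y" using \<mu>(2) by (simp add: op_apply scaleC_scaleC scaleC_one)
        ultimately show ?case by simp
      qed
      have "x \<in> gen_eigenspace L1 \<mu>"
        using eigenvector_shift_power[OF L1b x(2), of \<mu> 1] by (auto simp: gen_eigenspace_def intro!: exI[of _ 1])
      then have "x \<in> M" using inM by (auto simp: gen_eigenspace_def)
      then have "\<mu> \<in> S" using Mprops(3)[of x \<mu>] x L1L by auto
      then have \<mu>L: "\<mu> \<in> discrete_eigenvalues L" by (simp add: S_def)
      have pow: "blinfun_apply (op_power (L1 - \<mu> *\<^sub>C id_blinfun) k) y = blinfun_apply (op_power (L - \<mu> *\<^sub>C id_blinfun) k) y \<and>
        blinfun_apply (op_power (L - \<mu> *\<^sub>C id_blinfun) k) y \<in> M" if "y \<in> M" for k y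
      proof (induction k)
        case (Suc k)
        let ?z = "blinfun_apply (op_power (L - \<mu> *\<^sub>C id_blinfun) k) y"
        have "?z \<in> M" using Suc by simp
        then show ?case using Suc L1L[of ?z] LM[of ?z] sM
          by (auto simp: op_apply intro!: complex_vector.subspace_diff complex_vector.subspace_scale)
      qed (use that in simp)
      have "gen_eigenspace L1 \<mu> \<subseteq> gen_eigenspace L \<mu>"
      proof
        fix y assume "y \<in> gen_eigenspace L1 \<mu>"
        then obtain k where k: "blinfun_apply (op_power (L1 - \<mu> *\<^sub>C id_blinfun) k) y = 0" by (auto simp: gen_eigenspace_def)
        then have "blinfun_apply (op_power (L - \<mu> *\<^sub>C id_blinfun) k) y = 0" using pow[OF inM[OF k]] by simp
        then show "y \<in> gen_eigenspace L \<mu>" by (auto simp: gen_eigenspace_def)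
      qed
      then have "alg_mult L1 \<mu> \<le> alg_mult L \<mu>"
        unfolding discrete_eigenvalue_gen_eigenspace(3)[OF L1b \<mu>(1)] discrete_eigenvalue_gen_eigenspace(3)[OF Lb \<mu>L]
        by (rule gen_eigenspace_dim_mono[OF _ L1b Lb discrete_eigenvalue_gen_eigenspace(2)[OF Lb \<mu>L]])
      then show ?thesis using \<mu>L by blast
    qed
    show ?thesis
      unfolding eig_sum_def
    proof (rule infsum_mono_neutral[OF eigenvalues_summable[OF L1I] eigenvalues_summable[OF L]])
      fix \<mu> assume \<mu>: "\<mu> \<in> discrete_eigenvalues L1 \<inter> discrete_eigenvalues L"
      show "real (alg_mult L1 \<mu>) * cmod \<mu> powr p \<le> real (alg_mult L \<mu>) * cmod \<mu> powr p"
        using key[of \<mu>] \<mu> by (cases "\<mu> = 0") (auto intro!: mult_right_mono)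
    next
      fix \<mu> assume \<mu>: "\<mu> \<in> discrete_eigenvalues L1 - discrete_eigenvalues L"
      then have "\<mu> = 0" using key[of \<mu>] by blast
      then show "real (alg_mult L1 \<mu>) * cmod \<mu> powr p \<le> 0" by simp
    qed simp
  qed
  have detL1: "cmod (fr_det_reg p L1) \<le> exp (det_type * N L powr p)"
  proof -
    have "cmod (fr_det_reg p L1) \<le> exp (\<Gamma> * eig_sum L1)" using det_bound[OF L1] by (simp add: eig_sum_def)
    also have "\<dots> \<le> exp (\<Gamma> * (\<gamma> powr p * N L powr p))"
      using es eig_sum_le[OF L] \<Gamma> by simp
    finally show ?thesis by (simp add: det_type_def mult.assoc)
  qed
  have "cmod (fr_det_reg p F) = cmod (fr_det_reg p L1) * cmod (fr_det_reg p H)"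
    unfolding F_def using fr_det_reg_direct_sum[OF L1 H HL1] by (simp add: norm_mult)
  also have "\<dots> \<le> exp (det_type * N L powr p) * exp \<eta>" by (intro mult_mono detL1 detH) auto
  finally have "cmod (fr_det_reg p F) \<le> exp (det_type * N L powr p + \<eta>)" by (simp add: exp_add)
  then show ?thesis using F NF(2) by blast
qed

end

section \<open>The perturbation determinant\<close>

lemma fr_det_reg_zero: "fr_det_reg p 0 = 1"
proof -
  have "op_power (0 :: 'a \<Rightarrow>\<^sub>L 'a) k = 0" if "0 < k" for k
    using that by (cases k) (auto intro!: blinfun_eqI)
  then show ?thesis by (simp add: fr_det_reg_def)
qed

lemma resolvent_op_inverse:
  fixes A :: "'a::complex_banach \<Rightarrow>\<^sub>L 'a"
  assumes A: "A \<in> bounded_ops" and z: "z \<noteq> 0" "inverse z \<notin> op_spectrum A"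
  shows "id_blinfun - z *\<^sub>C A \<in> invertibles"
    "z *\<^sub>C inv_op (id_blinfun - z *\<^sub>C A) = resolvent_op A (inverse z)"
proof -
  show i: "id_blinfun - z *\<^sub>C A \<in> invertibles"
    using spectrum_reciprocal[OF A, of "inverse z"] z by simp
  have "inverse z *\<^sub>C (id_blinfun - z *\<^sub>C A) = inverse z *\<^sub>C id_blinfun - A"
    using z(1) by (simp add: scaleC_diff_right scaleC_scaleC scaleC_one)
  then show "z *\<^sub>C inv_op (id_blinfun - z *\<^sub>C A) = resolvent_op A (inverse z)"
    using scaleC_invertible(2)[OF i, of "inverse z"] z(1) by (simp add: resolvent_op_eq_inv_op)
qed

text \<open>Put \<open>T = A + F\<close>. Since \<open>T E\<close> has its range in the range of \<open>E\<close>, \<open>I - z T = (I - z T (I - E)) (I - z T E)\<close>. Multiplication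
  by \<open>V = (I - z A)\<^sup>-\<^sup>1\<close> from the right turns the left side into \<open>I - z F V\<close>, and the second factor, once it is moved past
  \<open>V\<close>, into a conjugate of \<open>I - z T E\<close>.\<close>

lemma fr_det_invariant_factor:
  fixes A F E :: "'a::complex_banach \<Rightarrow>\<^sub>L 'a"
  assumes A: "A \<in> bounded_ops" and F: "F \<in> finite_rank_ops" and E: "E \<in> finite_rank_ops"
    and inv: "\<And>x. blinfun_apply E (blinfun_apply (A + F) (blinfun_apply E x)) = blinfun_apply (A + F) (blinfun_apply E x)"
    and z: "id_blinfun - z *\<^sub>C A \<in> invertibles"
  defines "V \<equiv> inv_op (id_blinfun - z *\<^sub>C A)"
  shows "fr_det (F o\<^sub>L (z *\<^sub>C V)) =
    fr_det ((F - ((A + F) o\<^sub>L E)) o\<^sub>L (z *\<^sub>C V)) * fr_det (z *\<^sub>C ((A + F) o\<^sub>L E))"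
proof -
  let ?S = "id_blinfun - z *\<^sub>C A" and ?T = "(A + F) o\<^sub>L E"
  let ?X = "(F - ?T) o\<^sub>L (z *\<^sub>C V)" and ?Y = "?S o\<^sub>L (z *\<^sub>C ?T) o\<^sub>L V"
  have V: "V \<in> bounded_ops" unfolding V_def by (rule inv_op_bops[OF z])
  have Fb: "F \<in> bounded_ops" and S: "?S \<in> bounded_ops" using A F by auto
  have T: "?T \<in> finite_rank_ops" using A F E by simp
  have Tb: "?T \<in> bounded_ops" using T by simp
  have VS: "blinfun_apply V (blinfun_apply ?S x) = x" for x
    unfolding V_def by (rule inv_op_apply(2)[OF z])
  have "F o\<^sub>L (z *\<^sub>C V) = ?X + ?Y - (?X o\<^sub>L ?Y)"
  proof (rule blinfun_eqI)
    fix x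
    define y where "y = blinfun_apply V x"
    define w where "w = blinfun_apply ?T y"
    have Ew: "blinfun_apply E w = w" unfolding w_def using inv by simp
    have X: "blinfun_apply ?X x' = z *\<^sub>C (blinfun_apply F (blinfun_apply V x') - blinfun_apply ?T (blinfun_apply V x'))" for x'
    proof -
      have "F - ?T \<in> bounded_ops" using Fb Tb by simp
      then have "blinfun_apply ?X x' = z *\<^sub>C blinfun_apply (F - ?T) (blinfun_apply V x')"
        by (simp only: blinfun_apply_blinfun_compose scaleC_blinfun.rep_eq bopsD)
      then show ?thesis by (simp only: blinfun.diff_left)
    qed
    have Y: "blinfun_apply ?Y x = blinfun_apply ?S (z *\<^sub>C w)"
      by (simp only: blinfun_apply_blinfun_compose scaleC_blinfun.rep_eq y_def w_def)
    have XY: "blinfun_apply ?X (blinfun_apply ?Y x) = z *\<^sub>C (z *\<^sub>C blinfun_apply F w - z *\<^sub>C (blinfun_apply A w + blinfun_apply F w))"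
      unfolding X Y VS bopsD[OF Fb] bopsD[OF Tb] by (simp add: Ew blinfun.add_left)
    have "blinfun_apply (?X + ?Y - (?X o\<^sub>L ?Y)) x = blinfun_apply ?X x + blinfun_apply ?Y x - blinfun_apply ?X (blinfun_apply ?Y x)"
      by (simp only: blinfun.add_left blinfun.diff_left blinfun_apply_blinfun_compose)
    also have "\<dots> = z *\<^sub>C (blinfun_apply F y - w) + (z *\<^sub>C w - z *\<^sub>C z *\<^sub>C blinfun_apply A w)
      - z *\<^sub>C (z *\<^sub>C blinfun_apply F w - z *\<^sub>C (blinfun_apply A w + blinfun_apply F w))"
      unfolding XY unfolding X Y by (simp add: y_def w_def blinfun.diff_left scaleC_blinfun.rep_eq bopsD[OF A])
    also have "\<dots> = z *\<^sub>C blinfun_apply F y"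
      by (simp add: scaleC_diff_right scaleC_add_right)
    finally show "blinfun_apply (F o\<^sub>L (z *\<^sub>C V)) x = blinfun_apply (?X + ?Y - (?X o\<^sub>L ?Y)) x"
      by (simp add: y_def scaleC_blinfun.rep_eq bopsD[OF Fb])
  qed
  moreover have "?X \<in> finite_rank_ops" "?Y \<in> finite_rank_ops" using F T V S by auto
  ultimately have "fr_det (F o\<^sub>L (z *\<^sub>C V)) = fr_det ?X * fr_det ?Y" by (simp only: fr_det_mult)
  also have "fr_det ?Y = fr_det (z *\<^sub>C ?T)"
    using inv_op_inverse[OF z] T S by (intro fr_det_similar) (auto simp: V_def)
  finally show ?thesis .
qed

context det_ideal
begin

text \<open>Jensen's inequality for \<open>z \<mapsto> det\<^sub>p (I - z F (I - z A)\<^sup>-\<^sup>1)\<close> on \<open>\<bar>z\<bar> = 1 / t\<close>. On this circle the determinant is compared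
  with that of the approximation of \<open>L = K R\<^sub>A(1 / z)\<close> from \<open>approximation_with_determinant_bound\<close>; all
  error terms vanish as the distance \<open>\<eta>\<close> tends to 0.\<close>

lemma eigenvalue_count_bound:
  assumes A: "A \<in> bounded_ops" and K: "K \<in> \<I>" and R: "0 \<le> R" "R < t" and C: "0 < C"
    and spec: "\<And>\<mu>. R < cmod \<mu> \<Longrightarrow> \<mu> \<notin> op_spectrum A"
    and res: "\<And>\<mu>. R < cmod \<mu> \<Longrightarrow> norm (resolvent_op A \<mu>) \<le> C / (cmod \<mu> - R)"
    and S: "finite S" "S \<subseteq> discrete_eigenvalues (A + K)" "\<And>\<mu>. \<mu> \<in> S \<Longrightarrow> s \<le> cmod \<mu>" and s: "0 \<le> s"
  shows "(s / t) ^ (\<Sum>\<mu>\<in>S. alg_mult (A + K) \<mu>) \<le> exp (det_type * (C / (t - R) * N K) powr p)"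
proof -
  obtain q where q: "1 \<le> q" "\<And>x y. x \<in> \<I> \<Longrightarrow> y \<in> \<I> \<Longrightarrow> N (x + y) \<le> q * (N x + N y)"
    using quasi_triangle by blast
  define T where "T = A + K"
  have Kb: "K \<in> bounded_ops" by (rule ideal_bops[OF K])
  have Tb: "T \<in> bounded_ops" using A Kb by (simp add: T_def)
  have S2: "S \<subseteq> discrete_eigenvalues T" using S(2) by (simp add: T_def)
  define M where "M = complex_vector.span (\<Union>(gen_eigenspace T ` S))"
  have fin: "\<And>\<mu>. \<mu> \<in> S \<Longrightarrow> fin_dim (gen_eigenspace T \<mu>)"
    using discrete_eigenvalue_gen_eigenspace(2)[OF Tb] S2 by blast
  note Mprops = span_Union_gen_eigenspaces[OF Tb S(1) fin, folded M_def]
  have fM: "fin_dim M" using Mprops(1) by simp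
  have sM: "complex_vector.subspace M" by (simp add: M_def)
  define n where "n = (\<Sum>\<mu>\<in>S. alg_mult T \<mu>)"
  have "n = (\<Sum>\<mu>\<in>S. complex_vector.dim (gen_eigenspace T \<mu>))"
    unfolding n_def using discrete_eigenvalue_gen_eigenspace(3)[OF Tb] S2 by (intro sum.cong) auto
  then have dimM: "complex_vector.dim M = n" using Mprops(4) by (simp only:)
  obtain E where E: "E \<in> finite_rank_ops" and EM: "\<And>x. blinfun_apply E x \<in> M"
    and Eid: "\<And>x. x \<in> M \<Longrightarrow> blinfun_apply E x = x"
    using gen_eigenspaces_projection[OF Tb S(1) S2, folded M_def] by blast
  have Eb: "E \<in> bounded_ops" using E by simp
  define D where "D = id_blinfun - E"
  have D: "D \<in> bounded_ops" using Eb by (simp add: D_def)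
  have Dx: "blinfun_apply D x = x - blinfun_apply E x" for x by (simp add: D_def op_apply)
  define c where "c = C / (t - R)"
  have c: "0 < c" using C R by (simp add: c_def)
  define \<Lambda> where "\<Lambda> = det_type * (c * N K) powr p"
  have t: "0 < t" using R by simp
  \<comment> \<open>Any radius between \<open>1 / t\<close> and \<open>1 / R\<close> would do; the midpoint of \<open>R\<close> and \<open>t\<close> avoids a case distinction for \<open>R = 0\<close>.\<close>
  define \<rho>' where "\<rho>' = 1 / ((R + t) / 2)"
  have \<rho>': "1 / t < \<rho>'" "0 < \<rho>'" using R t by (auto simp: \<rho>'_def field_simps)
  define V where "V z = inv_op (id_blinfun - z *\<^sub>C A)" for z
  have big: "R < cmod (inverse z)" if "z \<noteq> 0" "cmod z < \<rho>'" for z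
  proof -
    have "0 < cmod z" using that by simp
    then have "(R + t) / 2 < inverse (cmod z)" using that(2) R by (simp add: \<rho>'_def field_simps)
    then show ?thesis using R by (simp add: norm_inverse)
  qed
  have inv: "id_blinfun - z *\<^sub>C A \<in> invertibles" if "cmod z < \<rho>'" for z
  proof (cases "z = 0")
    case True
    then show ?thesis using invertible_id_minus[of "0 :: 'a \<Rightarrow>\<^sub>L 'a"] by simp
  next
    case False
    then show ?thesis using resolvent_op_inverse(1)[OF A False spec[OF big[OF False that]]] by simp
  qed
  have Vb: "V z \<in> bounded_ops" if "cmod z < \<rho>'" for z unfolding V_def by (rule inv_op_bops[OF inv[OF that]])
  have circ: "norm (z *\<^sub>C V z) \<le> c" "cmod z < \<rho>'" if z: "cmod z = 1 / t" for z
  proof -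
    show lt: "cmod z < \<rho>'" using z \<rho>' by simp
    have z0: "z \<noteq> 0" using z t by auto
    have "cmod (inverse z) = t" using z t by (simp add: norm_inverse)
    then show "norm (z *\<^sub>C V z) \<le> c"
      using resolvent_op_inverse(2)[OF A z0 spec[OF big[OF z0 lt]]] res[of "inverse z"] R by (simp add: V_def c_def)
  qed
  obtain C' where C': "0 \<le> C'" and lip: "\<And>F G. F \<in> finite_rank_ops \<Longrightarrow> G \<in> finite_rank_ops \<Longrightarrow>
      N F \<le> q * (c * N K + 1) \<Longrightarrow> N (G - F) \<le> 1 / 2 \<Longrightarrow> cmod (fr_det_reg p G - fr_det_reg p F) \<le> C' * N (G - F)"
    using det_lipschitz[of "q * (c * N K + 1)"] by blast
  have step: "(s / t) ^ n \<le> exp (\<Lambda> + \<eta>) + C' * (q * (2 * \<eta>))" if \<eta>: "0 < \<eta>" "\<eta> \<le> 1 / (4 * q)" for \<eta>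
  proof -
    have \<eta>1: "q * (2 * \<eta>) \<le> 1 / 2" "\<eta> \<le> 1"
    proof -
      have "\<eta> * (4 * q) \<le> 1" using \<eta>(2) q(1) by (simp add: pos_le_divide_eq)
      then show "q * (2 * \<eta>) \<le> 1 / 2" by (simp add: mult_ac)
      have "1 / (4 * q) \<le> 1" using q(1) by simp
      then show "\<eta> \<le> 1" using \<eta>(2) by simp
    qed
    define e where "e = \<eta> / (c * (norm D + 1))"
    have nD: "0 < norm D + 1" by (simp add: add_nonneg_pos)
    have e: "0 < e" using \<eta> c nD by (simp add: e_def)
    obtain F0 where F0: "F0 \<in> finite_rank_ops" "N (F0 - K) < e" using finite_rank_approximation[OF K e] by blast
    \<comment> \<open>\<open>F\<close> approximates \<open>K\<close> and agrees with \<open>K\<close> on \<open>M\<close>, so \<open>A + F\<close> keeps the eigenvalues under consideration.\<close>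
    define F where "F = (F0 o\<^sub>L D) + (K o\<^sub>L E)"
    have F: "F \<in> finite_rank_ops" using F0 D E Kb by (simp add: F_def)
    have Fb: "F \<in> bounded_ops" using F by simp
    have F0K: "F0 - K \<in> \<I>" by (rule ideal_closed(2)[OF ideal_finite_rank[OF F0(1)] K])
    have FK: "F - K = (F0 - K) o\<^sub>L D"
      by (rule blinfun_eqI) (simp add: F_def blinfun.diff_left blinfun.add_left Dx blinfun.diff_right)
    have FKI: "F - K \<in> \<I>" by (rule ideal_closed(2)[OF ideal_finite_rank[OF F] K])
    have NFK: "N (F - K) * c \<le> \<eta>"
    proof -
      have "N (F - K) \<le> N (F0 - K) * norm D" unfolding FK by (rule ideal_comp_right(2)[OF F0K D])
      also have "\<dots> \<le> e * (norm D + 1)" using F0(2) N_nonneg[OF F0K] by (intro mult_mono) auto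
      finally have "N (F - K) * c \<le> e * (norm D + 1) * c" using c by (intro mult_right_mono) auto
      also have "\<dots> = \<eta>" using c nD by (simp add: e_def)
      finally show ?thesis .
    qed
    have FM: "blinfun_apply F x = blinfun_apply K x" if "x \<in> M" for x
      by (simp add: F_def blinfun.add_left Dx Eid[OF that] blinfun.zero_right)
    have TM: "blinfun_apply (A + F) x = blinfun_apply T x" if "x \<in> M" for x
      by (simp add: T_def blinfun.add_left FM[OF that])
    have TMM: "blinfun_apply (A + F) x \<in> M" if "x \<in> M" for x using Mprops(2) TM[OF that] that by auto
    let ?TE = "(A + F) o\<^sub>L E"
    have TE: "?TE \<in> finite_rank_ops" using A F E by simp
    obtain \<nu>s where \<nu>s: "length \<nu>s = n" "\<forall>\<nu>\<in>set \<nu>s. \<exists>x\<in>M. x \<noteq> 0 \<and> blinfun_apply ?TE x = \<nu> *\<^sub>C x"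
      "\<forall>w. fr_det (w *\<^sub>C ?TE) = (\<Prod>\<nu>\<leftarrow>\<nu>s. 1 - w * \<nu>)"
    proof -
      have "range (blinfun_apply ?TE) \<subseteq> M" using TMM[OF EM] by auto
      from fr_eigenvalue_list[OF TE sM fM this] show ?thesis
        using that unfolding dimM by (elim exE conjE) simp
    qed
    have \<nu>s_big: "s \<le> cmod \<nu>" if "\<nu> \<in> set \<nu>s" for \<nu>
    proof -
      obtain x where x: "x \<in> M" "x \<noteq> 0" "blinfun_apply ?TE x = \<nu> *\<^sub>C x"
        using bspec[OF \<nu>s(2) \<open>\<nu> \<in> set \<nu>s\<close>] by (elim bexE conjE)
      have "blinfun_apply T x = \<nu> *\<^sub>C x" using x(3) TM[OF x(1)] by (simp add: Eid[OF x(1)])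
      then have "\<nu> \<in> S" using Mprops(3)[of x \<nu>] x(1,2) by simp
      then show ?thesis by (rule S(3))
    qed
    \<comment> \<open>With \<open>?F2\<close> in place of \<open>F\<close>, the perturbed operator \<open>(A + F) (I - E)\<close> vanishes on \<open>M\<close>; its determinant is the factor without the known zeros.\<close>
    let ?F2 = "F - ?TE"
    have F2: "?F2 \<in> finite_rank_ops" using F TE by simp
    define G where "G z = F o\<^sub>L (z *\<^sub>C V z)" for z
    define G2 where "G2 z = ?F2 o\<^sub>L (z *\<^sub>C V z)" for z
    define g where "g z = fr_det (G2 z) * exp (\<Sum>k = 1..<nat \<lceil>p\<rceil>. 1 / of_nat k * fr_trace (op_power (G z) k))" for z
    have fac: "fr_det_reg p (G z) = g z * (\<Prod>\<nu>\<leftarrow>\<nu>s. 1 - z * \<nu>)" if z: "cmod z < \<rho>'" for z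
    proof -
      have "blinfun_apply E (blinfun_apply (A + F) (blinfun_apply E x)) = blinfun_apply (A + F) (blinfun_apply E x)" for x
        by (rule Eid[OF TMM[OF EM]])
      from fr_det_invariant_factor[OF A F E this inv[OF z]]
      have "fr_det (G z) = fr_det (G2 z) * (\<Prod>\<nu>\<leftarrow>\<nu>s. 1 - z * \<nu>)"
        using \<nu>s(3) by (simp only: G_def G2_def V_def)
      then show ?thesis by (simp add: fr_det_reg_def g_def)
    qed
    have hol: "g holomorphic_on ball 0 \<rho>'"
    proof -
      have i: "id_blinfun - z *\<^sub>C A \<in> invertibles" if "z \<in> ball 0 \<rho>'" for z using inv that by simp
      obtain u where "holomorphic_family u (range (blinfun_apply F)) G (ball 0 \<rho>')"
        using resolvent_family[OF A F open_ball i, folded V_def, folded G_def] by blast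
      then interpret f1: holomorphic_family u "range (blinfun_apply F)" G "ball 0 \<rho>'" .
      obtain u2 where "holomorphic_family u2 (range (blinfun_apply ?F2)) G2 (ball 0 \<rho>')"
        using resolvent_family[OF A F2 open_ball i, folded V_def, folded G2_def] by blast
      then interpret f2: holomorphic_family u2 "range (blinfun_apply ?F2)" G2 "ball 0 \<rho>'" .
      show ?thesis unfolding g_def[abs_def]
        by (intro holomorphic_intros f1.holomorphic_trace_power f2.holomorphic_det) auto
    qed
    have g0: "g 0 = 1"
    proof -
      have z: "G 0 = 0" "G2 0 = 0" by (auto simp: G_def G2_def intro!: blinfun_eqI)
      have "fr_det_reg p (0 :: 'a \<Rightarrow>\<^sub>L 'a) = exp (\<Sum>k = 1..<nat \<lceil>p\<rceil>. 1 / of_nat k * fr_trace (op_power (0 :: 'a \<Rightarrow>\<^sub>L 'a) k))"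
        by (simp add: fr_det_reg_def)
      then show ?thesis by (simp add: g_def z fr_det_reg_zero)
    qed
    have bound: "cmod (g z * (\<Prod>\<nu>\<leftarrow>\<nu>s. 1 - z * \<nu>)) \<le> exp (\<Lambda> + \<eta>) + C' * (q * (2 * \<eta>))" if z: "cmod z = 1 / t" for z
    proof -
      note zc = circ[OF z]
      have Bz: "z *\<^sub>C V z \<in> bounded_ops" using Vb[OF zc(2)] by simp
      define L where "L = K o\<^sub>L (z *\<^sub>C V z)"
      have L: "L \<in> \<I>" unfolding L_def by (rule ideal_comp_right(1)[OF K Bz])
      have NL: "N L \<le> c * N K"
        using ideal_comp_right(2)[OF K Bz] mult_left_mono[OF zc(1) N_nonneg[OF K]] by (simp add: L_def mult.commute)
      obtain F' where F': "F' \<in> finite_rank_ops" "N (F' - L) < \<eta>" "cmod (fr_det_reg p F') \<le> exp (det_type * N L powr p + \<eta>)"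
        using approximation_with_determinant_bound[OF L \<eta>(1)] by blast
      have F'I: "F' \<in> \<I>" by (rule ideal_finite_rank[OF F'(1)])
      have Gz: "G z \<in> finite_rank_ops" using F Bz by (simp add: G_def)
      have I: "F' - L \<in> \<I>" "G z - L \<in> \<I>" "L - F' \<in> \<I>"
        using ideal_closed(2)[OF F'I L] ideal_closed(2)[OF ideal_finite_rank[OF Gz] L] ideal_closed(2)[OF L F'I] by auto
      have NF': "N F' \<le> q * (c * N K + 1)"
      proof -
        have "N (L + (F' - L)) \<le> q * (N L + N (F' - L))" by (rule q(2)[OF L I(1)])
        also have "\<dots> \<le> q * (c * N K + 1)" using NL F'(2) \<eta>1(2) q(1) by (intro mult_left_mono add_mono) auto
        finally show ?thesis by simp
      qed
      have NGF: "N (G z - F') \<le> q * (2 * \<eta>)"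
      proof -
        have "G z - L = (F - K) o\<^sub>L (z *\<^sub>C V z)"
          by (rule blinfun_eqI) (simp add: G_def L_def blinfun.diff_left)
        then have "N (G z - L) \<le> N (F - K) * norm (z *\<^sub>C V z)" using ideal_comp_right(2)[OF FKI Bz] by simp
        also have "\<dots> \<le> N (F - K) * c" using zc(1) N_nonneg[OF FKI] by (intro mult_left_mono)
        also have "\<dots> \<le> \<eta>" by (rule NFK)
        finally have 1: "N (G z - L) \<le> \<eta>" .
        have "N ((G z - L) + (L - F')) \<le> q * (N (G z - L) + N (L - F'))" by (rule q(2)[OF I(2,3)])
        also have "\<dots> \<le> q * (\<eta> + \<eta>)"
          using 1 F'(2) N_minus_commute[OF L F'I] q(1) by (intro mult_left_mono add_mono) auto
        finally show ?thesis by simp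
      qed
      have "cmod (fr_det_reg p (G z)) \<le> cmod (fr_det_reg p F') + cmod (fr_det_reg p (G z) - fr_det_reg p F')"
        using norm_triangle_ineq[of "fr_det_reg p F'" "fr_det_reg p (G z) - fr_det_reg p F'"] by simp
      also have "\<dots> \<le> exp (\<Lambda> + \<eta>) + C' * (q * (2 * \<eta>))"
      proof (rule add_mono)
        have "N L powr p \<le> (c * N K) powr p" using NL N_nonneg[OF L] p by (intro powr_mono2) auto
        then have "det_type * N L powr p \<le> \<Lambda>" unfolding \<Lambda>_def using det_type_nonneg by (intro mult_left_mono)
        then show "cmod (fr_det_reg p F') \<le> exp (\<Lambda> + \<eta>)" using F'(3) by (meson add_right_mono exp_le_cancel_iff order_trans)
        have "cmod (fr_det_reg p (G z) - fr_det_reg p F') \<le> C' * N (G z - F')"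
          using NGF \<eta>1(1) by (intro lip[OF F'(1) Gz NF']) simp
        also have "\<dots> \<le> C' * (q * (2 * \<eta>))" using NGF C' by (intro mult_left_mono)
        finally show "cmod (fr_det_reg p (G z) - fr_det_reg p F') \<le> C' * (q * (2 * \<eta>))" .
      qed
      finally show ?thesis unfolding fac[OF zc(2)] .
    qed
    have "(s * (1 / t)) ^ length \<nu>s \<le> exp (\<Lambda> + \<eta>) + C' * (q * (2 * \<eta>))"
      by (rule zero_count_jensen[OF hol _ \<rho>'(1) g0 bound s \<nu>s_big]) (use t in auto)
    then show ?thesis by (simp add: \<nu>s(1))
  qed
  have "((\<lambda>\<eta>. exp (\<Lambda> + \<eta>) + C' * (q * (2 * \<eta>))) \<longlongrightarrow> exp (\<Lambda> + 0) + C' * (q * (2 * 0))) (at_right 0)"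
    by (intro tendsto_intros)
  moreover have "\<forall>\<^sub>F \<eta> in at_right 0. (s / t) ^ n \<le> exp (\<Lambda> + \<eta>) + C' * (q * (2 * \<eta>))"
  proof -
    have "0 < 1 / (4 * q)" using q(1) by simp
    then show ?thesis
      unfolding eventually_at_right_field using step by (intro exI[of _ "1 / (4 * q)"]) auto
  qed
  ultimately have "(s / t) ^ n \<le> exp (\<Lambda> + 0) + C' * (q * (2 * 0))"
    by (rule tendsto_lowerbound) simp
  then show ?thesis by (simp add: n_def T_def \<Lambda>_def c_def)
qed

end

section \<open>Optimization over the radius\<close>

text \<open>With \<open>x = R / s\<close>, Jensen's inequality on the circle of radius \<open>t = s u\<close> bounds the number of eigenvalues by a
  constant times \<open>1 / (s\<^sup>p jensen_weight p x u)\<close>; so this weight is to be maximized over \<open>u \<in> (x, 1)\<close>.\<close>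

definition jensen_weight :: "real \<Rightarrow> real \<Rightarrow> real \<Rightarrow> real"
  where "jensen_weight p x u = (u - x) powr p * (- ln u)"

lemma Lambert_W_properties:
  assumes "0 \<le> y"
  shows "0 \<le> Lambert_W y \<and> Lambert_W y * exp (Lambert_W y) = y"
proof -
  have mono: "v * exp v < w * exp w" if "0 \<le> v" "v < w" for v w :: real
    using that by (intro mult_strict_mono') auto
  have "\<exists>w\<ge>0. w \<le> y \<and> w * exp w = y"
  proof (rule IVT')
    have "y * 1 \<le> y * exp y" using assms by (intro mult_left_mono) auto
    then show "y \<le> y * exp y" by simp
  qed (use assms in \<open>auto intro!: continuous_intros\<close>)
  then obtain w where w: "0 \<le> w" "w * exp w = y" by blast
  have "v = w" if "0 \<le> v \<and> v * exp v = y" for v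
    using mono[of v w] mono[of w v] that w by (metis less_irrefl linorder_neqE)
  then have "\<exists>!w. 0 \<le> w \<and> w * exp w = y" using w by blast
  then show ?thesis unfolding Lambert_W_def by (rule theI')
qed

lemma Lambert_W_less:
  assumes "0 \<le> y" "y < w * exp w" "0 \<le> w"
  shows "Lambert_W y < w"
proof (rule ccontr)
  assume "\<not> ?thesis"
  then have "w * exp w \<le> Lambert_W y * exp (Lambert_W y)" using assms(3) by (intro mult_mono) auto
  then show False using Lambert_W_properties[OF assms(1)] assms(2) by simp
qed

text \<open>If \<open>w\<close> is the value of the Lambert function, then \<open>u = exp (w - 1 / p)\<close> satisfies \<open>x = p w u = u (1 + p ln u)\<close>, the
  equation for critical points of the weight, and \<open>u - x = u p (1 / p - w)\<close>.\<close>

lemma Phi_formula_eq: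
  assumes p: "0 < p" and x: "0 < x" "x < 1"
  defines "w \<equiv> Lambert_W (1 / p * exp (1 / p) * x)"
  shows "0 < w" "w < 1 / p" "x = p * w * exp (w - 1 / p)"
    "Phi_formula p x = 1 / jensen_weight p x (exp (w - 1 / p))"
proof -
  let ?y = "1 / p * exp (1 / p) * x"
  have y: "0 < ?y" using p x by simp
  have W: "0 \<le> w" "w * exp w = ?y" using Lambert_W_properties[of ?y] y by (auto simp: w_def)
  show w0: "0 < w" using W y by (metis less_eq_real_def mult_zero_left less_irrefl)
  have "1 / p * exp (1 / p) * x < 1 / p * exp (1 / p) * 1" using p x by (intro mult_strict_left_mono) auto
  then show w1: "w < 1 / p" unfolding w_def using y p by (intro Lambert_W_less) auto
  let ?u = "exp (w - 1 / p)"
  have "p * w * ?u = p * (w * exp w) * exp (- (1 / p))" by (simp add: exp_diff exp_minus field_simps)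
  also have "\<dots> = x * (exp (1 / p) * exp (- (1 / p)))" unfolding W using p by simp
  also have "\<dots> = x" by (simp add: exp_add[symmetric])
  finally show xu: "x = p * w * ?u" by simp
  define d where "d = 1 / p - w"
  have d: "0 < d" using w1 by (simp add: d_def)
  have "?u - x = ?u * (p * d)" using p by (subst xu) (simp add: d_def algebra_simps)
  then have "(?u - x) powr p = ?u powr p * (p powr p * d powr p)" using p d by (simp add: powr_mult)
  moreover have "- ln ?u = d" by (simp add: d_def)
  ultimately have 1: "jensen_weight p x ?u = ?u powr p * (p powr p * d powr p) * d"
    by (simp only: jensen_weight_def)
  have 2: "x powr p = p powr p * w powr p * ?u powr p" using p w0 by (subst xu) (simp add: powr_mult)
  have 3: "d powr (p + 1) = d powr p * d" using d by (simp add: powr_add)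
  have 4: "Phi_formula p x = w powr p / ((d powr p * d) * (p powr p * w powr p * ?u powr p))"
    unfolding Phi_formula_def w_def[symmetric] d_def[symmetric] 2 3 ..
  show "Phi_formula p x = 1 / jensen_weight p x ?u"
    unfolding 1 4 using p d w0 by simp
qed

text \<open>As \<open>x\<close> tends to 0 so does \<open>w\<close>, and the maximizer tends to \<open>exp (- 1 / p)\<close>.\<close>

lemma Phi_zero:
  assumes p: "0 < p"
  shows "Phi p 0 = 1 / jensen_weight p 0 (exp (- (1 / p)))"
proof -
  define W where "W x = Lambert_W (1 / p * exp (1 / p) * x)" for x
  have pos: "\<forall>\<^sub>F x in at_right (0::real). 0 < x \<and> x < 1"
    by (auto simp: eventually_at_right_field intro!: exI[of _ 1])
  have W0: "(W \<longlongrightarrow> 0) (at_right 0)"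
  proof (rule tendsto_sandwich[of "\<lambda>_. 0" W _ "\<lambda>x. 1 / p * exp (1 / p) * x"])
    show "\<forall>\<^sub>F x in at_right 0. 0 \<le> W x" using pos
      by eventually_elim (use p Phi_formula_eq(1)[OF p] in \<open>auto simp: W_def intro: less_imp_le\<close>)
    show "\<forall>\<^sub>F x in at_right 0. W x \<le> 1 / p * exp (1 / p) * x" using pos
    proof eventually_elim
      case (elim x)
      then have y: "0 \<le> 1 / p * exp (1 / p) * x" using p by simp
      have "W x * 1 \<le> W x * exp (W x)" using Lambert_W_properties[OF y] by (intro mult_left_mono) (auto simp: W_def)
      then show ?case using Lambert_W_properties[OF y] by (simp add: W_def)
    qed
    have "((\<lambda>x. 1 / p * exp (1 / p) * x) \<longlongrightarrow> 1 / p * exp (1 / p) * 0) (at_right 0)" by (intro tendsto_intros)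
    then show "((\<lambda>x. 1 / p * exp (1 / p) * x) \<longlongrightarrow> 0) (at_right 0)" by simp
  qed simp
  have ev: "\<forall>\<^sub>F x in at_right 0. 1 / ((p powr p * (1 / p - W x) powr p * exp (W x - 1 / p) powr p) * (1 / p - W x)) = Phi_formula p x"
    using pos
  proof eventually_elim
    case (elim x)
    note P = Phi_formula_eq[OF p conjunct1[OF elim] conjunct2[OF elim], folded W_def]
    have "exp (W x - 1 / p) - x = exp (W x - 1 / p) * (p * (1 / p - W x))"
      using p by (subst (2) P(3)) (simp add: algebra_simps)
    moreover have "0 < 1 / p - W x" using P(2) by simp
    ultimately have "(exp (W x - 1 / p) - x) powr p = exp (W x - 1 / p) powr p * (p powr p * (1 / p - W x) powr p)"
      using p by (simp add: powr_mult)
    then show ?case unfolding P(4) jensen_weight_def by (simp add: mult_ac)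
  qed
  have "((\<lambda>x. 1 / ((p powr p * (1 / p - W x) powr p * exp (W x - 1 / p) powr p) * (1 / p - W x))) \<longlongrightarrow>
    1 / ((p powr p * (1 / p - 0) powr p * exp (0 - 1 / p) powr p) * (1 / p - 0))) (at_right 0)"
    using p by (intro tendsto_intros W0) auto
  then have "(Phi_formula p \<longlongrightarrow> 1 / ((p powr p * (1 / p - 0) powr p * exp (0 - 1 / p) powr p) * (1 / p - 0))) (at_right 0)"
    by (rule Lim_transform_eventually[OF _ ev])
  then have "Phi p 0 = 1 / ((p powr p * (1 / p - 0) powr p * exp (0 - 1 / p) powr p) * (1 / p - 0))"
    unfolding Phi_def using tendsto_Lim[of "at_right (0::real)"] by simp
  also have "p powr p * (1 / p - 0) powr p = 1" using p by (simp add: powr_mult[symmetric])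
  finally show ?thesis by (simp add: jensen_weight_def)
qed

lemma Phi_minimizer:
  assumes p: "0 < p" and x: "0 \<le> x" "x < 1"
  shows "\<exists>u. x < u \<and> u < 1 \<and> x = u * (1 + p * ln u) \<and> Phi p x = 1 / jensen_weight p x u"
proof (cases "x = 0")
  case True
  then show ?thesis using Phi_zero[OF p] p by (intro exI[of _ "exp (- (1 / p))"]) auto
next
  case False
  then have x0: "0 < x" using x by simp
  note P = Phi_formula_eq[OF p x0 x(2)]
  define w where "w = Lambert_W (1 / p * exp (1 / p) * x)"
  let ?u = "exp (w - 1 / p)"
  have xe: "x = ?u * (1 + p * ln ?u)" using P(3) p by (simp add: w_def algebra_simps)
  have "p * w < 1" using P(2) p by (simp add: w_def field_simps)
  then have "p * w * ?u < 1 * ?u" by (intro mult_strict_right_mono) auto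
  then have "x < ?u" using P(3) unfolding w_def[symmetric] by linarith
  moreover have "?u < 1" using P(2) by (simp add: w_def)
  moreover have "Phi p x = 1 / jensen_weight p x ?u"
    using P(4) False by (simp only: Phi_def w_def if_False)
  ultimately show ?thesis using xe by (intro exI[of _ ?u] conjI)
qed

text \<open>The derivative of the weight at \<open>y\<close> has the sign of \<open>x - k(y)\<close>, where \<open>k(y) = y (1 + p ln y)\<close>. Where \<open>1 + p ln y\<close> is
  negative, \<open>k\<close> is negative; elsewhere \<open>k\<close> increases. As \<open>k(u) = x \<ge> 0\<close>, the weight increases up to \<open>u\<close> and
  decreases afterwards.\<close>

lemma Phi_le:
  assumes p: "0 < p" and x: "0 \<le> x" "x < 1" and v: "x < v" "v < 1"
  shows "Phi p x \<le> 1 / jensen_weight p x v"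
proof -
  obtain u where u: "x < u" "u < 1" and xu: "x = u * (1 + p * ln u)" and Phi: "Phi p x = 1 / jensen_weight p x u"
    using Phi_minimizer[OF p x] by blast
  define k where "k y = y * (1 + p * ln y)" for y
  have deriv: "(jensen_weight p x has_real_derivative (y - x) powr (p - 1) / y * (x - k y)) (at y)" if y: "x < y" for y
  proof -
    have y0: "0 < y" using y x by simp
    have "(jensen_weight p x has_real_derivative (p * (y - x) powr (p - 1)) * (- ln y) + (y - x) powr p * (- (1 / y))) (at y)"
      unfolding jensen_weight_def[abs_def] using y y0 by (auto intro!: derivative_eq_intros)
    moreover have "(y - x) powr p = (y - x) powr (p - 1) * (y - x)"
      using y by (simp add: powr_diff field_simps)
    ultimately show ?thesis using y0 by (simp add: k_def field_simps)
  qed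
  have u0: "0 < u" using u x by simp
  have su: "0 \<le> 1 + p * ln u" using xu x(1) u0 by (simp add: zero_le_mult_iff)
  have kle: "k y \<le> x" if "x < y" "y \<le> u" for y
  proof (cases "0 \<le> 1 + p * ln y")
    case True
    have "ln y \<le> ln u" using that x by simp
    then have "k y \<le> k u" unfolding k_def using True that x u0 p by (intro mult_mono) auto
    then show ?thesis using xu by (simp add: k_def)
  next
    case False
    then have "k y \<le> 0" unfolding k_def using that x by (intro mult_nonneg_nonpos) auto
    then show ?thesis using x by simp
  qed
  have kge: "x \<le> k y" if "u \<le> y" for y
  proof -
    have "ln u \<le> ln y" using that u0 by simp
    then have "k u \<le> k y" unfolding k_def using that u0 su p by (intro mult_mono) auto
    then show ?thesis using xu by (simp add: k_def)
  qed
  have "jensen_weight p x v \<le> jensen_weight p x u"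
  proof (cases "v \<le> u")
    case True
    then show ?thesis
    proof (rule DERIV_nonneg_imp_nondecreasing)
      fix y assume y: "v \<le> y" "y \<le> u"
      then have "0 \<le> (y - x) powr (p - 1) / y * (x - k y)" using v x kle[of y] by (intro mult_nonneg_nonneg) auto
      then show "\<exists>d. (jensen_weight p x has_real_derivative d) (at y) \<and> 0 \<le> d" using deriv[of y] y v by auto
    qed
  next
    case False
    then have "u \<le> v" by simp
    then show ?thesis
    proof (rule DERIV_nonpos_imp_nonincreasing)
      fix y assume y: "u \<le> y" "y \<le> v"
      then have "(y - x) powr (p - 1) / y * (x - k y) \<le> 0" using u0 kge[of y] by (intro mult_nonneg_nonpos) auto
      then show "\<exists>d. (jensen_weight p x has_real_derivative d) (at y) \<and> d \<le> 0" using deriv[of y] y u by auto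
    qed
  qed
  moreover have "0 < jensen_weight p x v"
    unfolding jensen_weight_def using v x by (intro mult_pos_pos) auto
  ultimately show ?thesis unfolding Phi by (intro divide_left_mono) auto
qed

text \<open>The point \<open>v = (p + x) / (p + 1)\<close> maximizes \<open>(v - x)\<^sup>p (1 - v)\<close>, a lower bound of the weight because \<open>- ln v \<ge> 1 - v\<close>.\<close>

lemma Phi_upper_bound:
  assumes p: "0 < p" and x: "0 \<le> x" "x < 1"
  shows "Phi p x \<le> (p + 1) powr (p + 1) / p powr p / (1 - x) powr (p + 1)"
proof -
  define v where "v = (p + x) / (p + 1)"
  have v1: "v - x = p * (1 - x) / (p + 1)" "1 - v = (1 - x) / (p + 1)"
    using p by (simp_all add: v_def field_simps)
  have v: "x < v" "v < 1" using v1 p x by (smt (verit) divide_pos_pos mult_pos_pos)+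
  have v0: "0 < v" using v x by simp
  have "(v - x) powr p * (1 - v) \<le> jensen_weight p x v"
    unfolding jensen_weight_def using ln_le_minus_one[OF v0] by (intro mult_left_mono) auto
  moreover have w: "(v - x) powr p * (1 - v) = p powr p * (1 - x) powr (p + 1) / (p + 1) powr (p + 1)"
  proof -
    have "(p * (1 - x) / (p + 1)) powr p = p powr p * (1 - x) powr p / (p + 1) powr p"
      using p x by (simp only: powr_divide powr_mult)
    moreover have "(1 - x) powr (p + 1) = (1 - x) powr p * (1 - x)" "(p + 1) powr (p + 1) = (p + 1) powr p * (p + 1)"
      using p x by (simp_all add: powr_add)
    ultimately show ?thesis unfolding v1 by simp
  qed
  moreover have "0 < (v - x) powr p * (1 - v)" using v by simp
  ultimately have "1 / jensen_weight p x v \<le> 1 / (p powr p * (1 - x) powr (p + 1) / (p + 1) powr (p + 1))"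
    by (intro frac_le) simp_all
  then show ?thesis using Phi_le[OF p x v] by (simp add: mult.commute)
qed

section \<open>The eigenvalue estimate\<close>

theorem theorem6p5:
  fixes p R s C\<^sub>A \<gamma> \<Gamma> :: real
    and \<I> :: "('a::complex_banach \<Rightarrow>\<^sub>L 'a) set"
    and N :: "('a \<Rightarrow>\<^sub>L 'a) \<Rightarrow> real"
    and A K :: "'a \<Rightarrow>\<^sub>L 'a"
  assumes "0 < p"
    and "lp_ideal p \<I> N \<gamma>"
    and "0 < \<Gamma>"
    and "\<forall>F \<in> (finite_rank_ops :: ('a \<Rightarrow>\<^sub>L 'a) set). cmod (fr_det_reg p F) \<le>
      exp (\<Gamma> * (\<Sum>\<^sub>\<infinity>\<mu> \<in> discrete_eigenvalues F. real (alg_mult F \<mu>) * cmod \<mu> powr p))"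
    and "A \<in> bounded_ops"
    and "K \<in> \<I>"
    and "op_spectral_radius A \<le> R"
    and "0 < C\<^sub>A"
    and "\<forall>\<mu>. R < cmod \<mu> \<longrightarrow> norm (resolvent_op A \<mu>) \<le> C\<^sub>A / (cmod \<mu> - R)"
    and "R < s"
  shows "eigenvalue_count (A + K) s
      \<le> ennreal (C\<^sub>A powr p * \<gamma> powr p * \<Gamma> * (1 / s powr p) * Phi p (R / s) * N K powr p)
    \<and> C\<^sub>A powr p * \<gamma> powr p * \<Gamma> * (1 / s powr p) * Phi p (R / s) * N K powr p
      \<le> C\<^sub>A powr p * \<gamma> powr p * \<Gamma> * ((p + 1) powr (p + 1) / p powr p)
         * (s / (s - R) powr (p + 1)) * N K powr p"
proof -
  interpret det_ideal p \<I> N \<gamma> \<Gamma>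
    using assms(1-4) by (auto simp: det_ideal_def det_ideal_axioms_def)
  have R0: "0 \<le> R" and spec: "\<And>\<mu>. R < cmod \<mu> \<Longrightarrow> \<mu> \<notin> op_spectrum A"
    using spectral_radius_bound[OF assms(5,7)] by auto
  have s: "0 < s" using R0 assms(10) by simp
  define x where "x = R / s"
  have x: "0 \<le> x" "x < 1" using R0 s assms(10) by (auto simp: x_def)
  have NK: "0 \<le> N K" by (rule N_nonneg[OF assms(6)])
  obtain u where u: "x < u" "u < 1" and Phi: "Phi p x = 1 / jensen_weight p x u"
    using Phi_minimizer[OF p x] by blast
  have u0: "0 < u" using u x by simp
  let ?c = "C\<^sub>A powr p * \<gamma> powr p * \<Gamma>"
  define b where "b = ?c * (1 / s powr p) * Phi p x * N K powr p"
  have finite_bound: "real (\<Sum>\<mu>\<in>S. alg_mult (A + K) \<mu>) \<le> b"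
    if S: "finite S" "S \<subseteq> {\<mu> \<in> discrete_eigenvalues (A + K). s < cmod \<mu>}" for S
  proof -
    let ?n = "\<Sum>\<mu>\<in>S. alg_mult (A + K) \<mu>"
    define t where "t = u * s"
    have t: "R < t" "0 < t" using u(1) u0 s by (auto simp: t_def x_def field_simps)
    have tR: "t - R = s * (u - x)" using s by (simp add: t_def x_def field_simps)
    have "(s / t) ^ ?n \<le> exp (det_type * (C\<^sub>A / (t - R) * N K) powr p)"
      by (rule eigenvalue_count_bound[OF assms(5,6) R0 t(1) assms(8) spec]) (use assms(9) S s in auto)
    then have "ln ((s / t) ^ ?n) \<le> det_type * (C\<^sub>A / (t - R) * N K) powr p"
      using s t by (subst ln_exp[symmetric], subst ln_le_cancel_iff) auto
    moreover have "ln ((s / t) ^ ?n) = real ?n * (- ln u)"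
      using s u0 by (simp add: t_def ln_realpow ln_div)
    moreover have "(C\<^sub>A / (t - R) * N K) powr p = C\<^sub>A powr p * N K powr p / (s powr p * (u - x) powr p)"
      unfolding tR using assms(8) NK s u by (simp add: powr_mult powr_divide)
    ultimately have "real ?n * (- ln u) \<le> det_type * (C\<^sub>A powr p * N K powr p / (s powr p * (u - x) powr p))"
      by simp
    moreover have lu: "0 < - ln u" using u u0 by simp
    ultimately have "real ?n \<le> det_type * (C\<^sub>A powr p * N K powr p / (s powr p * (u - x) powr p)) / (- ln u)"
      by (simp only: pos_le_divide_eq)
    also have "\<dots> = b"
      by (simp add: b_def Phi jensen_weight_def det_type_def mult_ac)
    finally show ?thesis .
  qed
  have "eigenvalue_count (A + K) s \<le> ennreal b"
    unfolding eigenvalue_count_def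
  proof (subst nonneg_infsum_complete, simp, rule SUP_least)
    fix S assume "S \<in> {F. finite F \<and> F \<subseteq> {\<mu> \<in> discrete_eigenvalues (A + K). s < cmod \<mu>}}"
    then have "real (\<Sum>\<mu>\<in>S. alg_mult (A + K) \<mu>) \<le> b" by (intro finite_bound) auto
    then have le: "ennreal (real (\<Sum>\<mu>\<in>S. alg_mult (A + K) \<mu>)) \<le> ennreal b" by (rule ennreal_leI)
    have "(\<Sum>\<mu>\<in>S. of_nat (alg_mult (A + K) \<mu>)) = (of_nat (\<Sum>\<mu>\<in>S. alg_mult (A + K) \<mu>) :: ennreal)"
      by (rule of_nat_sum[symmetric])
    also have "\<dots> = ennreal (real (\<Sum>\<mu>\<in>S. alg_mult (A + K) \<mu>))"
      by (rule ennreal_of_nat_eq_real_of_nat)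
    finally show "(\<Sum>\<mu>\<in>S. of_nat (alg_mult (A + K) \<mu>)) \<le> ennreal b" using le by simp
  qed
  moreover have "b \<le> ?c * ((p + 1) powr (p + 1) / p powr p) * (s / (s - R) powr (p + 1)) * N K powr p"
  proof -
    have "1 - x = (s - R) / s" using s by (simp add: x_def field_simps)
    then have "(1 - x) powr (p + 1) = (s - R) powr (p + 1) / (s powr p * s)"
      using s assms(10) by (simp add: powr_divide powr_add)
    then have "Phi p x \<le> (p + 1) powr (p + 1) / p powr p * (s powr p * s / (s - R) powr (p + 1))"
      using Phi_upper_bound[OF p x] by simp
    then have "1 / s powr p * Phi p x \<le> 1 / s powr p * ((p + 1) powr (p + 1) / p powr p * (s powr p * s / (s - R) powr (p + 1)))"
      by (intro mult_left_mono) auto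
    also have "\<dots> = (p + 1) powr (p + 1) / p powr p * (s / (s - R) powr (p + 1))" using s by simp
    finally have "?c * (1 / s powr p * Phi p x) * N K powr p \<le> ?c * ((p + 1) powr (p + 1) / p powr p * (s / (s - R) powr (p + 1))) * N K powr p"
      using \<Gamma> by (intro mult_right_mono mult_left_mono) auto
    then show ?thesis by (simp only: b_def mult.assoc)
  qed
  ultimately show ?thesis by (simp only: b_def x_def)
qed

end
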